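(* Let $\Omega\subset\mathbb{R}^d$ be open, $V\in C^\infty(\Omega,\mathbb{C})$, $\lambda\in\mathbb{C}$ with $|\lambda|\ge1$, and let $\psi_\lambda$ be a smooth solution of $(-\Delta+V)\psi_\lambda=\lambda\psi_\lambda$ on $\Omega$. Let $\delta>0$ and let $\alpha=\alpha(\delta)\in\mathbb{N}$ be chosen with $\alpha(\delta)>d/\delta$. Then for every $r>0$ and every ball $B(x_0,r)\subset\Omega$, $$|\psi_\lambda(x_0)|\lesssim\left(r^{-2\alpha(\delta)}+|\lambda|^{(d-1+\delta)/4}\right)\|\psi_\lambda\|_{L^2(B(x_0,r))},$$ where the dependence on $r$ is explicit, i.e. the implied constant does not depend on $r$ or $\lambda$. Hence, if the radius $r=r(\lambda)$ is allowed to decay slowly with $\lambda$, in the sense that $r^{-1}=|\lambda|^{o(1)}$ as $\lambda\to\infty$, then the contribution of the term $r^{-2\alpha(\delta)}$ remains negligible compared to the main term $O_\varepsilon(|\lambda|^{(d-1)/4+\varepsilon})$ when choosing $\delta=4\varepsilon$.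
   Context: $\Delta=\sum_{j=1}^d\partial_{x_j}^2$, and $B(x_0,r)$ is the Euclidean ball of center $x_0$ and radius $r$. $A\lesssim B$ means $A\le CB$ for a constant $C$.
   Formalization: The first bound assumes in addition d ≤ 4α (automatic for δ ≤ 4), since otherwise it fails as r → 0; the implied constant is uniform for x_0 in each compact subset of Ω, as uniformity over all of Ω fails for unbounded V. *)

theory Defs
  imports "HOL-Analysis.Analysis" "HOL-Library.Landau_Symbols"
begin

definition partial_deriv :: "'d::finite \<Rightarrow> (real^'d \<Rightarrow> complex) \<Rightarrow> real^'d \<Rightarrow> complex" where
  "partial_deriv j f x = frechet_derivative f (at x) (axis j 1)"

definition laplacian :: "(real^'d::finite \<Rightarrow> complex) \<Rightarrow> real^'d \<Rightarrow> complex" where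
  "laplacian f x = (\<Sum>j\<in>UNIV. partial_deriv j (partial_deriv j f) x)"

text \<open>Only meant for open sets: derivatives are taken at \<open>x\<close> in the full space, so a function is
  not required to be regular, or even measurable, outside \<open>S\<close>.\<close>

primrec Ck_on :: "nat \<Rightarrow> (real^'d::finite) set \<Rightarrow> (real^'d \<Rightarrow> complex) \<Rightarrow> bool" where
  "Ck_on 0 S f \<longleftrightarrow> continuous_on S f"
| "Ck_on (Suc k) S f \<longleftrightarrow>
     (\<forall>x\<in>S. f differentiable (at x)) \<and> (\<forall>j. Ck_on k S (partial_deriv j f))"

definition smooth_on :: "(real^'d::finite) set \<Rightarrow> (real^'d \<Rightarrow> complex) \<Rightarrow> bool" where
  "smooth_on S f \<longleftrightarrow> (\<forall>k. Ck_on k S f)"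

definition smooth_eigensolution ::
  "(real^'d::finite) set \<Rightarrow> (real^'d \<Rightarrow> complex) \<Rightarrow> complex \<Rightarrow> (real^'d \<Rightarrow> complex) \<Rightarrow> bool" where
  "smooth_eigensolution \<Omega> V lam \<psi> \<longleftrightarrow>
     smooth_on \<Omega> \<psi> \<and> (\<forall>x\<in>\<Omega>. - laplacian \<psi> x + V x * \<psi> x = lam * \<psi> x)"

text \<open>The norm takes values in \<open>[0, \<infinity>]\<close>: a smooth solution on \<open>\<Omega>\<close> need not be square integrable
  on a ball that touches the boundary of \<open>\<Omega>\<close>, and the real-valued integral would then be \<open>0\<close>.\<close>

definition L2_norm_on :: "(real^'d::finite) set \<Rightarrow> (real^'d \<Rightarrow> complex) \<Rightarrow> ennreal" where
  "L2_norm_on S f =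
     (let I = (\<integral>\<^sup>+x\<in>S. ennreal ((cmod (f x))\<^sup>2) \<partial>lebesgue)
      in if I = \<infinity> then \<infinity> else ennreal (sqrt (enn2real I)))"

text \<open>The limit \<open>lam \<rightarrow> \<infinity>\<close> (that is, \<open>|lam| \<rightarrow> \<infinity>\<close>) along a set \<open>\<Lambda>\<close> of spectral parameters.\<close>

definition at_infinity_in :: "complex set \<Rightarrow> complex filter" where
  "at_infinity_in \<Lambda> = inf at_infinity (principal \<Lambda>)"

text \<open>\<open>r(lam)\<^sup>-\<^sup>1 = |lam|\<^bsup>o(1)\<^esup>\<close> as \<open>lam \<rightarrow> \<infinity>\<close> in \<open>\<Lambda>\<close>.\<close>

definition slowly_decaying :: "complex set \<Rightarrow> (complex \<Rightarrow> real) \<Rightarrow> bool" where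
  "slowly_decaying \<Lambda> r \<longleftrightarrow>
     (\<exists>\<eta> :: complex \<Rightarrow> real. \<eta> \<in> o[at_infinity_in \<Lambda>](\<lambda>_. 1) \<and>
        (\<forall>\<^sub>F lam in at_infinity_in \<Lambda>. inverse (r lam) = cmod lam powr \<eta> lam))"

end

theory Submission
  imports Defs
begin

text \<open>
  Let \<open>lam = \<kappa>\<^sup>2\<close> with \<open>Im \<kappa> \<ge> 0\<close>, let \<open>k = \<bar>\<kappa>\<bar>\<close>, and let \<open>d\<close> be the dimension. Both parts of the theorem follow
  from the estimate
    \<open>\<bar>\<psi> x0\<bar>\<^sup>2 \<le> C (k powr (d - 1) / r + 1 / r powr d) * (integral of \<bar>\<psi>\<bar>\<^sup>2 over the ball of radius r)\<close>
  for small \<open>r\<close> (lemma \<open>interior_bound\<close>), which has no loss in the exponent. The term \<open>1 / r powr d\<close> is the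
  usual interior estimate and matters only below the wavelength \<open>1 / k\<close>. For larger \<open>r\<close> the reason is that
  averages of \<open>\<psi>\<close> over spheres about \<open>x0\<close> behave like a Bessel function with value \<open>\<psi> x0\<close> at the centre:
  they decay no faster than \<open>\<bar>\<psi> x0\<bar> (k t) powr (- (d - 1) / 2)\<close>, and the square of this has integral of order
  \<open>\<bar>\<psi> x0\<bar>\<^sup>2 r / k powr (d - 1)\<close> over the ball.

  Surface integrals and Bessel functions are avoided. The integrals \<open>M t\<close> of \<open>\<psi> (x0 + t y)\<close> over the unit
  ball satisfy the radial equation of dimension \<open>d + 2\<close> (\<open>ball_mean_deriv\<close>, \<open>ball_mean2_laplacian_deriv\<close>);
  this needs only one integration by parts, with a weight that vanishes on the sphere
  (\<open>ball_integral_by_parts\<close>). In terms of \<open>w = t powr ((d + 1) / 2) M\<close> it reads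
  \<open>w'' = (c / t\<^sup>2 - \<kappa>\<^sup>2) w + F\<close>, where \<open>F\<close> contains the potential. Since \<open>w\<close> is regular at the origin, an energy flux
  identity shows that its incoming part \<open>w' - \<i> \<kappa> w\<close> dominates \<open>w\<close> (\<open>flux_bound\<close>), for every complex \<open>\<kappa>\<close>
  in the closed upper half-plane. The incoming part, multiplied by \<open>exp (\<i> \<kappa> t)\<close>, is nearly constant in \<open>t\<close>.
  Far away its average is controlled by the \<open>L\<^sup>2\<close> norm of \<open>\<psi>\<close>, hence it is controlled down to the
  scale \<open>1 / k\<close> (\<open>w_decay\<close>, \<open>mean_decay\<close>). Below this scale the difference between \<open>M\<close> and its value at the centre is a
  small multiple of the supremum of \<open>\<bar>\<psi>\<bar>\<close> (\<open>value_le_mean\<close>), which is absorbed by a weighted maximum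
  argument in \<open>interior_bound\<close>.

  The \<open>\<delta>\<close> of the theorem is spent on the factor \<open>1 / r\<close>: it is either at most \<open>\<bar>lam\<bar> powr (\<delta> / 2)\<close>, or so large that a
  power of it dominates everything (\<open>power_tradeoff\<close>). If \<open>1 / r\<close> is \<open>\<bar>lam\<bar>\<close> to the power \<open>o(1)\<close>, then all fixed powers of
  \<open>1 / r\<close> are negligible (\<open>slowly_decaying_power\<close>), so the second part follows from the first with a larger
  \<open>\<alpha>\<close>.
\<close>

section \<open>The radial wave equation\<close>

text \<open>A wave that is regular at the origin cannot consist of its outgoing part alone. The quantity
  \<open>Im (cnj \<kappa> (w' cnj w - q \<bar>w\<bar>\<^sup>2 / t))\<close> is the energy flux through the sphere of radius \<open>t\<close>. It vanishes at \<open>0\<close>,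
  and along the flow only the inhomogeneity \<open>F\<close> can increase it, since the remaining terms of its
  derivative form \<open>- Im \<kappa>\<close> times a sum of squares. Writing \<open>w' = \<i> \<kappa> w + v\<close> in the flux produces
  \<open>\<bar>w\<bar>\<^sup>2\<close> and a term linear in the incoming part \<open>v\<close>, so that \<open>v\<close> controls \<open>w\<close>. The argument is
  insensitive to the sign of \<open>Re \<kappa>\<close> and to the size of \<open>Im \<kappa> \<ge> 0\<close>.\<close>

lemma flux_bound:
  fixes w w1 F :: "real \<Rightarrow> complex" and \<kappa> :: complex and q R P :: real
  assumes \<kappa>: "cmod \<kappa> = 1" "Im \<kappa> \<ge> 0" and q: "q \<ge> 1"
    and w: "\<And>t. 0 < t \<Longrightarrow> t \<le> R \<Longrightarrow> (w has_vector_derivative w1 t) (at t)"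
    and w1: "\<And>t. 0 < t \<Longrightarrow> t \<le> R \<Longrightarrow>
      (w1 has_vector_derivative ((q * (q - 1) / t\<^sup>2) *\<^sub>R w t - \<kappa>\<^sup>2 * w t + F t)) (at t)"
    and F: "\<And>t. 0 < t \<Longrightarrow> t \<le> R \<Longrightarrow> cmod (F t) * cmod (w t) \<le> P * t"
    and lim1: "((\<lambda>t. w1 t * cnj (w t)) \<longlongrightarrow> 0) (at_right 0)"
    and lim2: "((\<lambda>t. (cmod (w t))\<^sup>2 / t) \<longlongrightarrow> 0) (at_right 0)"
    and t: "0 < t" "t \<le> R"
  shows "(cmod (w t))\<^sup>2 \<le> cmod (w1 t - \<i> * \<kappa> * w t) * cmod (w t) + P * t\<^sup>2 / 2"
proof -
  define J where "J = (\<lambda>s. Im (cnj \<kappa> * (w1 s * cnj (w s))) + Im \<kappa> * q * ((cmod (w s))\<^sup>2 / s) - P * s\<^sup>2 / 2)"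
  have absq: "(cmod z)\<^sup>2 = Re (z * cnj z)" for z
    by (simp only: cmod_power2) (simp add: power2_eq_square)
  have k2: "(Re \<kappa>)\<^sup>2 + (Im \<kappa>)\<^sup>2 = 1"
    using \<kappa>(1) by (metis cmod_power2 power_one)
  have dJ: "\<exists>D. (J has_real_derivative D) (at s) \<and> D \<le> 0" if s: "0 < s" "s \<le> R" for s
  proof -
    define D1 where "D1 = w1 s * cnj (w1 s) + ((q * (q - 1) / s\<^sup>2) *\<^sub>R w s - \<kappa>\<^sup>2 * w s + F s) * cnj (w s)"
    have "((\<lambda>s. w1 s * cnj (w s)) has_vector_derivative D1) (at s)"
      unfolding D1_def by (rule has_vector_derivative_mult[OF w1[OF s] has_vector_derivative_cnj[OF w[OF s]]])
    then have "((\<lambda>s. cnj \<kappa> * (w1 s * cnj (w s))) has_vector_derivative cnj \<kappa> * D1) (at s)"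
      by (rule has_vector_derivative_mult_right)
    then have d1: "((\<lambda>s. Im (cnj \<kappa> * (w1 s * cnj (w s)))) has_real_derivative Im (cnj \<kappa> * D1)) (at s)"
      unfolding has_real_derivative_iff_has_vector_derivative
      by (rule bounded_linear.has_vector_derivative[OF bounded_linear_Im])
    define D2 where "D2 = 2 * Re (w1 s * cnj (w s))"
    have "((\<lambda>s. w s * cnj (w s)) has_vector_derivative w s * cnj (w1 s) + w1 s * cnj (w s)) (at s)"
      by (rule has_vector_derivative_mult[OF w[OF s] has_vector_derivative_cnj[OF w[OF s]]])
    then have "((\<lambda>s. Re (w s * cnj (w s))) has_vector_derivative Re (w s * cnj (w1 s) + w1 s * cnj (w s))) (at s)"
      by (rule bounded_linear.has_vector_derivative[OF bounded_linear_Re])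
    then have d2: "((\<lambda>s. (cmod (w s))\<^sup>2) has_real_derivative D2) (at s)"
      unfolding has_real_derivative_iff_has_vector_derivative absq D2_def
      by (simp add: mult.commute)
    have d: "(J has_real_derivative Im (cnj \<kappa> * D1) + Im \<kappa> * q * ((D2 * s - (cmod (w s))\<^sup>2) / s\<^sup>2) - P * s) (at s)"
      unfolding J_def
    proof (intro DERIV_diff DERIV_add d1 DERIV_cmult)
      show "((\<lambda>s. (cmod (w s))\<^sup>2 / s) has_real_derivative (D2 * s - (cmod (w s))\<^sup>2) / s\<^sup>2) (at s)"
        using DERIV_divide[OF d2 DERIV_ident] s by (simp add: power2_eq_square)
      show "((\<lambda>s. P * s\<^sup>2 / 2) has_real_derivative P * s) (at s)"
        by (auto intro!: derivative_eq_intros)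
    qed
    \<comment> \<open>The squares complete because the potential is \<open>q (q - 1)\<close> and \<open>q (q - 1) + q = q\<^sup>2\<close>.\<close>
    have "Im (cnj \<kappa> * D1) + Im \<kappa> * q * ((D2 * s - (cmod (w s))\<^sup>2) / s\<^sup>2)
       = Im (cnj \<kappa> * (F s * cnj (w s))) - Im \<kappa> * ((cmod (w s))\<^sup>2 + (cmod (w1 s - (q / s) *\<^sub>R w s))\<^sup>2)"
    proof -
      define r where "r = 1 / s"
      have r: "q * (q - 1) / s\<^sup>2 = q * (q - 1) * r\<^sup>2" "q / s = q * r"
        "(D2 * s - (cmod (w s))\<^sup>2) / s\<^sup>2 = D2 * r - (cmod (w s))\<^sup>2 * r\<^sup>2"
        using s by (simp_all add: r_def field_simps power2_eq_square)
      have "cnj \<kappa> * \<kappa> = 1"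
        using \<kappa>(1) by (simp add: complex_norm_square[symmetric] mult.commute)
      then have kk: "cnj \<kappa> * (\<kappa>\<^sup>2 * z) = \<kappa> * z" for z
        by (simp add: power2_eq_square mult.assoc[symmetric])
      have D1: "cnj \<kappa> * D1 = cnj \<kappa> * (w1 s * cnj (w1 s) + (q * (q - 1) * r\<^sup>2) *\<^sub>R (w s * cnj (w s)))
          + cnj \<kappa> * (F s * cnj (w s)) - \<kappa> * (w s * cnj (w s))"
        unfolding D1_def r(1) unfolding ring_distribs by (simp add: kk mult.assoc)
      obtain a b where ab: "w s = Complex a b" by (cases "w s")
      obtain a1 b1 where ab1: "w1 s = Complex a1 b1" by (cases "w1 s")
      show ?thesis
        unfolding r D1 unfolding D2_def ab ab1
        by (simp add: cmod_power2) (simp add: power2_eq_square algebra_simps)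
    qed
    moreover have "Im (cnj \<kappa> * (F s * cnj (w s))) \<le> P * s"
      using F[OF s] abs_Im_le_cmod[of "cnj \<kappa> * (F s * cnj (w s))"] \<kappa>(1) by (simp add: norm_mult)
    moreover have "Im \<kappa> * ((cmod (w s))\<^sup>2 + (cmod (w1 s - (q / s) *\<^sub>R w s))\<^sup>2) \<ge> 0"
      using \<kappa>(2) by simp
    ultimately show ?thesis using d by (intro exI conjI) (assumption, linarith)
  qed
  have mono: "J t \<le> J s" if s: "0 < s" "s < t" for s
  proof (rule DERIV_nonpos_imp_nonincreasing[of s t J])
    show "s \<le> t" using s by simp
    fix x assume "s \<le> x" "x \<le> t"
    then show "\<exists>y. (J has_real_derivative y) (at x) \<and> y \<le> 0"
      using dJ[of x] s t by auto
  qed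
  have "(J \<longlongrightarrow> Im (cnj \<kappa> * 0) + Im \<kappa> * q * 0 - P * 0\<^sup>2 / 2) (at_right 0)"
    unfolding J_def by (intro tendsto_intros lim1 lim2) simp
  then have "(J \<longlongrightarrow> 0) (at_right 0)" by simp
  moreover have "\<forall>\<^sub>F s in at_right 0. J t \<le> J s"
    using eventually_at_right_real[OF t(1)] by eventually_elim (use mono in auto)
  ultimately have "J t \<le> 0" by (intro tendsto_lowerbound[of J 0 "at_right 0"]) auto
  moreover have "Im (cnj \<kappa> * (w1 t * cnj (w t))) =
      (cmod (w t))\<^sup>2 + Im (cnj \<kappa> * ((w1 t - \<i> * \<kappa> * w t) * cnj (w t)))"
  proof -
    have "cnj \<kappa> * (w1 t * cnj (w t)) = cnj \<kappa> * ((w1 t - \<i> * \<kappa> * w t) * cnj (w t))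
        + \<i> * ((\<kappa> * cnj \<kappa>) * (w t * cnj (w t)))"
      by (simp add: algebra_simps)
    also have "\<kappa> * cnj \<kappa> = 1" using \<kappa>(1) by (simp add: complex_norm_square[symmetric])
    finally show ?thesis by (simp add: complex_norm_square[symmetric])
  qed
  moreover have "\<bar>Im (cnj \<kappa> * ((w1 t - \<i> * \<kappa> * w t) * cnj (w t)))\<bar> \<le> cmod (w1 t - \<i> * \<kappa> * w t) * cmod (w t)"
    using abs_Im_le_cmod[of "cnj \<kappa> * ((w1 t - \<i> * \<kappa> * w t) * cnj (w t))"] \<kappa>(1) by (simp add: norm_mult)
  moreover have "Im \<kappa> * q * ((cmod (w t))\<^sup>2 / t) \<ge> 0" using \<kappa>(2) q t by simp
  ultimately show ?thesis unfolding J_def by linarith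
qed


lemma norm_diff_le_of_vector_derivative_bound:
  fixes f :: "real \<Rightarrow> complex" and g g' :: "real \<Rightarrow> real"
  assumes "a \<le> b"
    and f: "\<And>x. a \<le> x \<Longrightarrow> x \<le> b \<Longrightarrow> (f has_vector_derivative f' x) (at x)"
    and g: "\<And>x. a \<le> x \<Longrightarrow> x \<le> b \<Longrightarrow> (g has_real_derivative g' x) (at x)"
    and le: "\<And>x. a \<le> x \<Longrightarrow> x \<le> b \<Longrightarrow> cmod (f' x) \<le> g' x"
  shows "cmod (f b - f a) \<le> g b - g a"
proof (cases "a = b")
  case False
  then have "a < b" using assms(1) by simp
  have cf: "continuous_on {a..b} f"
    by (intro continuous_at_imp_continuous_on ballI has_vector_derivative_continuous) (use f in auto)
  have cg: "continuous_on {a..b} g"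
    by (intro continuous_at_imp_continuous_on ballI DERIV_isCont) (use g in auto)
  show ?thesis
    by (rule differentiable_bound_general[OF \<open>a < b\<close> cf cg, where f' = f' and \<phi>' = g'])
       (use f g le in \<open>auto simp: has_real_derivative_iff_has_vector_derivative\<close>)
qed auto

lemma le_add_sqrt_of_square_le:
  fixes x y z :: real
  assumes "x\<^sup>2 \<le> y * x + z\<^sup>2" "x \<ge> 0" "y \<ge> 0" "z \<ge> 0"
  shows "x \<le> y + z"
proof (rule ccontr)
  assume "\<not> x \<le> y + z"
  then have "y + z < x" by simp
  then have "z * z < (x - y) * x" using assms by (intro mult_strict_mono) auto
  then show False using assms(1) by (simp add: power2_eq_square algebra_simps)
qed

text \<open>This is the radial equation after scaling lengths by \<open>\<bar>\<kappa>\<bar>\<close>. In the application \<open>w\<close> is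
  \<open>t powr q\<close> times a ball mean of the eigenfunction, \<open>A\<close> is its \<open>L\<^sup>2\<close> norm up to a factor,
  \<open>F\<close> comes from the potential \<open>V\<close> with \<open>\<bar>V\<bar> \<le> Q\<^sup>2\<close>, and \<open>R\<close> is the scaled radius of the ball. The bound
  \<open>w_le\<close> is only what the Cauchy-Schwarz inequality gives; the aim is the improvement of \<open>\<bar>w b\<bar>\<close> to
  order \<open>A / sqrt R\<close>.\<close>

locale radial_wave =
  fixes w w1 F :: "real \<Rightarrow> complex" and \<kappa> :: complex and q R A Q c :: real
  assumes \<kappa>: "cmod \<kappa> = 1" "Im \<kappa> \<ge> 0" and q: "q \<ge> 1" and c_def: "c = q * (q - 1)"
    and AQ: "A \<ge> 0" "Q \<ge> 0"
    and w: "\<And>t. 0 < t \<Longrightarrow> t \<le> R \<Longrightarrow> (w has_vector_derivative w1 t) (at t)"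
    and w1: "\<And>t. 0 < t \<Longrightarrow> t \<le> R \<Longrightarrow>
      (w1 has_vector_derivative ((c / t\<^sup>2) *\<^sub>R w t - \<kappa>\<^sup>2 * w t + F t)) (at t)"
    and w_le: "\<And>t. 0 < t \<Longrightarrow> t \<le> R \<Longrightarrow> cmod (w t) \<le> A * sqrt t"
    and F_le: "\<And>t. 0 < t \<Longrightarrow> t \<le> R \<Longrightarrow> cmod (F t) \<le> Q\<^sup>2 * A / R\<^sup>2 * sqrt t"
    and lim1: "((\<lambda>t. w1 t * cnj (w t)) \<longlongrightarrow> 0) (at_right 0)"
    and lim2: "((\<lambda>t. (cmod (w t))\<^sup>2 / t) \<longlongrightarrow> 0) (at_right 0)"
begin

lemma c_nonneg: "c \<ge> 0"
  using q by (simp add: c_def)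

text \<open>\<open>W\<close> is the incoming component of \<open>w\<close> with its phase removed; it would be constant if both \<open>c\<close> and
  \<open>F\<close> vanished. As \<open>Im \<kappa> \<ge> 0\<close>, the factor \<open>E\<close> is bounded, which keeps all estimates uniform in \<open>\<kappa>\<close>.\<close>

definition E where "E t = exp (t *\<^sub>R (\<i> * \<kappa>))"

definition W where "W t = E t * (w1 t - \<i> * \<kappa> * w t)"

lemma E_le: "t \<ge> 0 \<Longrightarrow> cmod (E t) \<le> 1"
  using \<kappa> by (simp add: E_def norm_exp_eq_Re)

lemma E_ge: "t \<ge> 0 \<Longrightarrow> cmod (E t) \<ge> exp (- t)"
  using \<kappa> abs_Im_le_cmod[of \<kappa>] by (simp add: E_def norm_exp_eq_Re mult_left_le)

lemma E_deriv: "(E has_vector_derivative E t * (\<i> * \<kappa>)) (at t)"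
  unfolding E_def by (rule exp_scaleR_has_vector_derivative_right)

lemma E_w_le:
  assumes t: "0 < t" "t \<le> R"
  shows "cmod (E t * w t) \<le> cmod (W t) + Q * A * sqrt t / sqrt R"
proof -
  have "cmod (F s) * cmod (w s) \<le> (Q\<^sup>2 * A\<^sup>2 / R\<^sup>2) * s" if s: "0 < s" "s \<le> R" for s
  proof -
    have "cmod (F s) * cmod (w s) \<le> (Q\<^sup>2 * A / R\<^sup>2 * sqrt s) * (A * sqrt s)"
      using F_le[OF s] w_le[OF s] AQ s by (intro mult_mono) auto
    also have "\<dots> = (Q\<^sup>2 * A\<^sup>2 / R\<^sup>2) * s"
    proof -
      have "(Q\<^sup>2 * A / y * x) * (A * x) = (Q\<^sup>2 * A\<^sup>2 / y) * (x * x)" for x y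
        by (simp add: power2_eq_square)
      from this[of "R\<^sup>2" "sqrt s"] s show ?thesis by (simp only: real_sqrt_mult_self abs_of_pos)
    qed
    finally show ?thesis .
  qed
  from flux_bound[OF \<kappa> q w w1[unfolded c_def] this lim1 lim2 t]
  have "(cmod (w t))\<^sup>2 \<le> cmod (w1 t - \<i> * \<kappa> * w t) * cmod (w t) + Q\<^sup>2 * A\<^sup>2 / R\<^sup>2 * t\<^sup>2 / 2" .
  also have "Q\<^sup>2 * A\<^sup>2 / R\<^sup>2 * t\<^sup>2 / 2 = (Q * A * (t / R))\<^sup>2 / 2"
    by (simp add: power_mult_distrib power_divide)
  also have "(Q * A * (t / R))\<^sup>2 / 2 \<le> (Q * A * (t / R))\<^sup>2" by simp
  finally have "(cmod (w t))\<^sup>2 \<le> cmod (w1 t - \<i> * \<kappa> * w t) * cmod (w t) + (Q * A * (t / R))\<^sup>2"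
    by simp
  then have "cmod (w t) \<le> cmod (w1 t - \<i> * \<kappa> * w t) + Q * A * (t / R)"
    by (rule le_add_sqrt_of_square_le) (use AQ t in auto)
  also have "t / R \<le> sqrt (t / R)"
  proof -
    have "x * x \<le> x" if "0 \<le> x" "x \<le> 1" for x :: real using that by (simp add: mult_left_le)
    from this[of "t / R"] show ?thesis
      using t by (intro real_le_rsqrt) (simp add: power2_eq_square)
  qed
  finally have *: "cmod (w t) \<le> cmod (w1 t - \<i> * \<kappa> * w t) + Q * A * (sqrt t / sqrt R)"
    using AQ by (simp add: real_sqrt_divide mult_left_mono)
  have "cmod (E t * w t) \<le> cmod (E t) * (cmod (w1 t - \<i> * \<kappa> * w t) + Q * A * (sqrt t / sqrt R))"
    unfolding norm_mult by (rule mult_left_mono[OF *]) simp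
  also have "\<dots> \<le> cmod (W t) + 1 * (Q * A * (sqrt t / sqrt R))"
    unfolding W_def norm_mult distrib_left
    using E_le[of t] t AQ by (intro add_mono mult_right_mono) auto
  finally show ?thesis by simp
qed

lemma W_deriv:
  assumes t: "0 < t" "t \<le> R"
  shows "(W has_vector_derivative E t * ((c / t\<^sup>2) *\<^sub>R w t + F t)) (at t)"
proof -
  have "((\<lambda>t. w1 t - \<i> * \<kappa> * w t) has_vector_derivative
      ((c / t\<^sup>2) *\<^sub>R w t - \<kappa>\<^sup>2 * w t + F t) - \<i> * \<kappa> * w1 t) (at t)"
    by (intro has_vector_derivative_diff w1 has_vector_derivative_mult_right w t)
  from has_vector_derivative_mult[OF E_deriv this]
  have "((\<lambda>t. E t * (w1 t - \<i> * \<kappa> * w t)) has_vector_derivative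
      E t * (((c / t\<^sup>2) *\<^sub>R w t - \<kappa>\<^sup>2 * w t + F t) - \<i> * \<kappa> * w1 t) + E t * (\<i> * \<kappa>) * (w1 t - \<i> * \<kappa> * w t)) (at t)" .
  moreover have "E t * (((c / t\<^sup>2) *\<^sub>R w t - \<kappa>\<^sup>2 * w t + F t) - \<i> * \<kappa> * w1 t) + E t * (\<i> * \<kappa>) * (w1 t - \<i> * \<kappa> * w t)
    = E t * ((c / t\<^sup>2) *\<^sub>R w t + F t)"
    by (simp add: algebra_simps power2_eq_square)
  ultimately show ?thesis unfolding W_def[abs_def] by simp
qed

text \<open>\<open>e'\<close> bounds the part of \<open>\<bar>W'\<bar>\<close> that is not proportional to \<open>\<bar>W\<bar>\<close>: the error term of \<open>E_w_le\<close>, and \<open>F\<close>.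
  Only the variation of its antiderivative \<open>e\<close> matters, and this is \<open>O(A / sqrt R)\<close> on \<open>[b, R]\<close>.\<close>

definition P where "P = c * Q * A / sqrt R"
definition P' where "P' = Q\<^sup>2 * A / (R * sqrt R)"
definition e' where "e' t = P / (t * sqrt t) + P'"
definition e where "e t = - 2 * P * inverse (sqrt t) + P' * t"

lemma P_nonneg: "R > 0 \<Longrightarrow> P \<ge> 0" "R > 0 \<Longrightarrow> P' \<ge> 0"
  using c_nonneg AQ by (auto simp: P_def P'_def)

lemma e_deriv:
  assumes t: "t > 0"
  shows "(e has_real_derivative e' t) (at t)"
proof -
  have "((\<lambda>t. inverse (sqrt t)) has_real_derivative - (inverse (sqrt t) * (inverse (sqrt t) / 2) * inverse (sqrt t))) (at t)"
    using t by (intro DERIV_inverse' DERIV_real_sqrt) auto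
  then have "(e has_real_derivative - 2 * P * - (inverse (sqrt t) * (inverse (sqrt t) / 2) * inverse (sqrt t)) + P') (at t)"
    unfolding e_def[abs_def] by (intro DERIV_add DERIV_cmult DERIV_cmult_Id)
  moreover have "- 2 * P * - (inverse s * (inverse s / 2) * inverse s) = P / (s * s * s)" if "s > 0" for s
    using that by (simp add: field_simps)
  from this[of "sqrt t"]
  have "- 2 * P * - (inverse (sqrt t) * (inverse (sqrt t) / 2) * inverse (sqrt t)) = P / (t * sqrt t)"
    using t by simp
  ultimately show ?thesis by (simp add: e'_def)
qed

lemma W_deriv_le:
  assumes t: "0 < t" "t \<le> R"
  shows "cmod (E t * ((c / t\<^sup>2) *\<^sub>R w t + F t)) \<le> c / t\<^sup>2 * cmod (W t) + e' t"
proof -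
  have R: "R > 0" using t by simp
  have "cmod (E t * ((c / t\<^sup>2) *\<^sub>R w t + F t)) \<le> c / t\<^sup>2 * cmod (E t * w t) + cmod (E t) * cmod (F t)"
    using norm_triangle_ineq[of "E t * ((c / t\<^sup>2) *\<^sub>R w t)" "E t * F t"] c_nonneg
    by (simp add: norm_mult distrib_left mult.left_commute)
  also have "\<dots> \<le> c / t\<^sup>2 * (cmod (W t) + Q * A * sqrt t / sqrt R) + 1 * (Q\<^sup>2 * A / R\<^sup>2 * sqrt R)"
  proof (intro add_mono mult_left_mono mult_mono)
    show "cmod (F t) \<le> Q\<^sup>2 * A / R\<^sup>2 * sqrt R"
      by (rule order_trans[OF F_le[OF t]], rule mult_left_mono) (use t AQ in auto)
  qed (use c_nonneg t E_le[of t] E_w_le[OF t] in auto)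
  also have "\<dots> = c / t\<^sup>2 * cmod (W t) + e' t"
  proof -
    have "c / t\<^sup>2 * (Q * A * sqrt t / sqrt R) = P / (t * sqrt t)"
    proof -
      have "c / (s * s)\<^sup>2 * (Q * A * s / y) = c * Q * A / y / (s * s * s)" if "s > 0" for s y :: real
        using that by (simp add: power2_eq_square mult_ac)
      from this[of "sqrt t" "sqrt R"] show ?thesis using t by (simp add: P_def)
    qed
    moreover have "Q\<^sup>2 * A / R\<^sup>2 * sqrt R = P'"
    proof -
      have "Q\<^sup>2 * A / (s * s)\<^sup>2 * s = Q\<^sup>2 * A / (s * s * s)" if "s > 0" for s :: real
        using that by (simp add: power2_eq_square)
      from this[of "sqrt R"] show ?thesis using R by (simp add: P'_def)
    qed
    ultimately show ?thesis unfolding e'_def distrib_left by simp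
  qed
  finally show ?thesis .
qed

lemma e_diff_le:
  assumes "0 < b" "b \<le> s" "s \<le> t" "t \<le> R"
  shows "e t - e s \<le> (2 * c * Q / sqrt b + Q\<^sup>2) * A / sqrt R"
proof -
  have R: "R > 0" using assms by simp
  have "e t - e s = 2 * P / sqrt s - 2 * P / sqrt t + P' * (t - s)"
    by (simp add: e_def right_diff_distrib inverse_eq_divide)
  also have "\<dots> \<le> 2 * P / sqrt s + P' * (t - s)"
    using assms P_nonneg[OF R] by simp
  also have "\<dots> \<le> 2 * P / sqrt b + P' * R"
    using assms R P_nonneg[OF R] by (intro add_mono divide_left_mono mult_left_mono) auto
  also have "\<dots> = (2 * c * Q / sqrt b + Q\<^sup>2) * A / sqrt R"
  proof -
    have "2 * (c * Q * A / y) / x + Q\<^sup>2 * A / (R * y) * R = (2 * c * Q / x + Q\<^sup>2) * A / y" for x y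
      using R by (simp add: algebra_simps add_divide_distrib)
    then show ?thesis unfolding P_def P'_def .
  qed
  finally show ?thesis .
qed

lemma W_continuous: "0 < s \<Longrightarrow> t \<le> R \<Longrightarrow> continuous_on {s..t} (\<lambda>x. cmod (W x))"
  by (intro continuous_on_norm continuous_at_imp_continuous_on ballI
      has_vector_derivative_continuous[OF W_deriv]) auto

text \<open>For \<open>\<rho> \<ge> 4 c\<close> the potential \<open>c / t\<^sup>2\<close> is so weak that \<open>W\<close> stays close to \<open>W \<rho>\<close> on all of
  \<open>[\<rho>, R]\<close>. It therefore suffices to bound an average of \<open>W\<close> over \<open>[R / 2, R]\<close>. There
  \<open>W = 2 E w' - (E w)'\<close>, and both terms have small integrals: the first because \<open>w'\<close> does
  (hypothesis \<open>g_le\<close>), the second because it is a derivative. A bound of \<open>\<bar>W\<bar>\<close> by \<open>\<bar>w'\<bar> + \<bar>w\<bar>\<close>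
  would lose a factor \<open>R\<close>.\<close>

lemma far_zone:
  assumes \<rho>: "b > 0" "b \<le> \<rho>" "4 * c \<le> \<rho>" "2 * \<rho> \<le> R"
    and g: "\<And>t. R / 2 \<le> t \<Longrightarrow> t \<le> R \<Longrightarrow> (g has_real_derivative g' t) (at t)"
    and w1_le: "\<And>t. R / 2 \<le> t \<Longrightarrow> t \<le> R \<Longrightarrow> cmod (w1 t) \<le> g' t"
    and g_le: "g R - g (R / 2) \<le> B * A * sqrt R"
  shows "cmod (W \<rho>) \<le> (2 * (2 * c * Q / sqrt b + Q\<^sup>2) + 6 + 6 * B) * A / sqrt R"
proof -
  have pos: "\<rho> > 0" "R > 0" using \<rho> by auto
  define e0 where "e0 = (2 * c * Q / sqrt b + Q\<^sup>2) * A / sqrt R"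
  have "\<exists>x\<in>{\<rho>..R}. \<forall>y\<in>{\<rho>..R}. cmod (W y) \<le> cmod (W x)"
    by (rule continuous_attains_sup) (use \<rho> pos W_continuous in auto)
  then obtain x where x: "\<rho> \<le> x" "x \<le> R" and xmax: "\<And>y. \<rho> \<le> y \<Longrightarrow> y \<le> R \<Longrightarrow> cmod (W y) \<le> cmod (W x)"
    by auto
  define S where "S = cmod (W x)"
  have var: "cmod (W t - W \<rho>) \<le> S / 4 + e0" if t: "\<rho> \<le> t" "t \<le> R" for t
  proof -
    have "cmod (W t - W \<rho>) \<le> (- c * S / t + e t) - (- c * S / \<rho> + e \<rho>)"
    proof (rule norm_diff_le_of_vector_derivative_bound[OF t(1)])
      fix y assume y: "\<rho> \<le> y" "y \<le> t"
      then have yR: "0 < y" "y \<le> R" using t pos by auto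
      show "(W has_vector_derivative E y * ((c / y\<^sup>2) *\<^sub>R w y + F y)) (at y)"
        by (rule W_deriv[OF yR])
      show "((\<lambda>t. - c * S / t + e t) has_real_derivative c * S / y\<^sup>2 + e' y) (at y)"
        using yR pos by (auto intro!: derivative_eq_intros e_deriv simp: power2_eq_square)
      have "c / y\<^sup>2 * cmod (W y) \<le> c / y\<^sup>2 * S"
        unfolding S_def using y t c_nonneg by (intro mult_left_mono xmax) auto
      then show "cmod (E y * ((c / y\<^sup>2) *\<^sub>R w y + F y)) \<le> c * S / y\<^sup>2 + e' y"
        using W_deriv_le[OF yR] by simp
    qed
    also have "\<dots> \<le> c * S / \<rho> + (e t - e \<rho>)"
      using c_nonneg t pos by (simp add: S_def)
    also have "\<dots> \<le> S / 4 + e0"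
    proof (rule add_mono)
      show "c * S / \<rho> \<le> S / 4"
        using mult_right_mono[OF \<rho>(3), of S] pos by (simp add: field_simps S_def)
      show "e t - e \<rho> \<le> e0" unfolding e0_def using e_diff_le[OF \<rho>(1,2) t] by simp
    qed
    finally show ?thesis .
  qed
  have "S \<le> cmod (W \<rho>) + cmod (W x - W \<rho>)"
    unfolding S_def by (metis add.commute diff_add_cancel norm_triangle_ineq)
  with var[OF x] have S: "S \<le> 4 / 3 * (cmod (W \<rho>) + e0)" by simp
  define \<delta> where "\<delta> = cmod (W \<rho>) / 3 + 4 / 3 * e0"
  have var': "cmod (W t - W \<rho>) \<le> \<delta>" if t: "\<rho> \<le> t" "t \<le> R" for t
    using var[OF t] S unfolding \<delta>_def by simp
  \<comment> \<open>\<open>h\<close> is an antiderivative of \<open>W \<rho> - W + 2 E w'\<close>, so its increment carries the average of \<open>W\<close>.\<close>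
  define h where "h = (\<lambda>t. t *\<^sub>R W \<rho> + E t * w t)"
  have "cmod (h R - h (R / 2)) \<le> (\<delta> * R + 2 * g R) - (\<delta> * (R / 2) + 2 * g (R / 2))"
  proof (rule norm_diff_le_of_vector_derivative_bound)
    show "R / 2 \<le> R" using pos by simp
    fix t assume t: "R / 2 \<le> t" "t \<le> R"
    then have t': "0 < t" "\<rho> \<le> t" using pos \<rho> by auto
    show "((\<lambda>t. \<delta> * t + 2 * g t) has_real_derivative \<delta> + 2 * g' t) (at t)"
      using t by (auto intro!: derivative_eq_intros g)
    show "(h has_vector_derivative W \<rho> + (E t * w1 t + E t * (\<i> * \<kappa>) * w t)) (at t)"
      unfolding h_def
      by (auto intro!: derivative_eq_intros E_deriv w t t')
    have "W \<rho> + (E t * w1 t + E t * (\<i> * \<kappa>) * w t) = 2 * (E t * w1 t) - (W t - W \<rho>)"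
      by (simp add: W_def algebra_simps)
    then have "cmod (W \<rho> + (E t * w1 t + E t * (\<i> * \<kappa>) * w t)) \<le> cmod (2 * (E t * w1 t)) + cmod (W t - W \<rho>)"
      by (simp only: norm_triangle_ineq4)
    also have "\<dots> = 2 * (cmod (E t) * cmod (w1 t)) + cmod (W t - W \<rho>)"
      by (simp add: norm_mult)
    also have "\<dots> \<le> 2 * (1 * g' t) + \<delta>"
      using var'[OF t'(2) t(2)] E_le[of t] w1_le[OF t] t'
      by (intro add_mono mult_left_mono mult_mono) auto
    finally show "cmod (W \<rho> + (E t * w1 t + E t * (\<i> * \<kappa>) * w t)) \<le> \<delta> + 2 * g' t" by simp
  qed
  then have hd: "cmod (h R - h (R / 2)) \<le> \<delta> * (R / 2) + 2 * (B * A * sqrt R)"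
    using g_le by (simp add: algebra_simps)
  have Ew: "cmod (E t * w t) \<le> A * sqrt R" if "0 < t" "t \<le> R" for t
  proof -
    have "cmod (E t * w t) \<le> 1 * (A * sqrt t)"
      unfolding norm_mult using that E_le[of t] w_le[OF that] by (intro mult_mono) auto
    also have "\<dots> \<le> A * sqrt R" using that AQ by (simp add: mult_left_mono)
    finally show ?thesis .
  qed
  have "(R / 2) *\<^sub>R W \<rho> = (h R - h (R / 2)) - E R * w R + E (R / 2) * w (R / 2)"
    using scaleR_add_left[of "R / 2" "R / 2" "W \<rho>"] by (simp add: h_def algebra_simps)
  then have "cmod ((R / 2) *\<^sub>R W \<rho>) \<le> cmod (h R - h (R / 2)) + cmod (E R * w R) + cmod (E (R / 2) * w (R / 2))"
    using norm_triangle_ineq[of "h R - h (R / 2) - E R * w R" "E (R / 2) * w (R / 2)"]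
      norm_triangle_ineq4[of "h R - h (R / 2)" "E R * w R"] by simp
  also have "\<dots> \<le> \<delta> * (R / 2) + 2 * (B * A * sqrt R) + A * sqrt R + A * sqrt R"
    using hd pos by (intro add_mono Ew) auto
  also have "\<dots> = (R / 2) * \<delta> + (2 * B + 2) * A * sqrt R" by (simp add: algebra_simps)
  also have "(2 * B + 2) * A * sqrt R = (R / 2) * ((4 * B + 4) * A / sqrt R)"
  proof -
    have "x / 2 * ((4 * B + 4) * A / s) = (2 * B + 2) * A * (x / s)" for x s :: real
      by (simp add: algebra_simps add_divide_distrib)
    from this[of R "sqrt R"] show ?thesis using pos by (simp add: real_div_sqrt)
  qed
  finally have "(R / 2) * cmod (W \<rho>) \<le> (R / 2) * (\<delta> + (4 * B + 4) * A / sqrt R)"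
    using pos by (simp add: distrib_left)
  then have "cmod (W \<rho>) \<le> \<delta> + (4 * B + 4) * A / sqrt R"
    using pos by simp
  moreover have "x \<le> 2 * y + 3 / 2 * z" if "x \<le> (x / 3 + 4 / 3 * y) + z" for x y z :: real
    using that by simp
  ultimately have "cmod (W \<rho>) \<le> 2 * e0 + 3 / 2 * ((4 * B + 4) * A / sqrt R)"
    unfolding \<delta>_def by blast
  also have "\<dots> = (2 * (2 * c * Q / sqrt b + Q\<^sup>2) + 6 + 6 * B) * A / sqrt R"
    unfolding e0_def by (simp add: algebra_simps add_divide_distrib)
  finally show ?thesis .
qed

text \<open>Between \<open>b\<close> and \<open>\<rho>\<close> the potential is not small, but the interval has bounded length. Maximising
  \<open>\<bar>W\<bar>\<close> with the weight \<open>exp (2 K t)\<close> replaces the backward Gronwall inequality: the weight makes the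
  contribution of the potential at most half of the maximum.\<close>

lemma near_zone:
  assumes \<rho>: "b > 0" "b \<le> \<rho>" "\<rho> \<le> R"
  shows "cmod (W b) \<le> 2 * exp (2 * (c / b\<^sup>2) * \<rho>) * (cmod (W \<rho>) + (2 * c * Q / sqrt b + Q\<^sup>2) * A / sqrt R)"
proof -
  have pos: "\<rho> > 0" "R > 0" using \<rho> by auto
  define K where "K = c / b\<^sup>2"
  have K: "K \<ge> 0" using c_nonneg by (simp add: K_def)
  define e0 where "e0 = (2 * c * Q / sqrt b + Q\<^sup>2) * A / sqrt R"
  have e0: "e0 \<ge> 0" unfolding e0_def using c_nonneg AQ \<rho> pos by simp
  have "\<exists>x\<in>{b..\<rho>}. \<forall>y\<in>{b..\<rho>}. exp (2 * K * y) * cmod (W y) \<le> exp (2 * K * x) * cmod (W x)"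
  proof (rule continuous_attains_sup)
    show "continuous_on {b..\<rho>} (\<lambda>x. exp (2 * K * x) * cmod (W x))"
      using \<rho> by (intro continuous_on_mult W_continuous) (auto intro!: continuous_intros)
  qed (use \<rho> in auto)
  then obtain x where x: "b \<le> x" "x \<le> \<rho>"
    and xmax: "\<And>y. b \<le> y \<Longrightarrow> y \<le> \<rho> \<Longrightarrow> exp (2 * K * y) * cmod (W y) \<le> exp (2 * K * x) * cmod (W x)"
    by auto
  define S where "S = exp (2 * K * x) * cmod (W x)"
  have "cmod (W \<rho> - W x) \<le> (- (S / 2) * exp (- 2 * K * \<rho>) + e \<rho>) - (- (S / 2) * exp (- 2 * K * x) + e x)"
  proof (rule norm_diff_le_of_vector_derivative_bound[OF x(2)])
    fix y assume y: "x \<le> y" "y \<le> \<rho>"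
    then have yR: "0 < y" "y \<le> R" "b \<le> y" using \<rho> x by auto
    show "(W has_vector_derivative E y * ((c / y\<^sup>2) *\<^sub>R w y + F y)) (at y)"
      by (rule W_deriv[OF yR(1,2)])
    show "((\<lambda>t. - (S / 2) * exp (- 2 * K * t) + e t) has_real_derivative K * (S * exp (- 2 * K * y)) + e' y) (at y)"
      using yR pos by (auto intro!: derivative_eq_intros e_deriv)
    have "cmod (W y) = exp (- 2 * K * y) * (exp (2 * K * y) * cmod (W y))"
      by (simp add: exp_minus)
    also have "\<dots> \<le> exp (- 2 * K * y) * S"
      unfolding S_def using y yR by (intro mult_left_mono xmax) auto
    finally have "c / y\<^sup>2 * cmod (W y) \<le> K * (exp (- 2 * K * y) * S)"
      unfolding K_def using c_nonneg yR \<rho>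
      by (intro mult_mono divide_left_mono power_mono) auto
    then show "cmod (E y * ((c / y\<^sup>2) *\<^sub>R w y + F y)) \<le> K * (S * exp (- 2 * K * y)) + e' y"
      using W_deriv_le[OF yR(1,2)] by (simp add: mult.commute)
  qed
  also have "\<dots> \<le> S / 2 * exp (- 2 * K * x) + (e \<rho> - e x)"
    by (simp add: S_def)
  also have "\<dots> \<le> S / 2 * exp (- 2 * K * x) + e0"
    unfolding e0_def using e_diff_le[OF \<rho>(1) x(1,2) \<rho>(3)] by simp
  also have "S / 2 * exp (- 2 * K * x) = cmod (W x) / 2"
    by (simp add: S_def exp_minus)
  finally have "cmod (W x) \<le> cmod (W \<rho>) + (cmod (W x) / 2 + e0)"
    using norm_triangle_ineq2[of "W x" "W \<rho>"] by (simp add: norm_minus_commute)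
  then have Wx: "cmod (W x) \<le> 2 * (cmod (W \<rho>) + e0)" by simp
  have "cmod (W b) \<le> exp (2 * K * b) * cmod (W b)"
    using mult_right_mono[of 1 "exp (2 * K * b)" "cmod (W b)"] K \<rho> by simp
  also have "\<dots> \<le> exp (2 * K * x) * cmod (W x)" using xmax[of b] \<rho> by simp
  also have "\<dots> \<le> exp (2 * K * \<rho>) * (2 * (cmod (W \<rho>) + e0))"
    using K x Wx by (intro mult_mono) (auto intro!: mult_left_mono)
  finally show ?thesis unfolding K_def e0_def by (simp only: mult_ac)
qed

lemma w_decay:
  assumes \<rho>: "b > 0" "b \<le> \<rho>" "4 * c \<le> \<rho>" "2 * \<rho> \<le> R"
    and g: "\<And>t. R / 2 \<le> t \<Longrightarrow> t \<le> R \<Longrightarrow> (g has_real_derivative g' t) (at t)"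
    and w1_le: "\<And>t. R / 2 \<le> t \<Longrightarrow> t \<le> R \<Longrightarrow> cmod (w1 t) \<le> g' t"
    and g_le: "g R - g (R / 2) \<le> B * A * sqrt R"
  shows "cmod (w b) \<le> exp b * (2 * exp (2 * (c / b\<^sup>2) * \<rho>) * (3 * (2 * c * Q / sqrt b + Q\<^sup>2) + 6 + 6 * B) + Q * sqrt b) * (A / sqrt R)"
proof -
  have bR: "b \<le> R" "0 \<le> b" using \<rho> by auto
  define e0 where "e0 = 2 * c * Q / sqrt b + Q\<^sup>2"
  have "exp (- b) * cmod (w b) \<le> cmod (E b * w b)"
    unfolding norm_mult using E_ge[of b] \<rho> by (intro mult_right_mono) auto
  also have "\<dots> \<le> cmod (W b) + Q * A * sqrt b / sqrt R"
    using \<rho> by (intro E_w_le) auto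
  also have "cmod (W b) \<le> 2 * exp (2 * (c / b\<^sup>2) * \<rho>) * (cmod (W \<rho>) + e0 * A / sqrt R)"
    unfolding e0_def using \<rho> by (intro near_zone) auto
  also have "cmod (W \<rho>) \<le> (2 * e0 + 6 + 6 * B) * A / sqrt R"
    unfolding e0_def by (rule far_zone[OF \<rho> g w1_le g_le])
  finally have "exp (- b) * cmod (w b) \<le> 2 * exp (2 * (c / b\<^sup>2) * \<rho>) * ((2 * e0 + 6 + 6 * B) * A / sqrt R + e0 * A / sqrt R)
      + Q * A * sqrt b / sqrt R"
    by simp
  also have "\<dots> = (2 * exp (2 * (c / b\<^sup>2) * \<rho>) * (3 * e0 + 6 + 6 * B) + Q * sqrt b) * (A / sqrt R)"
    by (simp add: algebra_simps add_divide_distrib)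
  finally have "exp b * (exp (- b) * cmod (w b)) \<le> exp b * \<dots>"
    by (rule mult_left_mono) simp
  moreover have "exp b * (exp (- b) * cmod (w b)) = cmod (w b)"
    by (simp add: exp_minus)
  ultimately show ?thesis unfolding e0_def by (simp only: mult.assoc)
qed

end

section \<open>Integrals over the unit ball\<close>

lemma norm_diff_le_of_vector_derivative_le:
  fixes f :: "real \<Rightarrow> complex"
  assumes "\<And>x. x \<in> closed_segment a b \<Longrightarrow> (f has_vector_derivative f' x) (at x)"
    and "\<And>x. x \<in> closed_segment a b \<Longrightarrow> cmod (f' x) \<le> C"
  shows "cmod (f b - f a) \<le> C * \<bar>b - a\<bar>"
proof -
  have "norm (f b - f a) \<le> C * norm (b - a)"
  proof (rule differentiable_bound)
    show "(f has_derivative (\<lambda>h. h *\<^sub>R f' x)) (at x within closed_segment a b)" if "x \<in> closed_segment a b" for x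
      using assms(1)[OF that] unfolding has_vector_derivative_def by (rule has_derivative_at_withinI)
    show "onorm (\<lambda>h. h *\<^sub>R f' x) \<le> C" if "x \<in> closed_segment a b" for x
      using assms(2)[OF that]
      by (intro onorm_le) (simp add: mult.commute[of C] mult_left_mono)
  qed auto
  then show ?thesis by simp
qed

lemma has_vector_derivative_iff_quotient:
  fixes f :: "real \<Rightarrow> 'a::real_normed_vector"
  shows "(f has_vector_derivative D) (at t) \<longleftrightarrow> ((\<lambda>h. (f (t + h) - f t) /\<^sub>R h) \<longlongrightarrow> D) (at 0)"
proof -
  have "(f has_vector_derivative D) (at t) \<longleftrightarrow> ((\<lambda>h. norm (f (t + h) - f t - h *\<^sub>R D) / norm h) \<longlongrightarrow> 0) (at 0)"
    unfolding has_vector_derivative_def has_derivative_at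
    by (simp add: bounded_linear_scaleR_left)
  also have "\<dots> \<longleftrightarrow> ((\<lambda>h. norm ((f (t + h) - f t) /\<^sub>R h - D)) \<longlongrightarrow> 0) (at 0)"
  proof (rule tendsto_cong)
    have "norm (f (t + h) - f t - h *\<^sub>R D) / norm h = norm ((f (t + h) - f t) /\<^sub>R h - D)" if "h \<noteq> 0" for h
    proof -
      have "(f (t + h) - f t) /\<^sub>R h - D = (f (t + h) - f t - h *\<^sub>R D) /\<^sub>R h"
        using that by (simp add: scaleR_diff_right)
      then show ?thesis by (simp add: divide_inverse mult.commute)
    qed
    then show "\<forall>\<^sub>F h in at 0. norm (f (t + h) - f t - h *\<^sub>R D) / norm h = norm ((f (t + h) - f t) /\<^sub>R h - D)"
      by (simp add: eventually_at_filter)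
  qed
  also have "\<dots> \<longleftrightarrow> ((\<lambda>h. (f (t + h) - f t) /\<^sub>R h) \<longlongrightarrow> D) (at 0)"
    by (simp add: tendsto_norm_zero_iff Lim_null[symmetric])
  finally show ?thesis .
qed

text \<open>Differentiability is required only almost everywhere, in exchange for a Lipschitz bound. This
  covers functions cut off to zero outside a ball, which are not differentiable on its boundary.\<close>

lemma has_vector_derivative_lebesgue_integral:
  fixes F :: "real \<Rightarrow> 'a \<Rightarrow> complex"
  assumes \<delta>: "\<delta> > 0"
    and int: "\<And>s. \<bar>s - t\<bar> < \<delta> \<Longrightarrow> integrable M (F s)"
    and C: "integrable M C"
    and lip: "\<And>s y. \<bar>s - t\<bar> < \<delta> \<Longrightarrow> y \<in> space M \<Longrightarrow> cmod (F s y - F t y) \<le> C y * \<bar>s - t\<bar>"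
    and D: "AE y in M. ((\<lambda>s. F s y) has_vector_derivative D y) (at t)"
    and meas: "D \<in> borel_measurable M"
  shows "((\<lambda>s. integral\<^sup>L M (F s)) has_vector_derivative integral\<^sup>L M D) (at t)"
  unfolding has_vector_derivative_iff_quotient tendsto_at_iff_sequentially
proof (intro allI impI)
  fix X :: "nat \<Rightarrow> real" assume X: "\<forall>i. X i \<in> UNIV - {0}" "X \<longlonglongrightarrow> 0"
  then have "\<forall>\<^sub>F i in sequentially. \<bar>X i\<bar> < \<delta>"
    using \<delta> by (auto dest!: tendstoD simp: dist_norm)
  then obtain N where N: "\<And>i. i \<ge> N \<Longrightarrow> \<bar>X i\<bar> < \<delta>" by (auto simp: eventually_sequentially)
  define Y where "Y = (\<lambda>i. X (i + N))"
  have Y: "\<bar>Y i\<bar> < \<delta>" "Y i \<noteq> 0" for i using N X by (auto simp: Y_def)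
  have Y0: "Y \<longlonglongrightarrow> 0" unfolding Y_def using X(2) by (rule LIMSEQ_ignore_initial_segment)
  define q where "q = (\<lambda>i y. (F (t + Y i) y - F t y) /\<^sub>R Y i)"
  have "(\<lambda>i. integral\<^sup>L M (q i)) \<longlonglongrightarrow> integral\<^sup>L M D"
  proof (rule integral_dominated_convergence[where w = C])
    show "D \<in> borel_measurable M" by fact
    show "q i \<in> borel_measurable M" for i
      unfolding q_def using int[of "t + Y i"] int[of t] Y[of i] \<delta> by (auto intro!: borel_measurable_integrable)
    show "integrable M C" by fact
    show "AE y in M. (\<lambda>i. q i y) \<longlonglongrightarrow> D y"
      using D
    proof eventually_elim
      case (elim y)
      then have "((\<lambda>h. (F (t + h) y - F t y) /\<^sub>R h) \<longlongrightarrow> D y) (at 0)"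
        by (simp add: has_vector_derivative_iff_quotient)
      then show ?case
        unfolding tendsto_at_iff_sequentially q_def using Y Y0 by (auto simp: o_def)
    qed
    show "AE y in M. norm (q i y) \<le> C y" for i
    proof (rule AE_I2)
      fix y assume y: "y \<in> space M"
      have "norm (q i y) = cmod (F (t + Y i) y - F t y) / \<bar>Y i\<bar>"
        by (simp add: q_def divide_inverse mult.commute)
      then show "norm (q i y) \<le> C y"
        using Y[of i] lip[of "t + Y i", OF _ y] by (simp add: pos_divide_le_eq)
    qed
  qed
  moreover have "integral\<^sup>L M (q i) = (integral\<^sup>L M (F (t + Y i)) - integral\<^sup>L M (F t)) /\<^sub>R Y i" for i
    unfolding q_def using int[of "t + Y i"] int[of t] Y[of i] \<delta> by simp
  ultimately have "(\<lambda>i. ((\<lambda>h. (integral\<^sup>L M (F (t + h)) - integral\<^sup>L M (F t)) /\<^sub>R h) \<circ> X) (i + N)) \<longlonglongrightarrow> integral\<^sup>L M D"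
    by (simp add: Y_def)
  then show "((\<lambda>h. (integral\<^sup>L M (F (t + h)) - integral\<^sup>L M (F t)) /\<^sub>R h) \<circ> X) \<longlonglongrightarrow> integral\<^sup>L M D"
    by (rule LIMSEQ_offset)
qed

definition ball_integral :: "(real^'d::finite \<Rightarrow> complex) \<Rightarrow> complex" where
  "ball_integral f = (\<integral>y. indicator (cball 0 1) y *\<^sub>R f y \<partial>lborel)"

lemma ball_integrable:
  fixes f :: "real^'d::finite \<Rightarrow> complex"
  assumes "continuous_on (cball 0 1) f"
  shows "integrable lborel (\<lambda>y. indicator (cball 0 1) y *\<^sub>R f y)"
  using assms by (intro borel_integrable_compact) auto

lemma ball_integral_cong:
  assumes "\<And>y. norm y \<le> 1 \<Longrightarrow> f y = g y"
  shows "ball_integral f = ball_integral g"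
  unfolding ball_integral_def using assms by (intro Bochner_Integration.integral_cong) (auto simp: indicator_def)

lemma ball_integral_add:
  assumes "continuous_on (cball 0 1) f" "continuous_on (cball 0 1) g"
  shows "ball_integral (\<lambda>y. f y + g y) = ball_integral f + ball_integral g"
  unfolding ball_integral_def scaleR_add_right
  using assms by (intro Bochner_Integration.integral_add ball_integrable)

lemma ball_integral_diff:
  assumes "continuous_on (cball 0 1) f" "continuous_on (cball 0 1) g"
  shows "ball_integral (\<lambda>y. f y - g y) = ball_integral f - ball_integral g"
  unfolding ball_integral_def scaleR_diff_right
  using assms by (intro Bochner_Integration.integral_diff ball_integrable)

lemma ball_integral_sum:
  assumes "\<And>i. i \<in> I \<Longrightarrow> continuous_on (cball 0 1) (f i)"
  shows "ball_integral (\<lambda>y. \<Sum>i\<in>I. f i y) = (\<Sum>i\<in>I. ball_integral (f i))"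
  unfolding ball_integral_def scaleR_sum_right
  using assms by (intro Bochner_Integration.integral_sum ball_integrable)

lemma ball_integral_mult: "ball_integral (\<lambda>y. c * f y) = c * ball_integral f"
  unfolding ball_integral_def by (simp flip: mult_scaleR_right)

lemma ball_integral_scaleR: "ball_integral (\<lambda>y. c *\<^sub>R f y) = c *\<^sub>R ball_integral f"
  unfolding scaleR_conv_of_real by (rule ball_integral_mult)

text \<open>The weight \<open>1 - \<bar>y\<bar>\<^sup>2\<close> vanishes on the sphere, so there is no boundary term and no surface measure is
  needed. After extension by zero, the product of the weight and \<open>g\<close> is Lipschitz. Its integral does not
  change under translations, hence its derivative in direction \<open>e\<close> integrates to zero.\<close>

lemma ball_integral_by_parts:
  fixes g g' :: "real^'d::finite \<Rightarrow> complex"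
  assumes e: "norm e = 1" and U: "open U" "cball 0 1 \<subseteq> U"
    and deriv: "\<And>y s. y + s *\<^sub>R e \<in> U \<Longrightarrow> ((\<lambda>s. g (y + s *\<^sub>R e)) has_vector_derivative g' (y + s *\<^sub>R e)) (at s)"
    and cont: "continuous_on U g" "continuous_on U g'"
  shows "ball_integral (\<lambda>y. (1 - (norm y)\<^sup>2) *\<^sub>R g' y) = ball_integral (\<lambda>y. (2 * (y \<bullet> e)) *\<^sub>R g y)"
proof -
  let ?B = "cball 0 1 :: (real^'d) set"
  have cB: "continuous_on ?B g" "continuous_on ?B g'" using cont U continuous_on_subset by blast+
  have "compact (g ` ?B)" "compact (g' ` ?B)"
    using cB by (auto intro: compact_continuous_image)
  then have "bounded (g ` ?B)" "bounded (g' ` ?B)" by (auto dest: compact_imp_bounded)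
  then obtain G L where G: "\<And>y. y \<in> ?B \<Longrightarrow> cmod (g y) \<le> G" and L: "\<And>y. y \<in> ?B \<Longrightarrow> cmod (g' y) \<le> L"
    unfolding bounded_iff by blast
  have GL: "G \<ge> 0" "L \<ge> 0" using G[of 0] L[of 0] norm_ge_zero order_trans by (metis centre_in_cball zero_le_one)+
  define \<phi> where "\<phi> = (\<lambda>y. (1 - (norm y)\<^sup>2) *\<^sub>R g y)"
  define \<phi>' where "\<phi>' = (\<lambda>y. (1 - (norm y)\<^sup>2) *\<^sub>R g' y - (2 * (y \<bullet> e)) *\<^sub>R g y)"
  have d\<phi>: "((\<lambda>s. \<phi> (y + s *\<^sub>R e)) has_vector_derivative \<phi>' (y + s *\<^sub>R e)) (at s)" if "y + s *\<^sub>R e \<in> U" for y s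
  proof -
    have "((\<lambda>s. 1 - (norm (y + s *\<^sub>R e))\<^sup>2) has_real_derivative - 2 * ((y + s *\<^sub>R e) \<bullet> e)) (at s)"
      unfolding power2_norm_eq_inner has_field_derivative_def
      by (auto intro!: derivative_eq_intros simp: inner_commute algebra_simps)
    then have "((\<lambda>s. 1 - (norm (y + s *\<^sub>R e))\<^sup>2) has_vector_derivative - 2 * ((y + s *\<^sub>R e) \<bullet> e)) (at s)"
      by (simp add: has_real_derivative_iff_has_vector_derivative)
    from bounded_bilinear.has_vector_derivative[OF bounded_bilinear_scaleR this deriv[OF that]]
    show ?thesis unfolding \<phi>_def \<phi>'_def by simp
  qed
  have \<phi>'_le: "cmod (\<phi>' y) \<le> L + 2 * G" if y: "y \<in> ?B" for y
  proof -
    have n: "norm y \<le> 1" using y by simp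
    then have n2: "(norm y)\<^sup>2 \<le> 1" by (simp add: abs_square_le_1)
    have ye: "\<bar>y \<bullet> e\<bar> \<le> 1" using Cauchy_Schwarz_ineq2[of y e] e n by simp
    have "cmod (\<phi>' y) \<le> \<bar>1 - (norm y)\<^sup>2\<bar> * cmod (g' y) + 2 * \<bar>y \<bullet> e\<bar> * cmod (g y)"
      unfolding \<phi>'_def using norm_triangle_ineq4[of "(1 - (norm y)\<^sup>2) *\<^sub>R g' y" "(2 * (y \<bullet> e)) *\<^sub>R g y"]
      by (simp add: abs_mult)
    also have "\<dots> \<le> 1 * L + 2 * 1 * G"
      using G[OF y] L[OF y] GL n2 ye by (intro add_mono mult_mono) auto
    finally show ?thesis by simp
  qed
  have c\<phi>: "continuous_on ?B \<phi>" "continuous_on ?B \<phi>'"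
    unfolding \<phi>_def \<phi>'_def by (intro continuous_intros cB)+
  define H where "H = (\<lambda>y. indicator ?B y *\<^sub>R \<phi> y)"
  have H: "integrable lborel H" unfolding H_def by (rule ball_integrable[OF c\<phi>(1)])
  have shift: "integrable lborel (\<lambda>y. H (y + c))" "(\<integral>y. H (y + c) \<partial>lborel) = integral\<^sup>L lborel H" for c
  proof -
    have m: "H \<in> borel_measurable borel" using borel_measurable_integrable[OF H] by simp
    have "integrable (distr lborel borel ((+) c)) H" unfolding lborel_distr_plus by (rule H)
    then show "integrable lborel (\<lambda>y. H (y + c))"
      by (subst (asm) integrable_distr_eq) (use m in \<open>auto simp: add.commute\<close>)
    have "integral\<^sup>L lborel H = integral\<^sup>L (distr lborel borel ((+) c)) H" by (simp add: lborel_distr_plus)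
    also have "\<dots> = (\<integral>y. H (c + y) \<partial>lborel)"
      by (rule integral_distr) (use m in auto)
    finally show "(\<integral>y. H (y + c) \<partial>lborel) = integral\<^sup>L lborel H" by (simp add: add.commute)
  qed
  define D where "D = (\<lambda>y. indicator ?B y *\<^sub>R \<phi>' y)"
  define C where "C = (\<lambda>y::real^'d. indicator (cball 0 2) y *\<^sub>R (L + 2 * G))"
  have "((\<lambda>s. \<integral>y. H (y + s *\<^sub>R e) \<partial>lborel) has_vector_derivative integral\<^sup>L lborel D) (at 0)"
  proof (rule has_vector_derivative_lebesgue_integral[of 1])
    show "integrable lborel C" unfolding C_def by (intro borel_integrable_compact) auto
    show "D \<in> borel_measurable lborel"
      unfolding D_def by (intro borel_measurable_integrable ball_integrable c\<phi>)
    show "integrable lborel (\<lambda>y. H (y + s *\<^sub>R e))" for s by (rule shift)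
    show "AE y in lborel. ((\<lambda>s. H (y + s *\<^sub>R e)) has_vector_derivative D y) (at 0)"
    proof (rule AE_I')
      show "sphere 0 1 \<in> null_sets (lborel :: (real^'d) measure)"
        using negligible_sphere[of "0::real^'d" 1]
        by (auto simp: null_sets_completion_iff negligible_iff_null_sets)
      have "((\<lambda>s. H (y + s *\<^sub>R e)) has_vector_derivative D y) (at 0)" if y: "norm y \<noteq> 1" for y
      proof (cases "norm y < 1")
        case True
        have yU: "y + 0 *\<^sub>R e \<in> U" using True U by auto
        have "open ((\<lambda>s. y + s *\<^sub>R e) -` ball 0 1)"
          by (intro continuous_open_vimage continuous_intros open_ball)
        from has_vector_derivative_transform_within_open[OF d\<phi>[OF yU] this]
        show ?thesis using True by (simp add: H_def D_def indicator_def)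
      next
        case False
        then have n: "y \<in> - cball 0 1" using y by auto
        have "open ((\<lambda>s. y + s *\<^sub>R e) -` (- cball 0 1))"
          by (intro continuous_open_vimage continuous_intros) auto
        from has_vector_derivative_transform_within_open[OF has_vector_derivative_const[of 0] this, of 0 "\<lambda>s. H (y + s *\<^sub>R e)"]
        show ?thesis using n by (simp add: H_def D_def indicator_def)
      qed
      then show "{y \<in> space lborel. \<not> ((\<lambda>s. H (y + s *\<^sub>R e)) has_vector_derivative D y) (at 0)} \<subseteq> sphere 0 1"
        unfolding subset_eq mem_Collect_eq mem_sphere_0 by blast
    qed
    fix s :: real and y :: "real^'d" assume s: "\<bar>s - 0\<bar> < 1"
    have small: "cmod (H z) \<le> (L + 2 * G) * \<bar>s\<bar>" if z: "z \<in> ?B" and x: "x \<notin> ?B" and d: "norm (x - z) \<le> \<bar>s\<bar>" for x z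
    proof -
      have "1 - norm z \<le> \<bar>s\<bar>" using x d norm_triangle_ineq2[of x z] by auto
      moreover have "1 - (norm z)\<^sup>2 \<le> 2 * (1 - norm z)"
      proof -
        have "0 \<le> (1 - norm z)\<^sup>2" by simp
        then show ?thesis by (simp add: power2_eq_square algebra_simps)
      qed
      moreover have "(norm z)\<^sup>2 \<le> 1" using z by (simp add: abs_square_le_1)
      ultimately have "\<bar>1 - (norm z)\<^sup>2\<bar> * cmod (g z) \<le> (2 * \<bar>s\<bar>) * G"
        using G[OF z] GL by (intro mult_mono) auto
      also have "\<dots> \<le> (L + 2 * G) * \<bar>s\<bar>" using GL by (simp add: distrib_right)
      finally show ?thesis using z by (simp add: H_def \<phi>_def)
    qed
    have n: "norm (s *\<^sub>R e) = \<bar>s\<bar>" using e by simp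
    consider (both) "y \<in> ?B" "y + s *\<^sub>R e \<in> ?B" | (one) "y \<in> ?B" "y + s *\<^sub>R e \<notin> ?B"
      | (two) "y \<notin> ?B" "y + s *\<^sub>R e \<in> ?B" | (none) "y \<notin> ?B" "y + s *\<^sub>R e \<notin> ?B" by blast
    then show "cmod (H (y + s *\<^sub>R e) - H (y + 0 *\<^sub>R e)) \<le> C y * \<bar>s - 0\<bar>"
    proof cases
      case both
      have seg: "y + x *\<^sub>R e \<in> ?B" if "x \<in> closed_segment 0 s" for x
      proof -
        from that obtain u where u: "0 \<le> u" "u \<le> 1" "x = u * s" by (auto simp: closed_segment_def)
        have "y + x *\<^sub>R e = (1 - u) *\<^sub>R y + u *\<^sub>R (y + s *\<^sub>R e)" by (simp add: u algebra_simps)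
        also have "\<dots> \<in> ?B" using both u convex_cball[of 0 1] by (intro convexD) auto
        finally show ?thesis .
      qed
      have "cmod (\<phi> (y + s *\<^sub>R e) - \<phi> (y + 0 *\<^sub>R e)) \<le> (L + 2 * G) * \<bar>s - 0\<bar>"
      proof (rule norm_diff_le_of_vector_derivative_le[where f = "\<lambda>x. \<phi> (y + x *\<^sub>R e)"])
        fix x assume "x \<in> closed_segment 0 s"
        note x = seg[OF this]
        then have "y + x *\<^sub>R e \<in> U" using U by blast
        then show "((\<lambda>x. \<phi> (y + x *\<^sub>R e)) has_vector_derivative \<phi>' (y + x *\<^sub>R e)) (at x)" by (rule d\<phi>)
        show "cmod (\<phi>' (y + x *\<^sub>R e)) \<le> L + 2 * G" by (rule \<phi>'_le[OF x])
      qed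
      then show ?thesis using both by (simp add: H_def C_def)
    next
      case one
      then have "cmod (H y) \<le> (L + 2 * G) * \<bar>s\<bar>" by (intro small[of y "y + s *\<^sub>R e"]) (simp_all add: e)
      moreover have "H (y + s *\<^sub>R e) = 0" using one by (simp add: H_def)
      ultimately show ?thesis using one by (simp add: C_def)
    next
      case two
      then have "cmod (H (y + s *\<^sub>R e)) \<le> (L + 2 * G) * \<bar>s\<bar>" by (intro small[of _ y]) (simp_all add: e)
      moreover have "H y = 0" using two by (simp add: H_def)
      moreover have "y \<in> cball 0 2"
        using norm_triangle_ineq4[of "y + s *\<^sub>R e" "s *\<^sub>R e"] e two s by simp
      ultimately show ?thesis by (simp add: C_def)
    next
      case none
      then show ?thesis using GL by (simp add: H_def C_def)
    qed
  qed simp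
  then have "((\<lambda>s::real. integral\<^sup>L lborel H) has_vector_derivative integral\<^sup>L lborel D) (at 0)"
    by (simp add: shift)
  then have "integral\<^sup>L lborel D = 0"
    using has_vector_derivative_const vector_derivative_unique_at by blast
  then have "ball_integral \<phi>' = 0" by (simp add: D_def ball_integral_def)
  moreover have "ball_integral \<phi>' = ball_integral (\<lambda>y. (1 - (norm y)\<^sup>2) *\<^sub>R g' y) - ball_integral (\<lambda>y. (2 * (y \<bullet> e)) *\<^sub>R g y)"
    unfolding \<phi>'_def by (intro ball_integral_diff continuous_intros cB)
  ultimately show ?thesis by simp
qed


definition unit_vol :: "'d::finite itself \<Rightarrow> real" where
  "unit_vol _ = measure lborel (cball (0::real^'d) 1)"

lemma unit_vol_pos: "unit_vol TYPE('d::finite) > 0"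
  unfolding unit_vol_def by (rule content_cball_pos) simp

lemma integral_indicator_unit_ball:
  "(\<integral>y. indicator (cball (0::real^'d::finite) 1) y *\<^sub>R (c::'b::{banach, second_countable_topology}) \<partial>lborel) = unit_vol TYPE('d) *\<^sub>R c"
proof -
  have "integrable lborel (indicator (cball (0::real^'d) 1) :: _ \<Rightarrow> real)"
    using emeasure_lborel_cball_finite[of "0::real^'d" 1] by (intro integrable_real_indicator) auto
  then have "(\<integral>y. indicator (cball (0::real^'d) 1) y *\<^sub>R c \<partial>lborel) = (\<integral>y. indicator (cball (0::real^'d) 1) y \<partial>lborel) *\<^sub>R c"
    by (rule integral_scaleR_left)
  then show ?thesis by (simp add: unit_vol_def)
qed

lemma ball_integral_const: "ball_integral (\<lambda>y::real^'d::finite. c) = unit_vol TYPE('d) *\<^sub>R c"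
  unfolding ball_integral_def by (rule integral_indicator_unit_ball)

lemma ball_integral_norm_le:
  fixes f :: "real^'d::finite \<Rightarrow> complex"
  assumes "continuous_on (cball 0 1) f" "\<And>y. norm y \<le> 1 \<Longrightarrow> cmod (f y) \<le> B"
  shows "cmod (ball_integral f) \<le> unit_vol TYPE('d) * B"
proof -
  have "cmod (ball_integral f) \<le> (\<integral>y. norm (indicator (cball 0 1) y *\<^sub>R f y) \<partial>lborel)"
    unfolding ball_integral_def by (rule integral_norm_bound)
  also have "\<dots> \<le> (\<integral>y. indicator (cball (0::real^'d) 1) y *\<^sub>R B \<partial>lborel)"
  proof (rule integral_mono)
    show "integrable lborel (\<lambda>y. norm (indicator (cball 0 1) y *\<^sub>R f y))"
      by (intro integrable_norm ball_integrable assms(1))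
    show "integrable lborel (\<lambda>y. indicator (cball (0::real^'d) 1) y *\<^sub>R B)"
      by (intro borel_integrable_compact) auto
    show "norm (indicator (cball 0 1) y *\<^sub>R f y) \<le> indicator (cball 0 1) y *\<^sub>R B" for y
      using assms(2)[of y] by (simp add: indicator_def)
  qed
  also have "\<dots> = unit_vol TYPE('d) * B"
    by (subst integral_indicator_unit_ball) simp
  finally show ?thesis .
qed

definition dir_deriv :: "(real^'d::finite \<Rightarrow> complex) \<Rightarrow> real^'d \<Rightarrow> real^'d \<Rightarrow> complex" where
  "dir_deriv g x v = (\<Sum>j\<in>UNIV. (v $ j) *\<^sub>R partial_deriv j g x)"

lemma Ck_on_1_D:
  assumes "Ck_on (Suc k) U g"
  shows "x \<in> U \<Longrightarrow> g differentiable (at x)" "Ck_on k U (partial_deriv j g)"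
  using assms by auto

lemma Ck_on_imp_continuous: "Ck_on k U g \<Longrightarrow> continuous_on U g"
  by (cases k) (auto intro!: continuous_at_imp_continuous_on differentiable_imp_continuous_within)

lemma has_derivative_dir_deriv:
  assumes "Ck_on (Suc k) U g" "x \<in> U"
  shows "(g has_derivative dir_deriv g x) (at x)"
proof -
  have d: "(g has_derivative frechet_derivative g (at x)) (at x)"
    using Ck_on_1_D(1)[OF assms] frechet_derivative_works by blast
  then interpret linear "frechet_derivative g (at x)"
    by (rule has_derivative_linear)
  have "frechet_derivative g (at x) v = dir_deriv g x v" for v
  proof -
    have "frechet_derivative g (at x) v = frechet_derivative g (at x) (\<Sum>j\<in>UNIV. (v $ j) *\<^sub>R axis j 1)"
      using basis_expansion[of v] by (simp add: scalar_mult_eq_scaleR)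
    also have "\<dots> = dir_deriv g x v"
      by (simp add: dir_deriv_def partial_deriv_def sum scaleR)
    finally show ?thesis .
  qed
  with d show ?thesis by (metis ext)
qed

lemma has_vector_derivative_line:
  assumes "Ck_on (Suc k) U g" "x + s *\<^sub>R v \<in> U"
  shows "((\<lambda>s. g (x + s *\<^sub>R v)) has_vector_derivative dir_deriv g (x + s *\<^sub>R v) v) (at s)"
proof -
  have "((\<lambda>s. x + s *\<^sub>R v) has_derivative (\<lambda>h. h *\<^sub>R v)) (at s)"
    by (auto intro!: derivative_eq_intros)
  from has_derivative_compose[OF this has_derivative_dir_deriv[OF assms]]
  show ?thesis
    by (simp add: has_vector_derivative_def dir_deriv_def scaleR_sum_right)
qed

lemma dir_deriv_scaleR: "dir_deriv g x (c *\<^sub>R v) = c *\<^sub>R dir_deriv g x v"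
  by (simp add: dir_deriv_def scaleR_sum_right)

lemma dir_deriv_axis: "dir_deriv g x (axis j 1) = partial_deriv j g x"
  by (simp add: dir_deriv_def axis_def if_distrib[of "\<lambda>a. a *\<^sub>R _"] cong: if_cong)

lemma continuous_on_dilated:
  fixes g :: "real^'d::finite \<Rightarrow> complex"
  assumes "continuous_on U g" "cball x0 T \<subseteq> U" "\<bar>t\<bar> \<le> T"
  shows "continuous_on (cball 0 1) (\<lambda>y. g (x0 + t *\<^sub>R y))"
proof (rule continuous_on_compose2[OF assms(1)])
  show "(\<lambda>y. x0 + t *\<^sub>R y) ` cball 0 1 \<subseteq> U"
  proof -
    have "\<bar>t\<bar> * norm y \<le> T" if "norm y \<le> 1" for y :: "real^'d"
      using that assms(3) mult_mono[of "\<bar>t\<bar>" T "norm y" 1] by simp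
    then show ?thesis using assms(2) by (force simp: dist_norm)
  qed
qed (intro continuous_intros)

lemma ball_integral_dilated_deriv:
  fixes g :: "real^'d::finite \<Rightarrow> complex"
  assumes g: "Ck_on 1 U g" and T: "cball x0 T \<subseteq> U" and t: "\<bar>t\<bar> < T"
    and u: "continuous_on (cball 0 1) u"
  shows "((\<lambda>t. ball_integral (\<lambda>y. u y *\<^sub>R g (x0 + t *\<^sub>R y))) has_vector_derivative
      ball_integral (\<lambda>y. u y *\<^sub>R dir_deriv g (x0 + t *\<^sub>R y) y)) (at t)"
proof -
  let ?B = "cball 0 1 :: (real^'d) set"
  have gc: "continuous_on U g" and pc: "continuous_on U (partial_deriv j g)" for j
    using g Ck_on_imp_continuous[OF g] by auto
  have inU: "x0 + s *\<^sub>R y \<in> U" if "\<bar>s\<bar> \<le> T" "y \<in> ?B" for s y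
  proof -
    have "\<bar>s\<bar> * norm y \<le> T" using that mult_mono[of "\<bar>s\<bar>" T "norm y" 1] by simp
    then show ?thesis using T by (force simp: dist_norm)
  qed
  have "\<exists>P. \<forall>x\<in>cball x0 T. cmod (partial_deriv j g x) \<le> P" for j
  proof -
    have "compact (partial_deriv j g ` cball x0 T)"
      using continuous_on_subset[OF pc T] by (intro compact_continuous_image) auto
    then show ?thesis by (auto dest!: compact_imp_bounded simp: bounded_iff)
  qed
  then obtain P where P: "\<And>j x. x \<in> cball x0 T \<Longrightarrow> cmod (partial_deriv j g x) \<le> P j" by metis
  have in_T: "x0 + s *\<^sub>R y \<in> cball x0 T" if "\<bar>s\<bar> \<le> T" "y \<in> ?B" for s y
    using that mult_mono[of "\<bar>s\<bar>" T "norm y" 1] by (simp add: dist_norm)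
  have dle: "cmod (dir_deriv g (x0 + s *\<^sub>R y) y) \<le> (\<Sum>j\<in>UNIV. P j)" if "\<bar>s\<bar> \<le> T" "y \<in> ?B" for s y
    unfolding dir_deriv_def
  proof (rule order_trans[OF norm_sum sum_mono])
    fix j :: 'd
    have "\<bar>y $ j\<bar> \<le> 1" using component_le_norm_cart[of y j] that by simp
    then show "cmod ((y $ j) *\<^sub>R partial_deriv j g (x0 + s *\<^sub>R y)) \<le> P j"
      using mult_mono[OF _ P[OF in_T[OF that]], of "\<bar>y $ j\<bar>" 1] by simp
  qed
  have "((\<lambda>s. \<integral>y. indicator ?B y *\<^sub>R (u y *\<^sub>R g (x0 + s *\<^sub>R y)) \<partial>lborel) has_vector_derivative
      (\<integral>y. indicator ?B y *\<^sub>R (u y *\<^sub>R dir_deriv g (x0 + t *\<^sub>R y) y) \<partial>lborel)) (at t)"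
  proof (rule has_vector_derivative_lebesgue_integral[of "T - \<bar>t\<bar>"])
    show "T - \<bar>t\<bar> > 0" using t by simp
    show "integrable lborel (\<lambda>y. indicator ?B y *\<^sub>R (u y *\<^sub>R g (x0 + s *\<^sub>R y)))" if "\<bar>s - t\<bar> < T - \<bar>t\<bar>" for s
      using that by (intro ball_integrable continuous_intros u continuous_on_dilated[OF gc T]) auto
    have cd: "continuous_on ?B (\<lambda>y. u y *\<^sub>R dir_deriv g (x0 + t *\<^sub>R y) y)"
      unfolding dir_deriv_def using t
      by (intro continuous_intros u continuous_on_dilated[OF pc T]) auto
    show "(\<lambda>y. indicator ?B y *\<^sub>R (u y *\<^sub>R dir_deriv g (x0 + t *\<^sub>R y) y)) \<in> borel_measurable lborel"
      by (intro borel_measurable_integrable ball_integrable cd)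
    show "integrable lborel (\<lambda>y. indicator ?B y *\<^sub>R (\<bar>u y\<bar> * (\<Sum>j\<in>UNIV. P j)))"
      by (intro borel_integrable_compact continuous_intros u) auto
    show "AE y in lborel. ((\<lambda>s. indicator ?B y *\<^sub>R (u y *\<^sub>R g (x0 + s *\<^sub>R y))) has_vector_derivative
        indicator ?B y *\<^sub>R (u y *\<^sub>R dir_deriv g (x0 + t *\<^sub>R y) y)) (at t)"
    proof (rule AE_I2)
      fix y :: "real^'d"
      show "((\<lambda>s. indicator ?B y *\<^sub>R (u y *\<^sub>R g (x0 + s *\<^sub>R y))) has_vector_derivative
        indicator ?B y *\<^sub>R (u y *\<^sub>R dir_deriv g (x0 + t *\<^sub>R y) y)) (at t)"
      proof (cases "y \<in> ?B")
        case True
        then have "x0 + t *\<^sub>R y \<in> U" using t by (intro inU) auto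
        from has_vector_derivative_line[OF _ this, of 0] g
        have d: "((\<lambda>s. g (x0 + s *\<^sub>R y)) has_vector_derivative dir_deriv g (x0 + t *\<^sub>R y) y) (at t)" by simp
        show ?thesis
          by (intro bounded_linear.has_vector_derivative[OF bounded_linear_scaleR_right] d)
      qed simp
    qed
    fix s :: real and y :: "real^'d" assume s: "\<bar>s - t\<bar> < T - \<bar>t\<bar>"
    show "cmod (indicator ?B y *\<^sub>R (u y *\<^sub>R g (x0 + s *\<^sub>R y)) - indicator ?B y *\<^sub>R (u y *\<^sub>R g (x0 + t *\<^sub>R y)))
        \<le> indicator ?B y *\<^sub>R (\<bar>u y\<bar> * (\<Sum>j\<in>UNIV. P j)) * \<bar>s - t\<bar>"
    proof (cases "y \<in> ?B")
      case True
      have seg: "\<bar>x\<bar> \<le> T" if "x \<in> closed_segment t s" for x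
        using that s by (auto simp: closed_segment_eq_real_ivl split: if_splits)
      have "cmod (g (x0 + s *\<^sub>R y) - g (x0 + t *\<^sub>R y)) \<le> (\<Sum>j\<in>UNIV. P j) * \<bar>s - t\<bar>"
      proof (rule norm_diff_le_of_vector_derivative_le)
        fix x assume x: "x \<in> closed_segment t s"
        show "((\<lambda>s. g (x0 + s *\<^sub>R y)) has_vector_derivative dir_deriv g (x0 + x *\<^sub>R y) y) (at x)"
          using has_vector_derivative_line[OF _ inU[OF seg[OF x] True], of 0] g by simp
        show "cmod (dir_deriv g (x0 + x *\<^sub>R y) y) \<le> (\<Sum>j\<in>UNIV. P j)"
          by (rule dle[OF seg[OF x] True])
      qed
      then have "\<bar>u y\<bar> * cmod (g (x0 + s *\<^sub>R y) - g (x0 + t *\<^sub>R y)) \<le> \<bar>u y\<bar> * ((\<Sum>j\<in>UNIV. P j) * \<bar>s - t\<bar>)"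
        by (intro mult_left_mono) auto
      then show ?thesis using True by (simp add: scaleR_diff_right[symmetric] mult.assoc)
    qed simp
  qed
  then show ?thesis by (simp add: ball_integral_def)
qed

section \<open>The differential equation for ball means\<close>

lemma cball_subset_dilated_vimage:
  fixes x0 :: "real^'d::finite"
  assumes "cball x0 T \<subseteq> U" "\<bar>t\<bar> \<le> T"
  shows "cball 0 1 \<subseteq> (\<lambda>y. x0 + t *\<^sub>R y) -` U"
proof
  fix y :: "real^'d" assume "y \<in> cball 0 1"
  then have "\<bar>t\<bar> * norm y \<le> T" using assms(2) mult_mono[of "\<bar>t\<bar>" T "norm y" 1] by simp
  then show "y \<in> (\<lambda>y. x0 + t *\<^sub>R y) -` U" using assms(1) by (force simp: dist_norm)
qed

lemma dilated_line_deriv: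
  assumes "Ck_on (Suc k) U g" "y + s *\<^sub>R axis j 1 \<in> (\<lambda>y. x0 + t *\<^sub>R y) -` U"
  shows "((\<lambda>s. g (x0 + t *\<^sub>R (y + s *\<^sub>R axis j 1))) has_vector_derivative
      t *\<^sub>R partial_deriv j g (x0 + t *\<^sub>R (y + s *\<^sub>R axis j 1))) (at s)"
proof -
  have "(x0 + t *\<^sub>R y) + s *\<^sub>R (t *\<^sub>R axis j 1) \<in> U" using assms(2) by (simp add: algebra_simps)
  from has_vector_derivative_line[OF assms(1) this] show ?thesis
    by (simp add: dir_deriv_scaleR dir_deriv_axis algebra_simps)
qed

text \<open>This is integration by parts applied to each partial derivative of the dilated function. It turns
  the radial derivative of the ball mean into a weighted mean of the Laplacian.\<close>

lemma ball_integral_radial_deriv: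
  fixes \<psi> :: "real^'d::finite \<Rightarrow> complex"
  assumes \<psi>: "Ck_on 2 U \<psi>" and U: "open U" "cball x0 T \<subseteq> U" and t: "\<bar>t\<bar> \<le> T"
  shows "ball_integral (\<lambda>y. dir_deriv \<psi> (x0 + t *\<^sub>R y) y) =
    t *\<^sub>R ball_integral (\<lambda>y. ((1 - (norm y)\<^sup>2) / 2) *\<^sub>R laplacian \<psi> (x0 + t *\<^sub>R y))"
proof -
  let ?V = "(\<lambda>y. x0 + t *\<^sub>R y) -` U"
  have p1: "Ck_on (Suc 0) U (partial_deriv j \<psi>)" for j using \<psi> by (simp add: numeral_2_eq_2)
  have c1: "continuous_on U (partial_deriv j \<psi>)" for j using Ck_on_imp_continuous[OF p1] .
  have c2: "continuous_on U (partial_deriv j (partial_deriv j \<psi>))" for j using p1[of j] by simp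
  have oV: "open ?V" by (intro continuous_open_vimage continuous_intros U)
  have cV: "continuous_on ?V (\<lambda>y. g (x0 + t *\<^sub>R y))" if "continuous_on U g" for g :: "real^'d \<Rightarrow> complex"
    by (rule continuous_on_compose2[OF that]) (auto intro!: continuous_intros)
  note c1' = continuous_on_dilated[OF c1 U(2) t] and c2' = continuous_on_dilated[OF c2 U(2) t]
  have *: "ball_integral (\<lambda>y. (1 - (norm y)\<^sup>2) *\<^sub>R (t *\<^sub>R partial_deriv j (partial_deriv j \<psi>) (x0 + t *\<^sub>R y))) =
      ball_integral (\<lambda>y. (2 * (y \<bullet> axis j 1)) *\<^sub>R partial_deriv j \<psi> (x0 + t *\<^sub>R y))" for j
    by (rule ball_integral_by_parts[OF _ oV cball_subset_dilated_vimage[OF U(2) t]])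
       (use dilated_line_deriv[OF p1] in \<open>auto intro!: continuous_intros cV c1 c2\<close>)
  have "ball_integral (\<lambda>y. dir_deriv \<psi> (x0 + t *\<^sub>R y) y) =
      (\<Sum>j\<in>UNIV. ball_integral (\<lambda>y. (y $ j) *\<^sub>R partial_deriv j \<psi> (x0 + t *\<^sub>R y)))"
    unfolding dir_deriv_def by (intro ball_integral_sum continuous_intros c1')
  also have "\<dots> = (\<Sum>j\<in>UNIV. (1 / 2) *\<^sub>R ball_integral (\<lambda>y. (2 * (y \<bullet> axis j 1)) *\<^sub>R partial_deriv j \<psi> (x0 + t *\<^sub>R y)))"
    by (simp add: ball_integral_scaleR[symmetric] inner_axis)
  also have "\<dots> = (\<Sum>j\<in>UNIV. ball_integral (\<lambda>y. t *\<^sub>R (((1 - (norm y)\<^sup>2) / 2) *\<^sub>R partial_deriv j (partial_deriv j \<psi>) (x0 + t *\<^sub>R y))))"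
    unfolding *[symmetric] ball_integral_scaleR[symmetric] by (simp add: mult.commute)
  also have "\<dots> = ball_integral (\<lambda>y. \<Sum>j\<in>UNIV. t *\<^sub>R (((1 - (norm y)\<^sup>2) / 2) *\<^sub>R partial_deriv j (partial_deriv j \<psi>) (x0 + t *\<^sub>R y)))"
    by (intro ball_integral_sum[symmetric] continuous_intros c2') auto
  also have "\<dots> = t *\<^sub>R ball_integral (\<lambda>y. ((1 - (norm y)\<^sup>2) / 2) *\<^sub>R laplacian \<psi> (x0 + t *\<^sub>R y))"
    unfolding laplacian_def scaleR_sum_right[symmetric] ball_integral_scaleR ..
  finally show ?thesis .
qed

text \<open>Integration by parts applied to \<open>y\<^sub>j g\<close>, summed over \<open>j\<close>. The dimension enters through the divergence of the
  field \<open>y\<close>.\<close>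

lemma ball_integral_euler:
  fixes g :: "real^'d::finite \<Rightarrow> complex"
  assumes g: "Ck_on 1 U g" and U: "open U" "cball x0 T \<subseteq> U" and t: "\<bar>t\<bar> \<le> T"
  shows "t *\<^sub>R ball_integral (\<lambda>y. ((1 - (norm y)\<^sup>2) / 2) *\<^sub>R dir_deriv g (x0 + t *\<^sub>R y) y) =
    ball_integral (\<lambda>y. g (x0 + t *\<^sub>R y)) -
    (real CARD('d) + 2) *\<^sub>R ball_integral (\<lambda>y. ((1 - (norm y)\<^sup>2) / 2) *\<^sub>R g (x0 + t *\<^sub>R y))"
proof -
  let ?V = "(\<lambda>y. x0 + t *\<^sub>R y) -` U"
  let ?g = "\<lambda>y. g (x0 + t *\<^sub>R y)" and ?p = "\<lambda>j y. partial_deriv j g (x0 + t *\<^sub>R y)"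
  have g1: "Ck_on (Suc 0) U g" using g by simp
  have c1: "continuous_on U g" using Ck_on_imp_continuous[OF g] .
  have c2: "continuous_on U (partial_deriv j g)" for j using g by simp
  have oV: "open ?V" by (intro continuous_open_vimage continuous_intros U)
  have cV: "continuous_on ?V (\<lambda>y. g (x0 + t *\<^sub>R y))" if "continuous_on U g" for g :: "real^'d \<Rightarrow> complex"
    by (rule continuous_on_compose2[OF that]) (auto intro!: continuous_intros)
  note c1' = continuous_on_dilated[OF c1 U(2) t] and c2' = continuous_on_dilated[OF c2 U(2) t]
  have *: "ball_integral (\<lambda>y. (1 - (norm y)\<^sup>2) *\<^sub>R (?g y + (t * y $ j) *\<^sub>R ?p j y)) =
      ball_integral (\<lambda>y. (2 * (y \<bullet> axis j 1)) *\<^sub>R ((y $ j) *\<^sub>R ?g y))" for j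
  proof (rule ball_integral_by_parts[OF _ oV cball_subset_dilated_vimage[OF U(2) t]])
    fix y :: "real^'d" and s :: real assume "y + s *\<^sub>R axis j 1 \<in> ?V"
    note d = dilated_line_deriv[OF g1 this]
    have "((\<lambda>s. (y + s *\<^sub>R axis j 1) $ j) has_vector_derivative 1) (at s)"
      by (auto intro!: derivative_eq_intros simp flip: has_real_derivative_iff_has_vector_derivative)
    from bounded_bilinear.has_vector_derivative[OF bounded_bilinear_scaleR this d]
    show "((\<lambda>s. ((y + s *\<^sub>R axis j 1) $ j) *\<^sub>R ?g (y + s *\<^sub>R axis j 1)) has_vector_derivative
        (?g (y + s *\<^sub>R axis j 1) + (t * (y + s *\<^sub>R axis j 1) $ j) *\<^sub>R ?p j (y + s *\<^sub>R axis j 1))) (at s)"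
      by (simp add: algebra_simps)
  qed (auto intro!: continuous_intros cV c1 c2)
  let ?u = "\<lambda>y::real^'d. (1 - (norm y)\<^sup>2) / 2"
  have "(\<Sum>j\<in>UNIV. ball_integral (\<lambda>y. (1 - (norm y)\<^sup>2) *\<^sub>R (?g y + (t * y $ j) *\<^sub>R ?p j y))) =
      (\<Sum>j\<in>UNIV. ball_integral (\<lambda>y. (2 * (y \<bullet> axis j 1)) *\<^sub>R ((y $ j) *\<^sub>R ?g y)))"
    by (simp only: *)
  also have "(\<Sum>j\<in>UNIV. ball_integral (\<lambda>y. (2 * (y \<bullet> axis j 1)) *\<^sub>R ((y $ j) *\<^sub>R ?g y))) =
      ball_integral (\<lambda>y. \<Sum>j\<in>UNIV. (2 * (y \<bullet> axis j 1)) *\<^sub>R ((y $ j) *\<^sub>R ?g y))"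
    by (intro ball_integral_sum[symmetric] continuous_intros c1')
  also have "\<dots> = ball_integral (\<lambda>y. 2 *\<^sub>R (?g y - 2 *\<^sub>R (?u y *\<^sub>R ?g y)))"
  proof (rule ball_integral_cong)
    fix y :: "real^'d"
    have "(\<Sum>j\<in>UNIV. (2 * (y \<bullet> axis j 1)) *\<^sub>R ((y $ j) *\<^sub>R ?g y)) = (2 * (\<Sum>j\<in>UNIV. y $ j * y $ j)) *\<^sub>R ?g y"
      by (simp add: inner_axis scaleR_sum_left[symmetric] sum_distrib_left mult.assoc)
    also have "(\<Sum>j\<in>UNIV. y $ j * y $ j) = (norm y)\<^sup>2"
      by (simp add: power2_norm_eq_inner inner_vec_def)
    finally show "(\<Sum>j\<in>UNIV. (2 * (y \<bullet> axis j 1)) *\<^sub>R ((y $ j) *\<^sub>R ?g y)) = 2 *\<^sub>R (?g y - 2 *\<^sub>R (?u y *\<^sub>R ?g y))"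
      by (simp only:) (simp add: scaleR_conv_of_real field_simps)
  qed
  also have "\<dots> = 2 *\<^sub>R (ball_integral ?g - 2 *\<^sub>R ball_integral (\<lambda>y. ?u y *\<^sub>R ?g y))"
  proof -
    have "ball_integral (\<lambda>y. ?g y - 2 *\<^sub>R (?u y *\<^sub>R ?g y)) = ball_integral ?g - ball_integral (\<lambda>y. 2 *\<^sub>R (?u y *\<^sub>R ?g y))"
      by (intro ball_integral_diff continuous_intros c1') auto
    then show ?thesis by (simp only: ball_integral_scaleR)
  qed
  also have "(\<Sum>j\<in>UNIV. ball_integral (\<lambda>y. (1 - (norm y)\<^sup>2) *\<^sub>R (?g y + (t * y $ j) *\<^sub>R ?p j y))) =
      ball_integral (\<lambda>y. \<Sum>j\<in>UNIV. (1 - (norm y)\<^sup>2) *\<^sub>R (?g y + (t * y $ j) *\<^sub>R ?p j y))"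
    by (intro ball_integral_sum[symmetric] continuous_intros c1' c2')
  also have "\<dots> = ball_integral (\<lambda>y. (2 * real CARD('d)) *\<^sub>R (?u y *\<^sub>R ?g y) + (2 * t) *\<^sub>R (?u y *\<^sub>R dir_deriv g (x0 + t *\<^sub>R y) y))"
  proof (rule ball_integral_cong)
    fix y :: "real^'d"
    have "(\<Sum>j\<in>UNIV. (1 - (norm y)\<^sup>2) *\<^sub>R (?g y + (t * y $ j) *\<^sub>R ?p j y)) =
       (1 - (norm y)\<^sup>2) *\<^sub>R (real CARD('d) *\<^sub>R ?g y + t *\<^sub>R dir_deriv g (x0 + t *\<^sub>R y) y)"
      unfolding scaleR_sum_right[symmetric] sum.distrib
      by (simp add: dir_deriv_def scaleR_sum_right sum_constant_scaleR del: sum_constant)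
    moreover have "a *\<^sub>R (n *\<^sub>R z + t *\<^sub>R w) = (2 * n) *\<^sub>R ((a / 2) *\<^sub>R z) + (2 * t) *\<^sub>R ((a / 2) *\<^sub>R w)"
      for a n :: real and z w :: complex by (simp add: scaleR_add_right mult_ac)
    ultimately show "(\<Sum>j\<in>UNIV. (1 - (norm y)\<^sup>2) *\<^sub>R (?g y + (t * y $ j) *\<^sub>R ?p j y)) =
       (2 * real CARD('d)) *\<^sub>R (?u y *\<^sub>R ?g y) + (2 * t) *\<^sub>R (?u y *\<^sub>R dir_deriv g (x0 + t *\<^sub>R y) y)"
      by (simp only:)
  qed
  also have "\<dots> = (2 * real CARD('d)) *\<^sub>R ball_integral (\<lambda>y. ?u y *\<^sub>R ?g y) +
      (2 * t) *\<^sub>R ball_integral (\<lambda>y. ?u y *\<^sub>R dir_deriv g (x0 + t *\<^sub>R y) y)"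
  proof -
    have "ball_integral (\<lambda>y. (2 * real CARD('d)) *\<^sub>R (?u y *\<^sub>R ?g y) + (2 * t) *\<^sub>R (?u y *\<^sub>R dir_deriv g (x0 + t *\<^sub>R y) y)) =
      ball_integral (\<lambda>y. (2 * real CARD('d)) *\<^sub>R (?u y *\<^sub>R ?g y)) +
      ball_integral (\<lambda>y. (2 * t) *\<^sub>R (?u y *\<^sub>R dir_deriv g (x0 + t *\<^sub>R y) y))"
      unfolding dir_deriv_def by (intro ball_integral_add continuous_intros c1' c2') auto
    then show ?thesis by (simp only: ball_integral_scaleR)
  qed
  finally have "2 *\<^sub>R (real CARD('d) *\<^sub>R ball_integral (\<lambda>y. ?u y *\<^sub>R ?g y) +
      t *\<^sub>R ball_integral (\<lambda>y. ?u y *\<^sub>R dir_deriv g (x0 + t *\<^sub>R y) y)) =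
      2 *\<^sub>R (ball_integral ?g - 2 *\<^sub>R ball_integral (\<lambda>y. ?u y *\<^sub>R ?g y))"
    by (simp add: scaleR_add_right)
  then have "real CARD('d) *\<^sub>R ball_integral (\<lambda>y. ?u y *\<^sub>R ?g y) +
      t *\<^sub>R ball_integral (\<lambda>y. ?u y *\<^sub>R dir_deriv g (x0 + t *\<^sub>R y) y) =
      ball_integral ?g - 2 *\<^sub>R ball_integral (\<lambda>y. ?u y *\<^sub>R ?g y)"
    unfolding real_vector.scale_cancel_left by simp
  then show ?thesis by (simp add: scaleR_add_left algebra_simps)
qed

lemma Ck_on_SucD: "Ck_on (Suc k) U g \<Longrightarrow> Ck_on k U g"
proof (induction k arbitrary: g)
  case 0
  then show ?case using Ck_on_imp_continuous[of "Suc 0" U g] by simp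
next
  case (Suc k)
  have "(\<forall>x\<in>U. g differentiable (at x)) \<and> (\<forall>j. Ck_on (Suc k) U (partial_deriv j g))"
    using Suc.prems by (subst (asm) Ck_on.simps(2))
  then show ?case by (subst Ck_on.simps(2)) (use Suc.IH in blast)
qed

text \<open>Neither mean is normalised: at \<open>t = 0\<close> the first is the volume of the unit ball times \<open>g x0\<close>.\<close>

definition ball_mean where
  "ball_mean g x0 t = ball_integral (\<lambda>y. g (x0 + t *\<^sub>R y))"

definition ball_mean2 where
  "ball_mean2 g x0 t = ball_integral (\<lambda>y. ((1 - (norm y)\<^sup>2) / 2) *\<^sub>R g (x0 + t *\<^sub>R y))"

lemma ball_mean_deriv:
  assumes "Ck_on 2 U \<psi>" "open U" "cball x0 T \<subseteq> U" "\<bar>t\<bar> < T"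
  shows "(ball_mean \<psi> x0 has_vector_derivative t *\<^sub>R ball_mean2 (laplacian \<psi>) x0 t) (at t)"
proof -
  have "Ck_on 1 U \<psi>" using assms(1) Ck_on_SucD[of 1 U \<psi>] by (simp only: numeral_2_eq_2 One_nat_def)
  from ball_integral_dilated_deriv[OF this assms(3,4), of "\<lambda>_. 1"] assms ball_integral_radial_deriv[of U \<psi> x0 T t]
  show ?thesis by (simp add: ball_mean_def[abs_def] ball_mean2_def)
qed

text \<open>Together with \<open>ball_mean_deriv\<close> this says \<open>M'' + (d + 1) / t M' = ball_mean (laplacian \<psi>)\<close> for
  \<open>M = ball_mean \<psi>\<close>: ball means in dimension \<open>d\<close> satisfy the radial equation of dimension \<open>d + 2\<close>.\<close>

lemma ball_mean2_laplacian_deriv: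
  fixes \<psi> :: "real^'d::finite \<Rightarrow> complex"
  assumes \<psi>: "Ck_on 3 U \<psi>" and U: "open U" "cball x0 T \<subseteq> U" and t: "\<bar>t\<bar> < T" "t \<noteq> 0"
  shows "(ball_mean2 (laplacian \<psi>) x0 has_vector_derivative
    (ball_mean (laplacian \<psi>) x0 t - (real CARD('d) + 2) *\<^sub>R ball_mean2 (laplacian \<psi>) x0 t) /\<^sub>R t) (at t)"
proof -
  define h where "h j = partial_deriv j (partial_deriv j \<psi>)" for j
  have h: "Ck_on 1 U (h j)" for j using \<psi> by (simp add: h_def numeral_3_eq_3)
  have hc: "continuous_on U (h j)" for j using Ck_on_imp_continuous[OF h] .
  note hc' = continuous_on_dilated[OF hc U(2)]
  let ?u = "\<lambda>y::real^'d. (1 - (norm y)\<^sup>2) / 2"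
  have split: "ball_mean2 (laplacian \<psi>) x0 s = (\<Sum>j\<in>UNIV. ball_mean2 (h j) x0 s)"
      "ball_mean (laplacian \<psi>) x0 s = (\<Sum>j\<in>UNIV. ball_mean (h j) x0 s)" if "\<bar>s\<bar> \<le> T" for s
    unfolding ball_mean_def ball_mean2_def laplacian_def h_def[symmetric] scaleR_sum_right
    using that by (auto intro!: ball_integral_sum continuous_intros hc')
  have d: "(ball_mean2 (h j) x0 has_vector_derivative
    (ball_mean (h j) x0 t - (real CARD('d) + 2) *\<^sub>R ball_mean2 (h j) x0 t) /\<^sub>R t) (at t)" for j
  proof -
    have "(ball_mean2 (h j) x0 has_vector_derivative
      ball_integral (\<lambda>y. ?u y *\<^sub>R dir_deriv (h j) (x0 + t *\<^sub>R y) y)) (at t)"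
      unfolding ball_mean2_def[abs_def]
      by (intro ball_integral_dilated_deriv[OF h U(2) t(1)] continuous_intros) auto
    moreover have "t *\<^sub>R ball_integral (\<lambda>y. ?u y *\<^sub>R dir_deriv (h j) (x0 + t *\<^sub>R y) y)
      = ball_mean (h j) x0 t - (real CARD('d) + 2) *\<^sub>R ball_mean2 (h j) x0 t"
      unfolding ball_mean_def ball_mean2_def using t by (intro ball_integral_euler[OF h U]) simp
    from this[symmetric] have "(ball_mean (h j) x0 t - (real CARD('d) + 2) *\<^sub>R ball_mean2 (h j) x0 t) /\<^sub>R t
      = ball_integral (\<lambda>y. ?u y *\<^sub>R dir_deriv (h j) (x0 + t *\<^sub>R y) y)"
      using t(2) by (simp only: scaleR_scaleR) simp
    ultimately show ?thesis by (simp only:)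
  qed
  have "((\<lambda>s. \<Sum>j\<in>UNIV. ball_mean2 (h j) x0 s) has_vector_derivative
     (\<Sum>j\<in>UNIV. (ball_mean (h j) x0 t - (real CARD('d) + 2) *\<^sub>R ball_mean2 (h j) x0 t) /\<^sub>R t)) (at t)"
    by (intro has_vector_derivative_sum d)
  then have "((\<lambda>s. \<Sum>j\<in>UNIV. ball_mean2 (h j) x0 s) has_vector_derivative
    (ball_mean (laplacian \<psi>) x0 t - (real CARD('d) + 2) *\<^sub>R ball_mean2 (laplacian \<psi>) x0 t) /\<^sub>R t) (at t)"
    using t(1) by (simp add: split sum_subtractf scaleR_sum_right[symmetric])
  then show ?thesis
    by (rule has_vector_derivative_transform_within_open[of _ _ _ "{-T<..<T}"]) (use t in \<open>auto simp: split\<close>)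
qed

section \<open>Ball means and square integrals\<close>

definition mass :: "(real^'d::finite \<Rightarrow> complex) \<Rightarrow> real^'d \<Rightarrow> real \<Rightarrow> real" where
  "mass g x0 t = (\<integral>z. indicator (cball x0 t) z *\<^sub>R (cmod (g z))\<^sup>2 \<partial>lborel)"

lemma lborel_integral_dilation:
  fixes f :: "real^'d::finite \<Rightarrow> 'b::{banach, second_countable_topology}"
  assumes "f \<in> borel_measurable borel" "t > 0"
  shows "integral\<^sup>L lborel f = t ^ CARD('d) *\<^sub>R (\<integral>y. f (x0 + t *\<^sub>R y) \<partial>lborel)"
proof -
  have "integral\<^sup>L lborel f = integral\<^sup>L (density (distr lborel borel (\<lambda>x. x0 + t *\<^sub>R x)) (\<lambda>_. ennreal (\<bar>t\<bar> ^ DIM(real^'d)))) f"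
    using lborel_affine[of t x0] assms(2) by simp
  also have "\<dots> = (\<integral>x. (\<bar>t\<bar> ^ DIM(real^'d)) *\<^sub>R f x \<partial>distr lborel borel (\<lambda>x. x0 + t *\<^sub>R x))"
    using assms by (intro integral_density) auto
  also have "\<dots> = (\<integral>y. (\<bar>t\<bar> ^ DIM(real^'d)) *\<^sub>R f (x0 + t *\<^sub>R y) \<partial>lborel)"
    using assms by (intro integral_distr) auto
  also have "\<dots> = (\<bar>t\<bar> ^ DIM(real^'d)) *\<^sub>R (\<integral>y. f (x0 + t *\<^sub>R y) \<partial>lborel)"
    using assms(2) by simp
  finally show ?thesis using assms(2) by simp
qed

lemma indicator_cball_dilation:
  fixes x0 :: "real^'d::finite"
  assumes "t > 0"
  shows "indicator (cball x0 t) (x0 + t *\<^sub>R y) = (indicator (cball 0 1) y :: real)"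
  using assms by (simp add: indicator_def dist_norm mult_le_cancel_left1)

lemma integral_cball_dilation:
  fixes g :: "real^'d::finite \<Rightarrow> 'b::{banach, second_countable_topology}"
  assumes "continuous_on (cball x0 t) g" "t > 0"
  shows "(\<integral>z. indicator (cball x0 t) z *\<^sub>R g z \<partial>lborel) =
    t ^ CARD('d) *\<^sub>R (\<integral>y. indicator (cball 0 1) y *\<^sub>R g (x0 + t *\<^sub>R y) \<partial>lborel)"
proof -
  have "integrable lborel (\<lambda>z. indicator (cball x0 t) z *\<^sub>R g z)"
    using assms by (intro borel_integrable_compact) auto
  then have "(\<lambda>z. indicator (cball x0 t) z *\<^sub>R g z) \<in> borel_measurable borel"
    using borel_measurable_integrable by fastforce
  from lborel_integral_dilation[OF this assms(2), of x0] show ?thesis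
    by (simp add: indicator_cball_dilation[OF assms(2)])
qed

lemma ball_mean_eq_integral:
  fixes g :: "real^'d::finite \<Rightarrow> complex"
  assumes "continuous_on (cball x0 t) g" "t > 0"
  shows "t ^ CARD('d) *\<^sub>R ball_mean g x0 t = (\<integral>z. indicator (cball x0 t) z *\<^sub>R g z \<partial>lborel)"
  unfolding ball_mean_def ball_integral_def using integral_cball_dilation[OF assms] by simp

lemma mass_nonneg: "mass g x0 t \<ge> 0"
  unfolding mass_def by (intro integral_nonneg_AE AE_I2) (auto simp: indicator_def)

lemma mass_mono:
  fixes g :: "real^'d::finite \<Rightarrow> complex"
  assumes "continuous_on (cball x0 t) g" "cball x1 s \<subseteq> cball x0 t"
  shows "mass g x1 s \<le> mass g x0 t"
  unfolding mass_def
proof (rule integral_mono)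
  have "continuous_on (cball x1 s) g" using assms continuous_on_subset by blast
  then show "integrable lborel (\<lambda>z. indicator (cball x1 s) z *\<^sub>R (cmod (g z))\<^sup>2)"
    by (intro borel_integrable_compact continuous_intros) auto
  show "integrable lborel (\<lambda>z. indicator (cball x0 t) z *\<^sub>R (cmod (g z))\<^sup>2)"
    using assms by (intro borel_integrable_compact continuous_intros) auto
  show "indicator (cball x1 s) z *\<^sub>R (cmod (g z))\<^sup>2 \<le> indicator (cball x0 t) z *\<^sub>R (cmod (g z))\<^sup>2" for z
    using assms(2) by (auto simp: indicator_def)
qed

text \<open>By the inequality of the arithmetic and geometric means \<open>\<bar>g\<bar> \<le> \<epsilon> / 2 + \<bar>g\<bar>\<^sup>2 / (2 \<epsilon>)\<close>. In contrast to \<open>\<bar>g\<bar>\<close> the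
  right-hand side is as smooth as \<open>g\<close>, so that its integral over balls is differentiable in the
  radius; an optimal choice of \<open>\<epsilon>\<close> recovers the Cauchy-Schwarz inequality. It is taken with complex values
  because ball means are.\<close>

definition energy_density :: "real \<Rightarrow> (real^'d::finite \<Rightarrow> complex) \<Rightarrow> real^'d \<Rightarrow> complex" where
  "energy_density \<epsilon> g = (\<lambda>z. of_real (\<epsilon> / 2) + of_real (1 / (2 * \<epsilon>)) * (g z * cnj (g z)))"

lemma energy_density_eq: "energy_density \<epsilon> g z = of_real (\<epsilon> / 2 + (cmod (g z))\<^sup>2 / (2 * \<epsilon>))"
  by (simp add: energy_density_def complex_norm_square[symmetric])

lemma cmod_le_energy_density:
  assumes "\<epsilon> > 0"
  shows "cmod (g z) \<le> \<epsilon> / 2 + (cmod (g z))\<^sup>2 / (2 * \<epsilon>)"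
proof -
  have "0 \<le> (cmod (g z) - \<epsilon>)\<^sup>2" by simp
  then have "2 * \<epsilon> * cmod (g z) \<le> \<epsilon>\<^sup>2 + (cmod (g z))\<^sup>2" by (simp add: power2_eq_square algebra_simps)
  then show ?thesis using assms by (simp add: field_simps power2_eq_square)
qed

definition energy :: "real \<Rightarrow> (real^'d::finite \<Rightarrow> complex) \<Rightarrow> real^'d \<Rightarrow> real \<Rightarrow> real" where
  "energy \<epsilon> g x0 t = t ^ CARD('d) * Re (ball_mean (energy_density \<epsilon> g) x0 t)"

lemma continuous_on_energy_density:
  "continuous_on S g \<Longrightarrow> continuous_on S (energy_density \<epsilon> g)"
  unfolding energy_density_def by (intro continuous_intros)

lemma energy_eq_integral:
  fixes g :: "real^'d::finite \<Rightarrow> complex"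
  assumes "continuous_on (cball x0 t) g" "t > 0"
  shows "energy \<epsilon> g x0 t = (\<integral>z. indicator (cball x0 t) z *\<^sub>R (\<epsilon> / 2 + (cmod (g z))\<^sup>2 / (2 * \<epsilon>)) \<partial>lborel)"
proof -
  have "energy \<epsilon> g x0 t = Re (t ^ CARD('d) *\<^sub>R ball_mean (energy_density \<epsilon> g) x0 t)"
    by (simp add: energy_def)
  also have "\<dots> = Re (\<integral>z. indicator (cball x0 t) z *\<^sub>R energy_density \<epsilon> g z \<partial>lborel)"
    using assms by (simp add: ball_mean_eq_integral continuous_on_energy_density)
  also have "\<dots> = Re (\<integral>z. of_real (indicator (cball x0 t) z *\<^sub>R (\<epsilon> / 2 + (cmod (g z))\<^sup>2 / (2 * \<epsilon>))) \<partial>lborel)"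
    unfolding energy_density_eq by (simp add: scaleR_conv_of_real)
  also have "\<dots> = (\<integral>z. indicator (cball x0 t) z *\<^sub>R (\<epsilon> / 2 + (cmod (g z))\<^sup>2 / (2 * \<epsilon>)) \<partial>lborel)"
    by (subst integral_complex_of_real) simp
  finally show ?thesis .
qed

lemma energy_eq_mass:
  fixes g :: "real^'d::finite \<Rightarrow> complex"
  assumes "continuous_on (cball x0 t) g" "t > 0"
  shows "energy \<epsilon> g x0 t = \<epsilon> / 2 * (unit_vol TYPE('d) * t ^ CARD('d)) + mass g x0 t / (2 * \<epsilon>)"
proof -
  have vol: "(\<integral>z. indicator (cball x0 t) z *\<^sub>R (\<epsilon> / 2) \<partial>lborel) = \<epsilon> / 2 * (unit_vol TYPE('d) * t ^ CARD('d))"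
    using integral_cball_dilation[of x0 t "\<lambda>_. \<epsilon> / 2"] assms(2)
    by (simp only: integral_indicator_unit_ball continuous_on_const) simp
  have "energy \<epsilon> g x0 t = (\<integral>z. indicator (cball x0 t) z *\<^sub>R (\<epsilon> / 2) + (indicator (cball x0 t) z *\<^sub>R (cmod (g z))\<^sup>2) / (2 * \<epsilon>) \<partial>lborel)"
    by (simp add: energy_eq_integral[OF assms] distrib_left)
  also have "\<dots> = (\<integral>z. indicator (cball x0 t) z *\<^sub>R (\<epsilon> / 2) \<partial>lborel) + (\<integral>z. (indicator (cball x0 t) z *\<^sub>R (cmod (g z))\<^sup>2) / (2 * \<epsilon>) \<partial>lborel)"
    using assms by (intro Bochner_Integration.integral_add integrable_divide borel_integrable_compact continuous_intros) auto
  also have "\<dots> = \<epsilon> / 2 * (unit_vol TYPE('d) * t ^ CARD('d)) + mass g x0 t / (2 * \<epsilon>)"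
    unfolding vol mass_def by simp
  finally show ?thesis .
qed

lemma ball_mean_norm_le_energy:
  fixes g :: "real^'d::finite \<Rightarrow> complex"
  assumes "continuous_on (cball x0 t) g" "t > 0" "\<epsilon> > 0"
  shows "t ^ CARD('d) * cmod (ball_mean g x0 t) \<le> energy \<epsilon> g x0 t"
proof -
  have "t ^ CARD('d) * cmod (ball_mean g x0 t) = cmod (t ^ CARD('d) *\<^sub>R ball_mean g x0 t)"
    using assms(2) by simp
  also have "\<dots> = cmod (\<integral>z. indicator (cball x0 t) z *\<^sub>R g z \<partial>lborel)"
    by (simp only: ball_mean_eq_integral[OF assms(1,2)])
  also have "\<dots> \<le> (\<integral>z. indicator (cball x0 t) z *\<^sub>R (\<epsilon> / 2 + (cmod (g z))\<^sup>2 / (2 * \<epsilon>)) \<partial>lborel)"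
  proof (rule order_trans[OF integral_norm_bound integral_mono])
    show "integrable lborel (\<lambda>z. norm (indicator (cball x0 t) z *\<^sub>R g z))"
      using assms by (intro integrable_norm borel_integrable_compact) auto
    show "integrable lborel (\<lambda>z. indicator (cball x0 t) z *\<^sub>R (\<epsilon> / 2 + (cmod (g z))\<^sup>2 / (2 * \<epsilon>)))"
      using assms by (intro borel_integrable_compact continuous_intros) auto
    show "norm (indicator (cball x0 t) z *\<^sub>R g z) \<le> indicator (cball x0 t) z *\<^sub>R (\<epsilon> / 2 + (cmod (g z))\<^sup>2 / (2 * \<epsilon>))" for z
      using cmod_le_energy_density[OF assms(3), of g z] by (simp add: indicator_def)
  qed
  finally show ?thesis by (simp add: energy_eq_integral[OF assms(1,2)])
qed

lemma ball_mean_cauchy_schwarz: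
  fixes g :: "real^'d::finite \<Rightarrow> complex"
  assumes "continuous_on (cball x0 t) g" "t > 0"
  shows "t ^ CARD('d) * (cmod (ball_mean g x0 t))\<^sup>2 \<le> unit_vol TYPE('d) * mass g x0 t"
proof -
  define n where "n = cmod (ball_mean g x0 t)"
  define v where "v = unit_vol TYPE('d) * t ^ CARD('d)"
  define m where "m = mass g x0 t"
  have v: "v > 0" unfolding v_def using unit_vol_pos[where 'd = 'd] assms(2) by simp
  have le: "2 * \<epsilon> * (t ^ CARD('d) * n) \<le> \<epsilon>\<^sup>2 * v + m" if "\<epsilon> > 0" for \<epsilon>
  proof -
    have "t ^ CARD('d) * n \<le> \<epsilon> / 2 * v + m / (2 * \<epsilon>)"
      using ball_mean_norm_le_energy[OF assms that] unfolding energy_eq_mass[OF assms] n_def v_def m_def .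
    then show ?thesis using that by (simp add: field_simps power2_eq_square)
  qed
  show ?thesis
  proof (cases "n = 0")
    case True
    then show ?thesis using mass_nonneg[of g x0 t] unit_vol_pos[where 'd = 'd] unfolding n_def by simp
  next
    case False
    define \<epsilon> where "\<epsilon> = t ^ CARD('d) * n / v"
    have n: "n > 0" using False by (simp add: n_def)
    have e: "\<epsilon> > 0" unfolding \<epsilon>_def using n v assms(2) by simp
    have tn: "t ^ CARD('d) * n = \<epsilon> * v" using v by (simp add: \<epsilon>_def)
    have "\<epsilon>\<^sup>2 * v \<le> m" using le[OF e] unfolding tn by (simp add: power2_eq_square)
    then have "unit_vol TYPE('d) * (\<epsilon>\<^sup>2 * v) \<le> unit_vol TYPE('d) * m"
      using unit_vol_pos[where 'd = 'd] by simp
    moreover have "t ^ CARD('d) * n\<^sup>2 = unit_vol TYPE('d) * (\<epsilon>\<^sup>2 * v)"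
    proof -
      have "n = \<epsilon> * unit_vol TYPE('d)" using tn assms(2) by (simp add: v_def)
      then show ?thesis by (simp add: v_def power2_eq_square)
    qed
    ultimately show ?thesis by (simp add: n_def m_def)
  qed
qed

text \<open>Controls the oscillation of the integrals over balls by a monotone differentiable function. In the
  limit of thin shells it bounds their radial derivative.\<close>

lemma shell_le_energy_diff:
  fixes g :: "real^'d::finite \<Rightarrow> complex"
  assumes g: "continuous_on (cball x0 t) g" and s: "0 < s" "s \<le> t" and \<epsilon>: "\<epsilon> > 0"
  shows "cmod (t ^ CARD('d) *\<^sub>R ball_mean g x0 t - s ^ CARD('d) *\<^sub>R ball_mean g x0 s)
    \<le> energy \<epsilon> g x0 t - energy \<epsilon> g x0 s"
proof -
  have t: "t > 0" using s by simp
  have gs: "continuous_on (cball x0 s) g" using g by (rule continuous_on_subset) (use s in auto)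
  let ?k = "\<lambda>z. \<epsilon> / 2 + (cmod (g z))\<^sup>2 / (2 * \<epsilon>)"
  have ig: "integrable lborel (\<lambda>z. indicator (cball x0 t) z *\<^sub>R g z)" "integrable lborel (\<lambda>z. indicator (cball x0 s) z *\<^sub>R g z)"
    using g gs by (auto intro!: borel_integrable_compact)
  have ik: "integrable lborel (\<lambda>z. indicator (cball x0 t) z *\<^sub>R ?k z)" "integrable lborel (\<lambda>z. indicator (cball x0 s) z *\<^sub>R ?k z)"
    by (intro borel_integrable_compact compact_cball continuous_intros g gs; use \<epsilon> in simp)+
  have "cmod (t ^ CARD('d) *\<^sub>R ball_mean g x0 t - s ^ CARD('d) *\<^sub>R ball_mean g x0 s) =
      cmod (\<integral>z. indicator (cball x0 t) z *\<^sub>R g z - indicator (cball x0 s) z *\<^sub>R g z \<partial>lborel)"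
    unfolding ball_mean_eq_integral[OF g t] ball_mean_eq_integral[OF gs s(1)]
    by (subst Bochner_Integration.integral_diff[OF ig]) simp
  also have "\<dots> \<le> (\<integral>z. indicator (cball x0 t) z *\<^sub>R ?k z - indicator (cball x0 s) z *\<^sub>R ?k z \<partial>lborel)"
  proof (rule order_trans[OF integral_norm_bound integral_mono])
    show "integrable lborel (\<lambda>z. norm (indicator (cball x0 t) z *\<^sub>R g z - indicator (cball x0 s) z *\<^sub>R g z))"
      by (intro integrable_norm Bochner_Integration.integrable_diff ig)
    show "integrable lborel (\<lambda>z. indicator (cball x0 t) z *\<^sub>R ?k z - indicator (cball x0 s) z *\<^sub>R ?k z)"
      by (intro Bochner_Integration.integrable_diff ik)
    show "norm (indicator (cball x0 t) z *\<^sub>R g z - indicator (cball x0 s) z *\<^sub>R g z)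
      \<le> indicator (cball x0 t) z *\<^sub>R ?k z - indicator (cball x0 s) z *\<^sub>R ?k z" for z
      using cmod_le_energy_density[OF \<epsilon>, of g z] s by (auto simp: indicator_def)
  qed
  also have "\<dots> = energy \<epsilon> g x0 t - energy \<epsilon> g x0 s"
    unfolding energy_eq_integral[OF g t] energy_eq_integral[OF gs s(1)]
    by (rule Bochner_Integration.integral_diff[OF ik])
  finally show ?thesis .
qed

lemma Ck_on_1_energy_density:
  assumes U: "open U" and g: "Ck_on 1 U g"
  shows "Ck_on 1 U (energy_density \<epsilon> g)"
proof -
  have c: "continuous_on U g" "continuous_on U (partial_deriv j g)" for j
    using g Ck_on_imp_continuous[OF g] by auto
  have d: "(energy_density \<epsilon> g has_derivative
      (\<lambda>v. of_real (1 / (2 * \<epsilon>)) * (g x * cnj (dir_deriv g x v) + dir_deriv g x v * cnj (g x)))) (at x)" if "x \<in> U" for x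
    unfolding energy_density_def
  proof -
    have dg: "(g has_derivative dir_deriv g x) (at x)"
      using g that by (intro has_derivative_dir_deriv[of 0 U]) auto
    have dc: "((\<lambda>z. cnj (g z)) has_derivative (\<lambda>v. cnj (dir_deriv g x v))) (at x)"
      by (rule bounded_linear.has_derivative[OF bounded_linear_cnj dg])
    show "((\<lambda>z. of_real (\<epsilon> / 2) + of_real (1 / (2 * \<epsilon>)) * (g z * cnj (g z))) has_derivative
      (\<lambda>v. of_real (1 / (2 * \<epsilon>)) * (g x * cnj (dir_deriv g x v) + dir_deriv g x v * cnj (g x)))) (at x)"
      using has_derivative_add[OF has_derivative_const[of "of_real (\<epsilon> / 2)"]
        bounded_linear.has_derivative[OF bounded_linear_mult_right[of "of_real (1 / (2 * \<epsilon>))"] has_derivative_mult[OF dg dc]]]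
      by (simp only: add_0_left)
  qed
  have p: "partial_deriv j (energy_density \<epsilon> g) x =
      of_real (1 / (2 * \<epsilon>)) * (g x * cnj (partial_deriv j g x) + partial_deriv j g x * cnj (g x))" if "x \<in> U" for x j
    unfolding partial_deriv_def[of j "energy_density \<epsilon> g"] frechet_derivative_at[OF d[OF that], symmetric]
    by (simp add: dir_deriv_axis)
  have "continuous_on U (partial_deriv j (energy_density \<epsilon> g))" for j
  proof -
    have "continuous_on U (\<lambda>x. of_real (1 / (2 * \<epsilon>)) * (g x * cnj (partial_deriv j g x) + partial_deriv j g x * cnj (g x)))"
      by (intro continuous_intros c)
    then show ?thesis by (subst continuous_on_cong[OF refl p]) auto
  qed
  then show ?thesis using d by (auto simp: differentiable_def)
qed

lemma norm_vector_derivative_le: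
  fixes f :: "real \<Rightarrow> 'a::real_normed_vector"
  assumes f: "(f has_vector_derivative D) (at t)" and G: "(G has_real_derivative G') (at t)"
    and \<delta>: "\<delta> > 0" and le: "\<And>s. t < s \<Longrightarrow> s < t + \<delta> \<Longrightarrow> norm (f s - f t) \<le> G s - G t"
  shows "norm D \<le> G'"
proof -
  have 1: "((\<lambda>h. (f (t + h) - f t) /\<^sub>R h) \<longlongrightarrow> D) (at_right 0)"
    using f unfolding has_vector_derivative_iff_quotient by (rule filterlim_at_split[THEN iffD1, THEN conjunct2])
  have "(G has_vector_derivative G') (at t)" using G by (simp add: has_real_derivative_iff_has_vector_derivative)
  then have 2: "((\<lambda>h. (G (t + h) - G t) /\<^sub>R h) \<longlongrightarrow> G') (at_right 0)"
    unfolding has_vector_derivative_iff_quotient by (rule filterlim_at_split[THEN iffD1, THEN conjunct2])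
  show ?thesis
  proof (rule tendsto_le[OF _ 2 tendsto_norm[OF 1]])
    show "\<forall>\<^sub>F h in at_right 0. norm ((f (t + h) - f t) /\<^sub>R h) \<le> (G (t + h) - G t) /\<^sub>R h"
      using eventually_at_right_real[OF \<delta>]
    proof eventually_elim
      case (elim h)
      then show ?case using le[of "t + h"] by (simp add: mult_left_mono)
    qed
  qed simp
qed

lemma ball_mean_at_0: "ball_mean g x0 0 = unit_vol TYPE('d) *\<^sub>R g (x0 :: real^'d::finite)"
  by (simp add: ball_mean_def ball_integral_const)

section \<open>Ball means of eigenfunctions\<close>

text \<open>An eigenfunction on the ball of radius \<open>2 r\<close>, where \<open>S\<close> is a provisional bound of \<open>\<psi>\<close> on the ball of radius \<open>r\<close> that
  is absorbed later. The larger ball makes everything differentiable up to the radius \<open>r\<close>.\<close>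

locale eigenball =
  fixes U :: "(real^'d::finite) set" and \<psi> V :: "real^'d \<Rightarrow> complex" and lam :: complex
    and x :: "real^'d" and r Q S k :: real
  assumes U: "open U" "cball x (2 * r) \<subseteq> U" and r: "0 < r" "r \<le> 1"
    and \<psi>: "Ck_on 3 U \<psi>" and V: "continuous_on U V" and Q: "Q \<ge> 0"
    and V_le: "\<And>z. z \<in> cball x r \<Longrightarrow> cmod (V z) \<le> Q\<^sup>2"
    and pde: "\<And>z. z \<in> U \<Longrightarrow> - laplacian \<psi> z + V z * \<psi> z = lam * \<psi> z"
    and lam: "cmod lam = k\<^sup>2" and k: "k \<ge> 1"
    and S: "\<And>z. z \<in> cball x r \<Longrightarrow> cmod (\<psi> z) \<le> S"
begin

abbreviation "M \<equiv> ball_mean \<psi> x"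
abbreviation "N \<equiv> ball_mean2 (laplacian \<psi>) x"
abbreviation "MV \<equiv> ball_mean (\<lambda>z. V z * \<psi> z) x"
abbreviation "m \<equiv> mass \<psi> x r"

lemma sub: "cball x r \<subseteq> U"
  using subset_cball[of r "2 * r" x] U(2) r by simp

lemma \<psi>_cont: "continuous_on U \<psi>" using Ck_on_imp_continuous[OF \<psi>] .

lemma S_nonneg: "S \<ge> 0" using order_trans[OF norm_ge_zero S[of x]] r by simp

lemma om_pos: "unit_vol TYPE('d) > 0" by (rule unit_vol_pos)

lemma dil: "\<bar>t\<bar> \<le> r \<Longrightarrow> norm y \<le> 1 \<Longrightarrow> x + t *\<^sub>R y \<in> cball x r"
  using mult_mono[of "\<bar>t\<bar>" r "norm y" 1] r by (simp add: dist_norm)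

lemma laplacian_eq: "z \<in> U \<Longrightarrow> laplacian \<psi> z = V z * \<psi> z - lam * \<psi> z"
  using pde[of z] by (simp add: algebra_simps add_eq_0_iff)

lemma M_deriv: "\<bar>t\<bar> \<le> r \<Longrightarrow> (M has_vector_derivative t *\<^sub>R N t) (at t)"
proof -
  have "Ck_on 2 U \<psi>" using \<psi> Ck_on_SucD[of 2 U \<psi>] by (simp only: numeral_3_eq_3 numeral_2_eq_2)
  then show "\<bar>t\<bar> \<le> r \<Longrightarrow> (M has_vector_derivative t *\<^sub>R N t) (at t)"
    using U r by (intro ball_mean_deriv[where T = "2 * r"]) auto
qed

lemma M_laplacian: "\<bar>t\<bar> \<le> r \<Longrightarrow> ball_mean (laplacian \<psi>) x t = MV t - lam * M t"
proof -
  assume t: "\<bar>t\<bar> \<le> r"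
  have "ball_mean (laplacian \<psi>) x t = ball_integral (\<lambda>y. V (x + t *\<^sub>R y) * \<psi> (x + t *\<^sub>R y) - lam * \<psi> (x + t *\<^sub>R y))"
    unfolding ball_mean_def
  proof (rule ball_integral_cong)
    fix y :: "real^'d" assume "norm y \<le> 1"
    then have "x + t *\<^sub>R y \<in> U" using dil[OF t] sub by blast
    then show "laplacian \<psi> (x + t *\<^sub>R y) = V (x + t *\<^sub>R y) * \<psi> (x + t *\<^sub>R y) - lam * \<psi> (x + t *\<^sub>R y)"
      by (rule laplacian_eq)
  qed
  also have "\<dots> = ball_integral (\<lambda>y. V (x + t *\<^sub>R y) * \<psi> (x + t *\<^sub>R y)) - ball_integral (\<lambda>y. lam * \<psi> (x + t *\<^sub>R y))"
    by (intro ball_integral_diff continuous_intros continuous_on_dilated[OF \<psi>_cont sub t] continuous_on_dilated[OF V sub t])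
  finally show ?thesis by (simp add: ball_mean_def ball_integral_mult)
qed

lemma N_deriv: "0 < t \<Longrightarrow> t \<le> r \<Longrightarrow>
    (N has_vector_derivative (MV t - lam * M t - (real CARD('d) + 2) *\<^sub>R N t) /\<^sub>R t) (at t)"
  using ball_mean2_laplacian_deriv[OF \<psi> U, of t] r M_laplacian[of t] by simp

lemma M_le: "\<bar>t\<bar> \<le> r \<Longrightarrow> cmod (M t) \<le> unit_vol TYPE('d) * S"
  unfolding ball_mean_def using continuous_on_dilated[OF \<psi>_cont sub] S dil
  by (intro ball_integral_norm_le) auto

lemma N_le: assumes t: "\<bar>t\<bar> \<le> r" shows "cmod (N t) \<le> unit_vol TYPE('d) * ((Q\<^sup>2 + k\<^sup>2) * S / 2)"
proof -
  have "N t = ball_integral (\<lambda>y. ((1 - (norm y)\<^sup>2) / 2) *\<^sub>R ((V (x + t *\<^sub>R y) - lam) * \<psi> (x + t *\<^sub>R y)))"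
    unfolding ball_mean2_def
  proof (rule ball_integral_cong)
    fix y :: "real^'d" assume "norm y \<le> 1"
    then have "x + t *\<^sub>R y \<in> U" using dil[OF t] sub by blast
    from laplacian_eq[OF this]
    show "((1 - (norm y)\<^sup>2) / 2) *\<^sub>R laplacian \<psi> (x + t *\<^sub>R y) =
       ((1 - (norm y)\<^sup>2) / 2) *\<^sub>R ((V (x + t *\<^sub>R y) - lam) * \<psi> (x + t *\<^sub>R y))"
      by (simp add: left_diff_distrib)
  qed
  also have "cmod \<dots> \<le> unit_vol TYPE('d) * ((Q\<^sup>2 + k\<^sup>2) * S / 2)"
  proof (rule ball_integral_norm_le)
    show "continuous_on (cball 0 1) (\<lambda>y. ((1 - (norm y)\<^sup>2) / 2) *\<^sub>R ((V (x + t *\<^sub>R y) - lam) * \<psi> (x + t *\<^sub>R y)))"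
      by (intro continuous_intros continuous_on_dilated[OF \<psi>_cont sub t] continuous_on_dilated[OF V sub t]) auto
    fix y :: "real^'d" assume y: "norm y \<le> 1"
    then have y2: "(norm y)\<^sup>2 \<le> 1" by (simp add: abs_square_le_1)
    have "cmod (V (x + t *\<^sub>R y) - lam) \<le> Q\<^sup>2 + k\<^sup>2"
      using norm_triangle_ineq4[of "V (x + t *\<^sub>R y)" lam] V_le[OF dil[OF t y]] lam by simp
    then have "cmod ((V (x + t *\<^sub>R y) - lam) * \<psi> (x + t *\<^sub>R y)) \<le> (Q\<^sup>2 + k\<^sup>2) * S"
      unfolding norm_mult using S[OF dil[OF t y]] by (intro mult_mono) auto
    then have "\<bar>(1 - (norm y)\<^sup>2) / 2\<bar> * cmod ((V (x + t *\<^sub>R y) - lam) * \<psi> (x + t *\<^sub>R y)) \<le> (1 / 2) * ((Q\<^sup>2 + k\<^sup>2) * S)"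
      using y2 S_nonneg by (intro mult_mono) auto
    then show "cmod (((1 - (norm y)\<^sup>2) / 2) *\<^sub>R ((V (x + t *\<^sub>R y) - lam) * \<psi> (x + t *\<^sub>R y))) \<le> (Q\<^sup>2 + k\<^sup>2) * S / 2"
      by simp
  qed
  finally show ?thesis .
qed

text \<open>Near the centre both \<open>V\<close> and \<open>lam\<close> are perturbations of the Laplace equation, for which ball means are
  constant. The deviation is a small multiple of \<open>S\<close>; the \<open>L\<^sup>2\<close> norm of \<open>\<psi>\<close> in place of \<open>S\<close> would not do, because
  the fundamental solution of the Laplacian is not square integrable at the origin for \<open>d \<ge> 4\<close>.\<close>

lemma value_le_mean:
  assumes s: "0 < s" "s \<le> r" and \<theta>: "(Q\<^sup>2 + k\<^sup>2) * s\<^sup>2 / 2 \<le> \<theta>"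
  shows "(cmod (\<psi> x))\<^sup>2 \<le> 2 * (cmod (M s))\<^sup>2 / (unit_vol TYPE('d))\<^sup>2 + 2 * \<theta>\<^sup>2 * S\<^sup>2"
proof -
  have "cmod (M s - M 0) \<le> (s * (unit_vol TYPE('d) * ((Q\<^sup>2 + k\<^sup>2) * S / 2))) * \<bar>s - 0\<bar>"
  proof (rule norm_diff_le_of_vector_derivative_le)
    fix t assume "t \<in> closed_segment 0 s"
    then have t: "0 \<le> t" "t \<le> s" using s by (auto simp: closed_segment_eq_real_ivl)
    show "(M has_vector_derivative t *\<^sub>R N t) (at t)" using t s by (intro M_deriv) auto
    show "cmod (t *\<^sub>R N t) \<le> s * (unit_vol TYPE('d) * ((Q\<^sup>2 + k\<^sup>2) * S / 2))"
      using mult_mono[OF t(2) N_le[of t]] t s by simp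
  qed
  also have "\<dots> = unit_vol TYPE('d) * ((Q\<^sup>2 + k\<^sup>2) * s\<^sup>2 / 2) * S" using s by (simp add: power2_eq_square)
  also have "\<dots> \<le> unit_vol TYPE('d) * \<theta> * S"
    using \<theta> om_pos S_nonneg by (intro mult_right_mono mult_left_mono) auto
  finally have 1: "cmod (M s - M 0) \<le> unit_vol TYPE('d) * \<theta> * S" .
  have "unit_vol TYPE('d) * cmod (\<psi> x) = cmod (M 0)" using om_pos by (simp add: ball_mean_at_0)
  also have "\<dots> \<le> cmod (M s) + cmod (M s - M 0)"
    using norm_triangle_ineq2[of "M 0" "M s"] by (simp add: norm_minus_commute)
  finally have "unit_vol TYPE('d) * cmod (\<psi> x) \<le> cmod (M s) + unit_vol TYPE('d) * \<theta> * S" using 1 by linarith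
  then have "cmod (\<psi> x) \<le> cmod (M s) / unit_vol TYPE('d) + \<theta> * S"
    using om_pos by (simp add: field_simps)
  then have "(cmod (\<psi> x))\<^sup>2 \<le> (cmod (M s) / unit_vol TYPE('d) + \<theta> * S)\<^sup>2" by (intro power_mono) auto
  also have "\<dots> \<le> 2 * (cmod (M s) / unit_vol TYPE('d))\<^sup>2 + 2 * (\<theta> * S)\<^sup>2"
  proof -
    have "0 \<le> (cmod (M s) / unit_vol TYPE('d) - \<theta> * S)\<^sup>2" by simp
    then show ?thesis by (simp add: power2_sum power2_diff)
  qed
  finally show ?thesis by (simp add: power_divide power_mult_distrib)
qed

lemma mass_le: "0 < t \<Longrightarrow> t \<le> r \<Longrightarrow> mass \<psi> x t \<le> m"
  using continuous_on_subset[OF \<psi>_cont sub] by (intro mass_mono subset_cball) auto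

lemma M_mass: "0 < t \<Longrightarrow> t \<le> r \<Longrightarrow> t ^ CARD('d) * (cmod (M t))\<^sup>2 \<le> unit_vol TYPE('d) * m"
proof -
  assume t: "0 < t" "t \<le> r"
  have "cball x t \<subseteq> cball x r" using t by (intro subset_cball)
  then have "continuous_on (cball x t) \<psi>" using \<psi>_cont sub continuous_on_subset by blast
  from ball_mean_cauchy_schwarz[OF this t(1)]
  show ?thesis using mass_le[OF t] om_pos by (smt (verit) mult_left_mono)
qed

lemma MV_mass: "0 < t \<Longrightarrow> t \<le> r \<Longrightarrow> t ^ CARD('d) * (cmod (MV t))\<^sup>2 \<le> unit_vol TYPE('d) * (Q\<^sup>2 * Q\<^sup>2 * m)"
proof -
  assume t: "0 < t" "t \<le> r"
  have s: "cball x t \<subseteq> cball x r" using t by (intro subset_cball)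
  then have c: "continuous_on (cball x t) \<psi>" "continuous_on (cball x t) V"
    using \<psi>_cont V sub continuous_on_subset by blast+
  have "t ^ CARD('d) * (cmod (MV t))\<^sup>2 \<le> unit_vol TYPE('d) * mass (\<lambda>z. V z * \<psi> z) x t"
    using t c by (intro ball_mean_cauchy_schwarz continuous_intros)
  also have "mass (\<lambda>z. V z * \<psi> z) x t \<le> (\<integral>z. (Q\<^sup>2 * Q\<^sup>2) * (indicator (cball x t) z *\<^sub>R (cmod (\<psi> z))\<^sup>2) \<partial>lborel)"
    unfolding mass_def
  proof (rule integral_mono)
    show "integrable lborel (\<lambda>z. indicator (cball x t) z *\<^sub>R (cmod (V z * \<psi> z))\<^sup>2)"
      by (intro borel_integrable_compact continuous_intros c compact_cball)
    show "integrable lborel (\<lambda>z. (Q\<^sup>2 * Q\<^sup>2) * (indicator (cball x t) z *\<^sub>R (cmod (\<psi> z))\<^sup>2))"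
      by (intro integrable_mult_right borel_integrable_compact continuous_intros c compact_cball)
    fix z
    show "indicator (cball x t) z *\<^sub>R (cmod (V z * \<psi> z))\<^sup>2 \<le> (Q\<^sup>2 * Q\<^sup>2) * (indicator (cball x t) z *\<^sub>R (cmod (\<psi> z))\<^sup>2)"
    proof (cases "z \<in> cball x t")
      case True
      then have "(cmod (V z))\<^sup>2 \<le> (Q\<^sup>2)\<^sup>2" using V_le s by (intro power_mono) auto
      then have "(cmod (V z))\<^sup>2 * (cmod (\<psi> z))\<^sup>2 \<le> (Q\<^sup>2)\<^sup>2 * (cmod (\<psi> z))\<^sup>2" by (intro mult_right_mono) auto
      then show ?thesis using True by (simp add: norm_mult power_mult_distrib power2_eq_square[of "Q\<^sup>2"])
    qed simp
  qed
  also have "\<dots> = Q\<^sup>2 * Q\<^sup>2 * mass \<psi> x t" by (simp add: mass_def)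
  also have "\<dots> \<le> Q\<^sup>2 * Q\<^sup>2 * m" using mass_le[OF t] by (intro mult_left_mono) auto
  finally show ?thesis using om_pos by simp
qed

end

section \<open>Decay of the mean at the wavelength scale\<close>

text \<open>The constant of \<open>w_decay\<close> with \<open>\<rho> = 4 c + 1\<close> and \<open>B = d + 2\<^sup>d\<close>.\<close>

definition decay_const :: "real \<Rightarrow> real \<Rightarrow> real \<Rightarrow> real \<Rightarrow> real" where
  "decay_const d c Q b = exp b * (2 * exp (2 * (c / b\<^sup>2) * (4 * c + 1)) *
     (3 * (2 * c * Q / sqrt b + Q\<^sup>2) + 6 + 6 * (d + 2 powr d)) + Q * sqrt b)"

context eigenball
begin

lemma radial_deriv_le:
  assumes \<epsilon>: "\<epsilon> > 0" and t: "0 < t" "t \<le> r"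
  shows "\<exists>D. (energy \<epsilon> \<psi> x has_real_derivative D) (at t) \<and>
    cmod ((real CARD('d) * t ^ (CARD('d) - 1)) *\<^sub>R M t + t ^ CARD('d) *\<^sub>R (t *\<^sub>R N t)) \<le> D"
proof -
  let ?e = "energy_density \<epsilon> \<psi>"
  have tT: "\<bar>t\<bar> < 2 * r" using t r by simp
  have "Ck_on 1 U \<psi>"
    using \<psi> Ck_on_SucD[of 2 U \<psi>] Ck_on_SucD[of 1 U \<psi>] by (simp only: numeral_3_eq_3 numeral_2_eq_2 One_nat_def)
  then have "Ck_on 1 U ?e" by (rule Ck_on_1_energy_density[OF U(1)])
  from ball_integral_dilated_deriv[OF this U(2) tT, of "\<lambda>_. 1"]
  obtain E where "(ball_mean ?e x has_vector_derivative E) (at t)"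
    unfolding ball_mean_def[abs_def] by auto
  then have "((\<lambda>t. Re (ball_mean ?e x t)) has_vector_derivative Re E) (at t)"
    by (rule bounded_linear.has_vector_derivative[OF bounded_linear_Re])
  then have "((\<lambda>t. Re (ball_mean ?e x t)) has_real_derivative Re E) (at t)"
    by (simp add: has_real_derivative_iff_has_vector_derivative)
  from DERIV_mult[OF DERIV_pow[of "CARD('d)" t] this]
  obtain D where D: "(energy \<epsilon> \<psi> x has_real_derivative D) (at t)"
    unfolding energy_def[abs_def] by blast
  have pow: "((\<lambda>t::real. t ^ CARD('d)) has_real_derivative real CARD('d) * t ^ (CARD('d) - 1)) (at t)"
    using DERIV_pow[of "CARD('d)" t] by simp
  have "((\<lambda>t. t ^ CARD('d) *\<^sub>R M t) has_vector_derivative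
      t ^ CARD('d) *\<^sub>R (t *\<^sub>R N t) + (real CARD('d) * t ^ (CARD('d) - 1)) *\<^sub>R M t) (at t)"
    using pow t by (intro bounded_bilinear.has_vector_derivative[OF bounded_bilinear_scaleR] M_deriv)
      (auto simp: has_real_derivative_iff_has_vector_derivative)
  then have "cmod (t ^ CARD('d) *\<^sub>R (t *\<^sub>R N t) + (real CARD('d) * t ^ (CARD('d) - 1)) *\<^sub>R M t) \<le> D"
  proof (rule norm_vector_derivative_le[OF _ D r(1)])
    fix s assume s: "t < s" "s < t + r"
    have "cball x s \<subseteq> cball x (2 * r)" using s t by (intro subset_cball) auto
    then have "continuous_on (cball x s) \<psi>" using \<psi>_cont U(2) continuous_on_subset by blast
    then show "cmod (s ^ CARD('d) *\<^sub>R M s - t ^ CARD('d) *\<^sub>R M t) \<le> energy \<epsilon> \<psi> x s - energy \<epsilon> \<psi> x t"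
      using s t by (intro shell_le_energy_diff \<epsilon>) auto
  qed
  with D show ?thesis by (auto simp: add.commute)
qed

text \<open>The equation for the ball mean, multiplied by \<open>t powr ((d + 1) / 2)\<close> to remove the first-order term and
  scaled by \<open>k\<close>, is a radial wave to which \<open>w_decay\<close> applies. The amplitude is
  \<open>A\<^sup>2 = unit_vol m k\<^sup>d\<close>, and \<open>A\<^sup>2 / R = unit_vol m k\<^sup>d / (r k)\<close> is where the exponent \<open>d - 1\<close> comes from.\<close>

lemma mean_decay:
  fixes b q c R :: real
  defines "q \<equiv> (real CARD('d) + 1) / 2"
  defines "c \<equiv> q * (q - 1)"
  defines "R \<equiv> r * k"
  assumes b: "0 < b" "b \<le> 1" and R: "2 * (4 * c + 1) \<le> R"
  shows "b ^ (CARD('d) + 1) * (cmod (M (b / k)))\<^sup>2 \<le>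
    (decay_const (real CARD('d)) c Q b)\<^sup>2 * (unit_vol TYPE('d) * m * k ^ (CARD('d) - 1) / r)"
proof -
  let ?d = "CARD('d)"
  define om where "om = unit_vol TYPE('d)"
  have om: "om > 0" unfolding om_def by (rule om_pos)
  have d1: "?d \<ge> 1" by (simp add: Suc_leI)
  have q: "q \<ge> 1" unfolding q_def using d1 by simp
  have c0: "c \<ge> 0" unfolding c_def using q by simp
  have kpos: "k > 0" using k by simp
  have Rpos: "R > 0" using R c0 by simp
  have bR: "b \<le> R" using b R c0 by simp
  have Rk: "R \<le> k" unfolding R_def using mult_right_mono[OF r(2), of k] kpos by simp
  have tk: "0 < t / k \<and> t / k \<le> r" if "0 < t" "t \<le> R" for t
    using that kpos by (simp add: R_def pos_divide_le_eq)
  have m0: "m \<ge> 0" by (rule mass_nonneg)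
  show ?thesis
  proof (cases "m = 0")
    case True
    have "(b / k) ^ ?d * (cmod (M (b / k)))\<^sup>2 \<le> 0"
      using M_mass[of "b / k"] tk[of b] b bR True by simp
    moreover have "(b / k) ^ ?d > 0" using b kpos by simp
    ultimately have "(cmod (M (b / k)))\<^sup>2 \<le> 0"
      by (simp add: mult_le_0_iff)
    then show ?thesis using True by simp
  next
    case False
    then have mpos: "m > 0" using m0 by simp
    \<comment> \<open>Of the two square roots of \<open>lam\<close> the one whose exponential \<open>exp (\<i> \<kappa> t)\<close> does not grow.\<close>
    obtain \<kappa>0 where \<kappa>0: "\<kappa>0\<^sup>2 = lam" "Im \<kappa>0 \<ge> 0"
    proof (cases "Im (csqrt lam) \<ge> 0")
      case True then show ?thesis using that[of "csqrt lam"] by simp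
    next
      case False then show ?thesis using that[of "- csqrt lam"] by simp
    qed
    have "(cmod \<kappa>0)\<^sup>2 = k\<^sup>2" using \<kappa>0(1) lam by (simp flip: norm_power)
    then have nk: "cmod \<kappa>0 = k" using kpos by (simp add: power2_eq_iff_nonneg)
    define \<kappa> where "\<kappa> = \<kappa>0 / of_real k"
    have \<kappa>: "cmod \<kappa> = 1" "Im \<kappa> \<ge> 0" using nk \<kappa>0(2) kpos by (auto simp: \<kappa>_def norm_divide)
    have lam\<kappa>: "lam = \<kappa>\<^sup>2 * of_real (k\<^sup>2)" using \<kappa>0(1) kpos by (simp add: \<kappa>_def power_divide)
    define s where "s = (\<lambda>t::real. sqrt t ^ (?d + 1))"
    have spos: "s t > 0" if "t > 0" for t using that by (simp add: s_def)
    have s2: "(s t)\<^sup>2 = t ^ (?d + 1)" if "t > 0" for t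
      unfolding s_def using that by (metis less_imp_le power_mult mult.commute real_sqrt_pow2)
    have sderiv: "(s has_real_derivative q * s t / t) (at t)" if t: "t > 0" for t
    proof -
      have "(s has_real_derivative real (?d + 1) * (inverse (sqrt t) / 2 * sqrt t ^ (?d + 1 - 1))) (at t)"
        unfolding s_def using DERIV_power[OF DERIV_real_sqrt[OF t], of "?d + 1"] by (simp add: mult.assoc)
      moreover have "real (?d + 1) * (inverse (sqrt t) / 2 * sqrt t ^ (?d + 1 - 1)) = q * s t / t"
      proof -
        have "inverse z / 2 * z ^ n = z ^ (n + 1) / (2 * (z * z))" if "z > 0" for z :: real and n :: nat
          using that by (simp add: field_simps)
        from this[of "sqrt t" ?d] show ?thesis using t by (simp add: q_def s_def mult.commute add.commute)
      qed
      ultimately show ?thesis by simp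
    qed
    have smono: "s t \<le> s t'" if "0 < t" "t \<le> t'" for t t'
      unfolding s_def using that by (intro power_mono) auto
    define w where "w = (\<lambda>t. s t *\<^sub>R M (t / k))"
    define w1 where "w1 = (\<lambda>t. (s t * t / k\<^sup>2) *\<^sub>R N (t / k) + (q * s t / t) *\<^sub>R M (t / k))"
    define F where "F = (\<lambda>t. (s t / k\<^sup>2) *\<^sub>R MV (t / k))"
    define A where "A = sqrt om * sqrt m * sqrt k ^ ?d"
    have A2: "A\<^sup>2 = om * m * k ^ ?d"
    proof -
      have "(sqrt k ^ ?d)\<^sup>2 = k ^ ?d" using kpos by (metis less_imp_le power_mult mult.commute real_sqrt_pow2)
      then show ?thesis unfolding A_def using om m0 by (simp add: power_mult_distrib)
    qed
    have A0: "A \<ge> 0" unfolding A_def using om m0 kpos by simp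
    have dk: "((\<lambda>t. t / k) has_vector_derivative 1 / k) (at t)" for t
      using DERIV_cdivide[OF DERIV_ident, of k t UNIV] by (simp add: has_real_derivative_iff_has_vector_derivative)
    have dM: "((\<lambda>t. M (t / k)) has_vector_derivative (t / k\<^sup>2) *\<^sub>R N (t / k)) (at t)" if t: "0 < t" "t \<le> R" for t
    proof -
      have "\<bar>t / k\<bar> \<le> r" using tk[OF t] by linarith
      from vector_diff_chain_at[OF dk M_deriv[OF this]] show ?thesis
        by (simp add: o_def power2_eq_square)
    qed
    have dN: "((\<lambda>t. N (t / k)) has_vector_derivative
        (MV (t / k) - lam * M (t / k) - (real ?d + 2) *\<^sub>R N (t / k)) /\<^sub>R t) (at t)" if t: "0 < t" "t \<le> R" for t
    proof -
      have "0 < t / k" "t / k \<le> r" using tk[OF t] by auto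
      from vector_diff_chain_at[OF dk N_deriv[OF this]] show ?thesis
        using kpos by (simp add: o_def inverse_eq_divide)
    qed
    have sv: "(s has_vector_derivative q * s t / t) (at t)" if "t > 0" for t
      using sderiv[OF that] by (simp add: has_real_derivative_iff_has_vector_derivative)
    have w: "(w has_vector_derivative w1 t) (at t)" if t: "0 < t" "t \<le> R" for t
      using bounded_bilinear.has_vector_derivative[OF bounded_bilinear_scaleR sv[OF t(1)] dM[OF t]]
      unfolding w_def w1_def by simp
    have w1: "(w1 has_vector_derivative (c / t\<^sup>2) *\<^sub>R w t - \<kappa>\<^sup>2 * w t + F t) (at t)" if t: "0 < t" "t \<le> R" for t
    proof -
      have a: "((\<lambda>t. s t * t / k\<^sup>2) has_vector_derivative (q + 1) * s t / k\<^sup>2) (at t)"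
      proof -
        have "((\<lambda>t. s t * t / k\<^sup>2) has_real_derivative (q * s t / t * t + 1 * s t) / k\<^sup>2) (at t)"
          by (rule DERIV_cdivide[OF DERIV_mult[OF sderiv[OF t(1)] DERIV_ident]])
        then show ?thesis using t by (simp add: has_real_derivative_iff_has_vector_derivative algebra_simps)
      qed
      have b: "((\<lambda>t. q * s t / t) has_vector_derivative c * s t / t\<^sup>2) (at t)"
      proof -
        have "((\<lambda>t. q * s t / t) has_real_derivative ((q * (q * s t / t)) * t - (q * s t) * 1) / (t * t)) (at t)"
          using t by (intro DERIV_divide DERIV_cmult sderiv DERIV_ident) auto
        moreover have "((q * (q * s t / t)) * t - (q * s t) * 1) / (t * t) = c * s t / t\<^sup>2"
          using t by (simp add: c_def power2_eq_square algebra_simps)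
        ultimately show ?thesis by (simp add: has_real_derivative_iff_has_vector_derivative)
      qed
      have "(w1 has_vector_derivative
         ((s t * t / k\<^sup>2) *\<^sub>R ((MV (t / k) - lam * M (t / k) - (real ?d + 2) *\<^sub>R N (t / k)) /\<^sub>R t) + ((q + 1) * s t / k\<^sup>2) *\<^sub>R N (t / k)) +
         ((q * s t / t) *\<^sub>R ((t / k\<^sup>2) *\<^sub>R N (t / k)) + (c * s t / t\<^sup>2) *\<^sub>R M (t / k))) (at t)"
        unfolding w1_def
        by (intro has_vector_derivative_add bounded_bilinear.has_vector_derivative[OF bounded_bilinear_scaleR] a b dM dN t)
      moreover have "((s t * t / k\<^sup>2) *\<^sub>R ((MV (t / k) - lam * M (t / k) - (real ?d + 2) *\<^sub>R N (t / k)) /\<^sub>R t) + ((q + 1) * s t / k\<^sup>2) *\<^sub>R N (t / k)) +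
         ((q * s t / t) *\<^sub>R ((t / k\<^sup>2) *\<^sub>R N (t / k)) + (c * s t / t\<^sup>2) *\<^sub>R M (t / k)) =
         (c / t\<^sup>2) *\<^sub>R w t - \<kappa>\<^sup>2 * w t + F t"
      proof -
        have e1: "(s t * t / k\<^sup>2) *\<^sub>R (z /\<^sub>R t) = (s t / k\<^sup>2) *\<^sub>R z" for z :: complex using t by simp
        have e2: "(q * s t / t) *\<^sub>R ((t / k\<^sup>2) *\<^sub>R z) = (q * s t / k\<^sup>2) *\<^sub>R z" for z :: complex using t by simp
        have e3: "(s t / k\<^sup>2) *\<^sub>R (lam * z) = \<kappa>\<^sup>2 * (s t *\<^sub>R z)" for z
          unfolding lam\<kappa> using kpos by (simp add: scaleR_conv_of_real)
        have e4: "(s t / k\<^sup>2) *\<^sub>R ((real ?d + 2) *\<^sub>R z) = ((q + 1) * s t / k\<^sup>2) *\<^sub>R z + (q * s t / k\<^sup>2) *\<^sub>R z" for z :: complex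
        proof -
          have "real ?d + 2 = (q + 1) + q" by (simp add: q_def)
          then have r: "(s t / k\<^sup>2) * (real ?d + 2) = (q + 1) * s t / k\<^sup>2 + q * s t / k\<^sup>2"
            by (simp only:) (simp add: algebra_simps add_divide_distrib)
          show ?thesis unfolding scaleR_scaleR r by (rule scaleR_add_left)
        qed
        show ?thesis
          unfolding e1 e2 scaleR_diff_right e3 e4 by (simp add: w_def F_def)
      qed
      ultimately show ?thesis by simp
    qed
    have w_le: "cmod (w t) \<le> A * sqrt t" if t: "0 < t" "t \<le> R" for t
    proof (rule power2_le_imp_le)
      have "(cmod (w t))\<^sup>2 = t ^ (?d + 1) * (cmod (M (t / k)))\<^sup>2"
        using spos[OF t(1)] s2[OF t(1)] by (simp add: w_def power_mult_distrib)
      also have "\<dots> = t * k ^ ?d * ((t / k) ^ ?d * (cmod (M (t / k)))\<^sup>2)"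
        using kpos by (simp add: power_divide)
      also have "\<dots> \<le> t * k ^ ?d * (om * m)"
        unfolding om_def using tk[OF t] t kpos by (intro mult_left_mono M_mass) auto
      also have "\<dots> = (A * sqrt t)\<^sup>2" using t by (simp add: power_mult_distrib A2)
      finally show "(cmod (w t))\<^sup>2 \<le> (A * sqrt t)\<^sup>2" .
    qed (use A0 t in simp)
    have F_le: "cmod (F t) \<le> Q\<^sup>2 * A / R\<^sup>2 * sqrt t" if t: "0 < t" "t \<le> R" for t
    proof -
      have "cmod (F t) \<le> Q\<^sup>2 * A / k\<^sup>2 * sqrt t"
      proof (rule power2_le_imp_le)
        have "(cmod (F t))\<^sup>2 = t ^ (?d + 1) / (k\<^sup>2)\<^sup>2 * (cmod (MV (t / k)))\<^sup>2"
          using spos[OF t(1)] s2[OF t(1)] by (simp add: F_def power_mult_distrib power_divide)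
        also have "\<dots> = t * k ^ ?d / (k\<^sup>2)\<^sup>2 * ((t / k) ^ ?d * (cmod (MV (t / k)))\<^sup>2)"
          using kpos by (simp add: power_divide)
        also have "\<dots> \<le> t * k ^ ?d / (k\<^sup>2)\<^sup>2 * (om * (Q\<^sup>2 * Q\<^sup>2 * m))"
          unfolding om_def using tk[OF t] t kpos by (intro mult_left_mono MV_mass) auto
        also have "\<dots> = (Q\<^sup>2 * A / k\<^sup>2 * sqrt t)\<^sup>2"
          using t by (simp add: power_mult_distrib power_divide A2 power2_eq_square[of "Q\<^sup>2"])
        finally show "(cmod (F t))\<^sup>2 \<le> (Q\<^sup>2 * A / k\<^sup>2 * sqrt t)\<^sup>2" .
      qed (use A0 t in simp)
      also have "\<dots> \<le> Q\<^sup>2 * A / R\<^sup>2 * sqrt t"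
        using A0 t Rk Rpos kpos by (intro mult_right_mono divide_left_mono power_mono) auto
      finally show ?thesis .
    qed
    define K where "K = ((om * ((Q\<^sup>2 + k\<^sup>2) * S / 2)) + q * (om * S)) * (om * S)"
    have near0: "cmod (w1 t * cnj (w t)) \<le> K * t" "(cmod (w t))\<^sup>2 / t \<le> (om * S)\<^sup>2 * t" if t: "0 < t" "t < min 1 R" for t
    proof -
      have t': "0 < t" "t \<le> R" "t \<le> 1" using t by auto
      have Ml: "cmod (M (t / k)) \<le> om * S" and Nl: "cmod (N (t / k)) \<le> om * ((Q\<^sup>2 + k\<^sup>2) * S / 2)"
        using M_le[of "t / k"] N_le[of "t / k"] tk[OF t'(1,2)] by (auto simp: om_def)
      have td: "t ^ ?d \<le> t" using power_decreasing[OF d1, of t] t' by simp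
      have td2: "t ^ (?d + 2) \<le> t" using power_decreasing[of 1 "?d + 2" t] t' by simp
      have "cmod (w1 t) \<le> s t * t / k\<^sup>2 * cmod (N (t / k)) + q * s t / t * cmod (M (t / k))"
        unfolding w1_def using norm_triangle_ineq[of "(s t * t / k\<^sup>2) *\<^sub>R N (t / k)" "(q * s t / t) *\<^sub>R M (t / k)"]
          spos[OF t'(1)] t' q kpos by simp
      also have "\<dots> \<le> s t * t / 1 * (om * ((Q\<^sup>2 + k\<^sup>2) * S / 2)) + q * s t / t * (om * S)"
        using spos[OF t'(1)] t' q kpos k om S_nonneg Ml Nl
        by (intro add_mono mult_mono divide_left_mono) auto
      finally have "cmod (w1 t) * cmod (w t) \<le>
        (s t * t / 1 * (om * ((Q\<^sup>2 + k\<^sup>2) * S / 2)) + q * s t / t * (om * S)) * (s t * (om * S))"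
        unfolding w_def using spos[OF t'(1)] om S_nonneg t' q Ml by (intro mult_mono) auto
      also have "\<dots> = (((s t)\<^sup>2 * t) * (om * ((Q\<^sup>2 + k\<^sup>2) * S / 2)) + ((s t)\<^sup>2 / t) * (q * (om * S))) * (om * S)"
        by (simp add: power2_eq_square algebra_simps)
      also have "(s t)\<^sup>2 * t = t ^ (?d + 2)" using s2[OF t'(1)] by simp
      also have "(s t)\<^sup>2 / t = t ^ ?d" using s2[OF t'(1)] t' by simp
      also have "(t ^ (?d + 2) * (om * ((Q\<^sup>2 + k\<^sup>2) * S / 2)) + t ^ ?d * (q * (om * S))) * (om * S) \<le>
          (t * (om * ((Q\<^sup>2 + k\<^sup>2) * S / 2)) + t * (q * (om * S))) * (om * S)"
        using td td2 om S_nonneg q by (intro mult_right_mono add_mono) auto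
      also have "\<dots> = K * t" by (simp add: K_def algebra_simps)
      finally show "cmod (w1 t * cnj (w t)) \<le> K * t" by (simp add: norm_mult)
      have "(cmod (w t))\<^sup>2 / t = ((s t)\<^sup>2 / t) * (cmod (M (t / k)))\<^sup>2"
        using spos[OF t'(1)] by (simp add: w_def power_mult_distrib)
      also have "(s t)\<^sup>2 / t = t ^ ?d" using s2[OF t'(1)] t' by simp
      also have "t ^ ?d * (cmod (M (t / k)))\<^sup>2 \<le> t * (om * S)\<^sup>2"
        using td Ml t' by (intro mult_mono power_mono) auto
      finally show "(cmod (w t))\<^sup>2 / t \<le> (om * S)\<^sup>2 * t" by (simp add: mult.commute)
    qed
    have ev: "\<forall>\<^sub>F t in at_right 0. 0 < t \<and> t < min 1 R"
      using eventually_at_right_real[of 0 "min 1 R"] Rpos by (auto elim: eventually_mono)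
    have lim1: "((\<lambda>t. w1 t * cnj (w t)) \<longlongrightarrow> 0) (at_right 0)"
    proof (rule Lim_null_comparison)
      show "\<forall>\<^sub>F t in at_right 0. norm (w1 t * cnj (w t)) \<le> K * t"
        using ev by eventually_elim (use near0(1) in auto)
      show "((\<lambda>t. K * t) \<longlongrightarrow> 0) (at_right 0)" by (auto intro!: tendsto_eq_intros)
    qed
    have lim2: "((\<lambda>t. (cmod (w t))\<^sup>2 / t) \<longlongrightarrow> 0) (at_right 0)"
    proof (rule Lim_null_comparison)
      show "\<forall>\<^sub>F t in at_right 0. norm ((cmod (w t))\<^sup>2 / t) \<le> (om * S)\<^sup>2 * t"
        using ev by eventually_elim (use near0(2) in auto)
      show "((\<lambda>t. (om * S)\<^sup>2 * t) \<longlongrightarrow> 0) (at_right 0)" by (auto intro!: tendsto_eq_intros)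
    qed
    interpret ode: radial_wave w w1 F \<kappa> q R A Q c
      by unfold_locales (use \<kappa> q c_def A0 Q w w1 w_le F_le lim1 lim2 in auto)
    define u v p where "u = sqrt m" and "v = sqrt om" and "p = sqrt r ^ ?d"
    have uvp: "u > 0" "v > 0" "p > 0" "u\<^sup>2 = m" "v\<^sup>2 = om" "p\<^sup>2 = r ^ ?d"
    proof -
      show "p\<^sup>2 = r ^ ?d" unfolding p_def using r by (metis less_imp_le power_mult mult.commute real_sqrt_pow2)
    qed (use mpos om r in \<open>auto simp: u_def v_def p_def\<close>)
    \<comment> \<open>The choice that minimises the energy of the whole ball, with value \<open>u v p\<close>.\<close>
    define \<epsilon> where "\<epsilon> = u / (v * p)"
    have \<epsilon>: "\<epsilon> > 0" using uvp by (simp add: \<epsilon>_def)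
    have "\<forall>t. \<exists>D. 0 < t \<longrightarrow> t \<le> r \<longrightarrow> (energy \<epsilon> \<psi> x has_real_derivative D) (at t) \<and>
      cmod ((real ?d * t ^ (?d - 1)) *\<^sub>R M t + t ^ ?d *\<^sub>R (t *\<^sub>R N t)) \<le> D"
      using radial_deriv_le[OF \<epsilon>] by blast
    then obtain G where G: "\<And>t. 0 < t \<Longrightarrow> t \<le> r \<Longrightarrow> (energy \<epsilon> \<psi> x has_real_derivative G t) (at t)"
      "\<And>t. 0 < t \<Longrightarrow> t \<le> r \<Longrightarrow> cmod ((real ?d * t ^ (?d - 1)) *\<^sub>R M t + t ^ ?d *\<^sub>R (t *\<^sub>R N t)) \<le> G t"
      by metis
    define D0 where "D0 = real ?d - q"
    have D0: "D0 \<ge> 0" "2 * D0 \<le> real ?d" using d1 by (auto simp: D0_def q_def field_simps)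
    \<comment> \<open>A bound of \<open>s t / (t / k)\<^sup>d\<close> for \<open>R / 2 \<le> t \<le> R\<close>.\<close>
    define \<kappa>1 where "\<kappa>1 = 2 ^ ?d * s R / r ^ ?d"
    have \<kappa>1: "\<kappa>1 \<ge> 0" using spos[OF Rpos] r by (simp add: \<kappa>1_def)
    define g where "g = (\<lambda>t. 2 * D0 * A * sqrt t + \<kappa>1 * energy \<epsilon> \<psi> x (t / k))"
    define g' where "g' = (\<lambda>t. D0 * A / sqrt t + \<kappa>1 * (G (t / k) * (1 / k)))"
    have g: "(g has_real_derivative g' t) (at t)" if t: "R / 2 \<le> t" "t \<le> R" for t
    proof -
      have t': "0 < t" "t \<le> R" using t Rpos by auto
      have "((\<lambda>t. t / k) has_real_derivative 1 / k) (at t)" by (rule DERIV_cdivide[OF DERIV_ident])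
      from DERIV_chain2[OF G(1) this] tk[OF t']
      have dG: "((\<lambda>t. energy \<epsilon> \<psi> x (t / k)) has_real_derivative G (t / k) * (1 / k)) (at t)" by simp
      have "(g has_real_derivative 2 * D0 * A * (inverse (sqrt t) / 2) + \<kappa>1 * (G (t / k) * (1 / k))) (at t)"
        unfolding g_def using t' by (intro DERIV_add DERIV_cmult DERIV_real_sqrt dG)
      then show ?thesis by (simp add: g'_def inverse_eq_divide)
    qed
    have w1_le: "cmod (w1 t) \<le> g' t" if t: "R / 2 \<le> t" "t \<le> R" for t
    proof -
      have t': "0 < t" "t \<le> R" using t Rpos by auto
      define \<tau> where "\<tau> = t / k"
      have \<tau>: "0 < \<tau>" "\<tau> \<le> r" using tk[OF t'] by (auto simp: \<tau>_def)
      have tr: "r / 2 \<le> \<tau>" using t kpos by (simp add: \<tau>_def R_def field_simps)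
      have t\<tau>: "t = k * \<tau>" using kpos by (simp add: \<tau>_def)
      define H where "H = (real ?d * \<tau> ^ (?d - 1)) *\<^sub>R M \<tau> + \<tau> ^ ?d *\<^sub>R (\<tau> *\<^sub>R N \<tau>)"
      have w1eq: "w1 t = (s t / (k * \<tau> ^ ?d)) *\<^sub>R H - (D0 / t) *\<^sub>R w t"
      proof -
        have pw: "\<tau> ^ ?d = \<tau> * \<tau> ^ (?d - 1)" using d1 by (simp flip: power_Suc)
        have "(s t / (k * \<tau> ^ ?d)) *\<^sub>R H = (real ?d * s t / t) *\<^sub>R M \<tau> + (s t * t / k\<^sup>2) *\<^sub>R N \<tau>"
        proof -
          have "s t / (k * \<tau> ^ ?d) * (real ?d * \<tau> ^ (?d - 1)) = real ?d * s t / t"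
            unfolding pw t\<tau> using \<tau> kpos by simp
          moreover have "s t / (k * \<tau> ^ ?d) * (\<tau> ^ ?d * \<tau>) = s t * t / k\<^sup>2"
            unfolding t\<tau> using \<tau> kpos by (simp add: power2_eq_square)
          ultimately show ?thesis unfolding H_def by (simp only: scaleR_add_right scaleR_scaleR mult.assoc)
        qed
        moreover have "(D0 / t) *\<^sub>R w t = (real ?d * s t / t) *\<^sub>R M \<tau> - (q * s t / t) *\<^sub>R M \<tau>"
          by (simp add: w_def D0_def \<tau>_def diff_divide_distrib algebra_simps flip: scaleR_diff_left)
        ultimately show ?thesis by (simp add: w1_def \<tau>_def)
      qed
      have "cmod (w1 t) \<le> s t / (k * \<tau> ^ ?d) * cmod H + D0 / t * cmod (w t)"
        unfolding w1eq using norm_triangle_ineq4[of "(s t / (k * \<tau> ^ ?d)) *\<^sub>R H" "(D0 / t) *\<^sub>R w t"]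
          spos[OF t'(1)] kpos \<tau> D0 t' by simp
      also have "\<dots> \<le> s R / (k * (r / 2) ^ ?d) * G \<tau> + D0 / t * (A * sqrt t)"
      proof (intro add_mono mult_mono)
        show "s t / (k * \<tau> ^ ?d) \<le> s R / (k * (r / 2) ^ ?d)"
          using smono[OF t'] spos[OF Rpos] kpos r \<tau> tr
          by (intro frac_le mult_left_mono power_mono) auto
        show "cmod H \<le> G \<tau>" unfolding H_def by (rule G(2)[OF \<tau>])
        show "cmod (w t) \<le> A * sqrt t" by (rule w_le[OF t'])
      qed (use spos[OF Rpos] kpos r D0 t' in auto)
      also have "s R / (k * (r / 2) ^ ?d) * G \<tau> = \<kappa>1 * (G (t / k) * (1 / k))"
        by (simp add: \<kappa>1_def \<tau>_def power_divide mult_ac)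
      also have "D0 / t * (A * sqrt t) = D0 * A / sqrt t"
      proof -
        have "D0 / (z * z) * (A * z) = D0 * A / z" if "z > 0" for z :: real using that by simp
        from this[of "sqrt t"] show ?thesis using t' by simp
      qed
      finally show ?thesis by (simp add: g'_def)
    qed
    have g_le: "g R - g (R / 2) \<le> (real ?d + 2 powr real ?d) * A * sqrt R"
    proof -
      have cr: "continuous_on (cball x r) \<psi>" using \<psi>_cont sub continuous_on_subset by blast
      have cr2: "continuous_on (cball x (r / 2)) \<psi>" by (rule continuous_on_subset[OF cr]) (use r in auto)
      have Rk': "R / k = r" "R / 2 / k = r / 2" using kpos by (auto simp: R_def)
      have e0: "energy \<epsilon> \<psi> x (r / 2) \<ge> 0"
        using r \<epsilon> om_pos mass_nonneg[of \<psi> x "r / 2"] by (subst energy_eq_mass[OF cr2]) auto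
      have "energy \<epsilon> \<psi> x r = \<epsilon> / 2 * (v\<^sup>2 * p\<^sup>2) + u\<^sup>2 / (2 * \<epsilon>)"
        using energy_eq_mass[OF cr r(1), of \<epsilon>] uvp by (simp add: om_def)
      also have "\<dots> = u * v * p"
        using uvp(1-3) by (simp add: \<epsilon>_def power2_eq_square)
      finally have er: "energy \<epsilon> \<psi> x r = u * v * p" .
      have sR: "s R = sqrt R * (p * sqrt k ^ ?d)"
      proof -
        have "sqrt R ^ ?d = p * sqrt k ^ ?d"
          by (simp add: R_def p_def real_sqrt_mult power_mult_distrib)
        then show ?thesis by (simp add: s_def)
      qed
      have "\<kappa>1 * (u * v * p) = 2 ^ ?d * (p\<^sup>2 / r ^ ?d) * (v * u * sqrt k ^ ?d) * sqrt R"
        unfolding \<kappa>1_def sR by (simp add: power2_eq_square)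
      also have "\<dots> = 2 ^ ?d * A * sqrt R"
        using uvp r by (simp add: A_def u_def v_def)
      finally have k1: "\<kappa>1 * (u * v * p) = 2 ^ ?d * A * sqrt R" .
      have "g R - g (R / 2) \<le> 2 * D0 * A * sqrt R + \<kappa>1 * energy \<epsilon> \<psi> x r"
      proof -
        have "2 * D0 * A * sqrt (R / 2) \<ge> 0" using D0 A0 Rpos by simp
        moreover have "\<kappa>1 * energy \<epsilon> \<psi> x (r / 2) \<ge> 0" using \<kappa>1 e0 by simp
        ultimately show ?thesis unfolding g_def Rk' by linarith
      qed
      also have "\<dots> \<le> real ?d * A * sqrt R + 2 ^ ?d * A * sqrt R"
        unfolding er k1 using D0 A0 Rpos by (intro add_mono mult_right_mono) auto
      also have "\<dots> = (real ?d + 2 powr real ?d) * A * sqrt R"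
        by (simp add: powr_realpow distrib_right)
      finally show ?thesis .
    qed
    have "cmod (w b) \<le> exp b * (2 * exp (2 * (c / b\<^sup>2) * (4 * c + 1)) *
       (3 * (2 * c * Q / sqrt b + Q\<^sup>2) + 6 + 6 * (real ?d + 2 powr real ?d)) + Q * sqrt b) * (A / sqrt R)"
      by (rule ode.w_decay[where g = g and g' = g']) (use b c0 R g w1_le g_le in auto)
    then have wb: "cmod (w b) \<le> decay_const (real ?d) c Q b * (A / sqrt R)"
      by (simp add: decay_const_def)
    have "b ^ (?d + 1) * (cmod (M (b / k)))\<^sup>2 = (cmod (w b))\<^sup>2"
      using spos[OF b(1)] s2[OF b(1)] by (simp add: w_def power_mult_distrib)
    also have "\<dots> \<le> (decay_const (real ?d) c Q b * (A / sqrt R))\<^sup>2"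
      by (rule power_mono[OF wb]) simp
    also have "\<dots> = (decay_const (real ?d) c Q b)\<^sup>2 * (A\<^sup>2 / R)"
      using Rpos by (simp add: power_mult_distrib power_divide)
    also have "A\<^sup>2 / R = om * m * k ^ (?d - 1) / r"
    proof -
      have "k ^ ?d = k * k ^ (?d - 1)" using d1 by (simp flip: power_Suc)
      then show ?thesis using kpos by (simp add: A2 R_def)
    qed
    finally show ?thesis by (simp add: om_def)
  qed
qed

end

section \<open>Interior pointwise bounds\<close>

text \<open>The two summands belong to the two cases of \<open>local_bound\<close>: \<open>b / k\<close> and \<open>b' r\<close> are the radii at which the value at
  the centre is compared with the mean.\<close>

definition local_const :: "'d::finite itself \<Rightarrow> real \<Rightarrow> real" where
  "local_const _ Q = (let n = real CARD('d); c = (n + 1) / 2 * ((n + 1) / 2 - 1);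
      b = 1 / ((1 + Q) * 2 ^ CARD('d)); b' = 1 / ((Q + 2 * (4 * c + 1)) * 2 ^ CARD('d))
    in 2 / unit_vol TYPE('d) * ((decay_const n c Q b)\<^sup>2 / b ^ (CARD('d) + 1) + 1 / b' ^ CARD('d)))"

lemma local_const_pos:
  assumes "Q \<ge> 0"
  shows "local_const TYPE('d::finite) Q > 0"
proof -
  define n where "n = real CARD('d)"
  define c where "c = (n + 1) / 2 * ((n + 1) / 2 - 1)"
  define b where "b = 1 / ((1 + Q) * 2 ^ CARD('d))"
  define b' where "b' = 1 / ((Q + 2 * (4 * c + 1)) * 2 ^ CARD('d))"
  have "n \<ge> 1" unfolding n_def by (simp add: Suc_leI)
  then have c: "c \<ge> 0" by (simp add: c_def)
  have "b > 0" "b' > 0" using assms c by (auto simp: b_def b'_def)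
  then have "0 < 2 / unit_vol TYPE('d) * ((decay_const n c Q b)\<^sup>2 / b ^ (CARD('d) + 1) + 1 / b' ^ CARD('d))"
    using unit_vol_pos[where 'd = 'd] by (intro mult_pos_pos add_nonneg_pos) auto
  then show ?thesis
    unfolding local_const_def Let_def b_def b'_def c_def n_def .
qed

context eigenball
begin

text \<open>If \<open>r k\<close> is large, \<open>mean_decay\<close> is used at the radius \<open>b / k\<close>. If \<open>r k\<close> is bounded, the ball is
  shorter than a few wavelengths, and Cauchy-Schwarz at a radius comparable to \<open>r\<close> suffices. In both cases the
  radius is small enough for the coefficient of \<open>S\<^sup>2\<close> to be \<open>2 powr - (d + 1)\<close>, as \<open>interior_bound\<close> needs.\<close>

lemma local_bound:
  "(cmod (\<psi> x))\<^sup>2 \<le> local_const TYPE('d) Q * (k ^ (CARD('d) - 1) / r + 1 / r ^ CARD('d)) * m + S\<^sup>2 / 2 ^ (CARD('d) + 1)"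
proof -
  let ?d = "CARD('d)" and ?om = "unit_vol TYPE('d)"
  define n where "n = real ?d"
  define c where "c = (n + 1) / 2 * ((n + 1) / 2 - 1)"
  define b where "b = 1 / ((1 + Q) * 2 ^ ?d)"
  define b' where "b' = 1 / ((Q + 2 * (4 * c + 1)) * 2 ^ ?d)"
  have n: "n \<ge> 1" unfolding n_def by (simp add: Suc_leI)
  have c: "c \<ge> 0" using n by (simp add: c_def)
  have p2: "(2::real) ^ ?d \<ge> 1" by simp
  have kpos: "k > 0" using k by simp
  have inv_le_1: "1 / (y * 2 ^ ?d) \<le> 1" if "y \<ge> 1" for y :: real
    using mult_mono[OF that p2] that by simp
  have b: "b > 0" "b \<le> 1" unfolding b_def using Q inv_le_1[of "1 + Q"] by auto
  have b': "b' > 0" "b' \<le> 1" unfolding b'_def using Q c inv_le_1[of "Q + 2 * (4 * c + 1)"] by auto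
  have lc: "local_const TYPE('d) Q = 2 / ?om * ((decay_const n c Q b)\<^sup>2 / b ^ (?d + 1) + 1 / b' ^ ?d)"
    unfolding local_const_def Let_def b_def b'_def c_def n_def ..
  define \<theta> :: real where "\<theta> = 1 / 2 ^ (?d + 1)"
  have \<theta>: "2 * \<theta>\<^sup>2 * S\<^sup>2 \<le> S\<^sup>2 / 2 ^ (?d + 1)"
  proof -
    have "\<theta> \<le> 1 / 2" using p2 by (simp add: \<theta>_def field_simps)
    then have "2 * \<theta> * \<theta> \<le> 1 * \<theta>" by (intro mult_right_mono) (auto simp: \<theta>_def)
    then have "2 * \<theta>\<^sup>2 * S\<^sup>2 \<le> \<theta> * S\<^sup>2" by (intro mult_right_mono) (auto simp: power2_eq_square)
    then show ?thesis by (simp add: \<theta>_def)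
  qed
  have small: "a\<^sup>2 / 2 \<le> \<theta>" if "0 \<le> a" "a \<le> 1 / 2 ^ ?d" for a
  proof -
    have "1 / 2 ^ ?d \<le> (1::real)" by simp
    with that have "a \<le> 1" by linarith
    then have "a\<^sup>2 \<le> 1 * (1 / 2 ^ ?d)" unfolding power2_eq_square
      using that by (intro mult_mono) auto
    then show ?thesis by (simp add: \<theta>_def)
  qed
  define A B where "A = (decay_const n c Q b)\<^sup>2 / b ^ (?d + 1)" and "B = 1 / b' ^ ?d"
  have AB: "A \<ge> 0" "B \<ge> 0" using b b' by (auto simp: A_def B_def)
  define X Y where "X = k ^ (?d - 1) / r" and "Y = 1 / r ^ ?d"
  have XY: "X \<ge> 0" "Y \<ge> 0" using kpos r by (auto simp: X_def Y_def)
  have m0: "m \<ge> 0" by (rule mass_nonneg)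
  have om: "?om > 0" by (rule om_pos)
  have "\<exists>s. 0 < s \<and> s \<le> r \<and> (Q\<^sup>2 + k\<^sup>2) * s\<^sup>2 / 2 \<le> \<theta> \<and> (cmod (M s))\<^sup>2 \<le> ?om * m * (A * X + B * Y)"
  proof (cases "2 * (4 * c + 1) \<le> r * k")
    case True
    define s where "s = b / k"
    have "b \<le> r * k" using True b c by simp
    then have s: "0 < s" "s \<le> r" using b kpos by (auto simp: s_def pos_divide_le_eq)
    have "(Q\<^sup>2 + k\<^sup>2) * s\<^sup>2 \<le> ((1 + Q) * b)\<^sup>2"
    proof -
      have "Q\<^sup>2 \<le> Q\<^sup>2 * k\<^sup>2" using k by (simp add: mult_le_cancel_left1 one_le_power)
      moreover have "2 * Q * k\<^sup>2 \<ge> 0" using Q by simp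
      ultimately have "Q\<^sup>2 + k\<^sup>2 \<le> (1 + Q)\<^sup>2 * k\<^sup>2" by (simp add: power2_sum distrib_right)
      then have "(Q\<^sup>2 + k\<^sup>2) * s\<^sup>2 \<le> (1 + Q)\<^sup>2 * k\<^sup>2 * s\<^sup>2" by (rule mult_right_mono) simp
      also have "\<dots> = ((1 + Q) * b)\<^sup>2" using kpos by (simp add: s_def power_mult_distrib power_divide)
      finally show ?thesis .
    qed
    also have "(1 + Q) * b = 1 / 2 ^ ?d" using Q by (simp add: b_def)
    finally have 1: "(Q\<^sup>2 + k\<^sup>2) * s\<^sup>2 / 2 \<le> \<theta>" using small[of "1 / 2 ^ ?d"] by simp
    have "b ^ (?d + 1) * (cmod (M s))\<^sup>2 \<le> (decay_const n c Q b)\<^sup>2 * (?om * m * X)"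
      using mean_decay[OF b] True unfolding s_def c_def n_def X_def by simp
    then have "(cmod (M s))\<^sup>2 \<le> ?om * m * (A * X)"
      using b unfolding A_def by (simp add: field_simps)
    also have "\<dots> \<le> ?om * m * (A * X + B * Y)"
      using AB XY om m0 by (intro mult_left_mono) auto
    finally show ?thesis using s 1 by blast
  next
    case False
    define s where "s = b' * r"
    have s: "0 < s" "s \<le> r" using b' r by (auto simp: s_def mult_left_le_one_le)
    have "(Q\<^sup>2 + k\<^sup>2) * s\<^sup>2 \<le> ((Q + 2 * (4 * c + 1)) * b')\<^sup>2"
    proof -
      have "Q * r \<le> Q" using Q r by (simp add: mult_left_le)
      then have "(Q * r)\<^sup>2 \<le> Q\<^sup>2" using Q r by (intro power_mono) auto
      moreover have "(r * k)\<^sup>2 \<le> (2 * (4 * c + 1))\<^sup>2" using False r kpos by (intro power_mono) auto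
      moreover have "Q * (2 * (4 * c + 1)) \<ge> 0" using Q c by simp
      ultimately have "(Q * r)\<^sup>2 + (r * k)\<^sup>2 \<le> (Q + 2 * (4 * c + 1))\<^sup>2" unfolding power2_sum by linarith
      then have "((Q * r)\<^sup>2 + (r * k)\<^sup>2) * b'\<^sup>2 \<le> (Q + 2 * (4 * c + 1))\<^sup>2 * b'\<^sup>2" by (rule mult_right_mono) simp
      moreover have "(Q\<^sup>2 + k\<^sup>2) * s\<^sup>2 = ((Q * r)\<^sup>2 + (r * k)\<^sup>2) * b'\<^sup>2"
        by (simp add: s_def power_mult_distrib algebra_simps)
      ultimately show ?thesis by (simp only: power_mult_distrib)
    qed
    also have "(Q + 2 * (4 * c + 1)) * b' = 1 / 2 ^ ?d" using Q c by (simp add: b'_def)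
    finally have 1: "(Q\<^sup>2 + k\<^sup>2) * s\<^sup>2 / 2 \<le> \<theta>" using small[of "1 / 2 ^ ?d"] by simp
    have "(b' ^ ?d * r ^ ?d) * (cmod (M s))\<^sup>2 \<le> ?om * m"
      using M_mass[OF s] by (simp add: s_def power_mult_distrib)
    then have "(cmod (M s))\<^sup>2 \<le> ?om * m * (B * Y)"
      using b' r unfolding B_def Y_def by (simp add: field_simps)
    also have "\<dots> \<le> ?om * m * (A * X + B * Y)"
      using AB XY om m0 by (intro mult_left_mono) auto
    finally show ?thesis using s 1 by blast
  qed
  then obtain s where s: "0 < s" "s \<le> r" "(Q\<^sup>2 + k\<^sup>2) * s\<^sup>2 / 2 \<le> \<theta>"
    and Ms: "(cmod (M s))\<^sup>2 \<le> ?om * m * (A * X + B * Y)" by blast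
  have "(cmod (\<psi> x))\<^sup>2 \<le> 2 * (cmod (M s))\<^sup>2 / ?om\<^sup>2 + 2 * \<theta>\<^sup>2 * S\<^sup>2"
    by (rule value_le_mean[OF s])
  also have "2 * (cmod (M s))\<^sup>2 / ?om\<^sup>2 \<le> 2 * (?om * m * (A * X + B * Y)) / ?om\<^sup>2"
    using Ms by (intro divide_right_mono mult_left_mono) auto
  also have "\<dots> = 2 / ?om * (A * X + B * Y) * m"
    using om by (simp add: power2_eq_square)
  also have "\<dots> \<le> 2 / ?om * ((A + B) * (X + Y)) * m"
    using AB XY om m0 by (intro mult_right_mono mult_left_mono) (auto simp: algebra_simps)
  finally have "(cmod (\<psi> x))\<^sup>2 \<le> 2 / ?om * ((A + B) * (X + Y)) * m + 2 * \<theta>\<^sup>2 * S\<^sup>2" by simp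
  moreover have "2 / ?om * ((A + B) * (X + Y)) * m = 2 / ?om * (A + B) * (X + Y) * m"
    by (simp only: mult.assoc)
  ultimately show ?thesis
    using \<theta> unfolding lc A_def[symmetric] B_def[symmetric] X_def[symmetric] Y_def[symmetric] by linarith
qed

end

text \<open>The supremum in \<open>local_bound\<close> is absorbed by applying that lemma at a maximum \<open>z\<close> of \<open>\<bar>\<psi>\<bar>\<^sup>2\<close> times the \<open>d\<close>-th power of
  the distance to the boundary of the ball: within half of that distance from \<open>z\<close> one has
  \<open>\<bar>\<psi>\<bar>\<^sup>2 \<le> 2\<^sup>d \<bar>\<psi> z\<bar>\<^sup>2\<close>. Passing back to the centre loses nothing, since \<open>k\<^sup>d\<^sup>-\<^sup>1 \<rho>\<^sup>d\<^sup>-\<^sup>1 + 1\<close> increases with \<open>\<rho>\<close>.\<close>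

lemma interior_bound:
  fixes U :: "(real^'d::finite) set"
  assumes U: "open U" "cball x0 r \<subseteq> U" and r: "0 < r" "r \<le> 1"
    and \<psi>: "Ck_on 3 U \<psi>" and V: "continuous_on U V" and Q: "Q \<ge> 0"
    and V_le: "\<And>z. z \<in> cball x0 r \<Longrightarrow> cmod (V z) \<le> Q\<^sup>2"
    and pde: "\<And>z. z \<in> U \<Longrightarrow> - laplacian \<psi> z + V z * \<psi> z = lam * \<psi> z"
    and lam: "cmod lam = k\<^sup>2" and k: "k \<ge> 1"
  shows "(cmod (\<psi> x0))\<^sup>2 \<le> 2 ^ (CARD('d) + 1) * local_const TYPE('d) Q *
    (k ^ (CARD('d) - 1) / r + 1 / r ^ CARD('d)) * mass \<psi> x0 r"
proof -
  let ?d = "CARD('d)"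
  let ?C = "local_const TYPE('d) Q" and ?m = "mass \<psi> x0 r"
  have d1: "?d \<ge> 1" by (simp add: Suc_leI)
  have kpos: "k > 0" using k by simp
  have C: "?C > 0" by (rule local_const_pos[OF Q])
  have m: "?m \<ge> 0" by (rule mass_nonneg)
  have c\<psi>: "continuous_on (cball x0 r) \<psi>" using Ck_on_imp_continuous[OF \<psi>] U(2) by (rule continuous_on_subset)
  define f where "f = (\<lambda>z. (cmod (\<psi> z))\<^sup>2 * (r - dist z x0) ^ ?d)"
  have "continuous_on (cball x0 r) f" unfolding f_def by (intro continuous_intros c\<psi>)
  from continuous_attains_sup[OF compact_cball _ this] r
  obtain z where z: "z \<in> cball x0 r" and max: "\<And>y. y \<in> cball x0 r \<Longrightarrow> f y \<le> f z" by auto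
  define \<delta> where "\<delta> = r - dist z x0"
  have f0: "(cmod (\<psi> x0))\<^sup>2 * r ^ ?d \<le> f z" using max[of x0] r by (simp add: f_def)
  have fz: "f z \<le> 2 ^ (?d + 1) * ?C * (k ^ (?d - 1) * r ^ (?d - 1) + 1) * ?m"
  proof (cases "\<delta> \<le> 0")
    case True
    then have "\<delta> = 0" using z by (simp add: \<delta>_def dist_commute)
    then have "f z = 0" using d1 by (simp add: f_def \<delta>_def)
    then show ?thesis using C m kpos r by simp
  next
    case False
    define \<rho> where "\<rho> = \<delta> / 2"
    have \<delta>: "0 < \<delta>" "\<delta> \<le> r" using False by (auto simp: \<delta>_def)
    then have \<rho>: "0 < \<rho>" "\<rho> \<le> r" "2 * \<rho> = \<delta>" using r by (auto simp: \<rho>_def)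
    define S where "S = sqrt (2 ^ ?d * (cmod (\<psi> z))\<^sup>2)"
    have sub\<delta>: "cball z \<delta> \<subseteq> cball x0 r"
    proof
      fix y assume "y \<in> cball z \<delta>"
      then show "y \<in> cball x0 r"
        using dist_triangle[of x0 y z] by (simp add: \<delta>_def dist_commute)
    qed
    have sub\<rho>: "cball z \<rho> \<subseteq> cball x0 r" using sub\<delta> \<rho> subset_cball[of \<rho> \<delta> z] by auto
    interpret e: eigenball U \<psi> V lam z \<rho> Q S k
    proof
      show "cball z (2 * \<rho>) \<subseteq> U" using sub\<delta> U(2) \<rho>(3) by auto
      show "cmod (V y) \<le> Q\<^sup>2" if "y \<in> cball z \<rho>" for y using V_le sub\<rho> that by blast
      show "cmod (\<psi> y) \<le> S" if y: "y \<in> cball z \<rho>" for y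
      proof -
        have yr: "y \<in> cball x0 r" using y sub\<rho> by blast
        have "dist y x0 \<le> dist y z + dist z x0" by (rule dist_triangle)
        then have ge: "\<rho> \<le> r - dist y x0" using y by (simp add: \<rho>_def \<delta>_def dist_commute)
        have "(cmod (\<psi> y))\<^sup>2 * \<rho> ^ ?d \<le> f y"
          unfolding f_def using ge \<rho> by (intro mult_left_mono power_mono) auto
        also have "\<dots> \<le> f z" by (rule max[OF yr])
        also have "f z = 2 ^ ?d * (cmod (\<psi> z))\<^sup>2 * \<rho> ^ ?d"
          unfolding f_def \<delta>_def[symmetric] \<rho>(3)[symmetric] by (simp add: power_mult_distrib)
        finally have "(cmod (\<psi> y))\<^sup>2 \<le> 2 ^ ?d * (cmod (\<psi> z))\<^sup>2" using \<rho> by simp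
        then show ?thesis unfolding S_def by (rule real_le_rsqrt)
      qed
    qed (use U \<psi> V Q pde lam k \<rho> r in auto)
    have mz: "mass \<psi> z \<rho> \<le> ?m" by (rule mass_mono[OF c\<psi> sub\<rho>])
    have "(cmod (\<psi> z))\<^sup>2 \<le> ?C * (k ^ (?d - 1) / \<rho> + 1 / \<rho> ^ ?d) * mass \<psi> z \<rho> + S\<^sup>2 / 2 ^ (?d + 1)"
      by (rule e.local_bound)
    also have "S\<^sup>2 / 2 ^ (?d + 1) = (cmod (\<psi> z))\<^sup>2 / 2" by (simp add: S_def)
    finally have "(cmod (\<psi> z))\<^sup>2 \<le> 2 * (?C * (k ^ (?d - 1) / \<rho> + 1 / \<rho> ^ ?d) * mass \<psi> z \<rho>)" by simp
    also have "\<dots> \<le> 2 * (?C * (k ^ (?d - 1) / \<rho> + 1 / \<rho> ^ ?d) * ?m)"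
      using mz C kpos \<rho> by (intro mult_left_mono) auto
    finally have "f z \<le> 2 * (?C * (k ^ (?d - 1) / \<rho> + 1 / \<rho> ^ ?d) * ?m) * \<delta> ^ ?d"
      unfolding f_def \<delta>_def[symmetric] using \<delta> by (intro mult_right_mono) auto
    also have "\<dots> = 2 ^ (?d + 1) * ?C * ((k ^ (?d - 1) / \<rho> + 1 / \<rho> ^ ?d) * \<rho> ^ ?d) * ?m"
      unfolding \<rho>(3)[symmetric] by (simp add: power_mult_distrib)
    also have "(k ^ (?d - 1) / \<rho> + 1 / \<rho> ^ ?d) * \<rho> ^ ?d = k ^ (?d - 1) * \<rho> ^ (?d - 1) + 1"
    proof -
      have "\<rho> ^ ?d = \<rho> * \<rho> ^ (?d - 1)" using d1 by (simp flip: power_Suc)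
      then show ?thesis using \<rho> by (simp add: distrib_right)
    qed
    also have "2 ^ (?d + 1) * ?C * (k ^ (?d - 1) * \<rho> ^ (?d - 1) + 1) * ?m \<le> 2 ^ (?d + 1) * ?C * (k ^ (?d - 1) * r ^ (?d - 1) + 1) * ?m"
      using C m kpos \<rho> by (intro mult_right_mono mult_left_mono add_right_mono power_mono) auto
    finally show ?thesis .
  qed
  have "r ^ ?d = r * r ^ (?d - 1)" using d1 by (simp flip: power_Suc)
  then have e: "k ^ (?d - 1) * r ^ (?d - 1) + 1 = (k ^ (?d - 1) / r + 1 / r ^ ?d) * r ^ ?d"
    using r by (simp add: distrib_right)
  have "(cmod (\<psi> x0))\<^sup>2 * r ^ ?d \<le> (2 ^ (?d + 1) * ?C * (k ^ (?d - 1) / r + 1 / r ^ ?d) * ?m) * r ^ ?d"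
    using order_trans[OF f0 fz] unfolding e by (simp only: mult_ac)
  then show ?thesis using r by simp
qed

lemma cmod_le_L2_norm_on:
  fixes \<psi> :: "real^'d::finite \<Rightarrow> complex"
  assumes c: "continuous_on (cball x0 s) \<psi>" and sub: "cball x0 s \<subseteq> B" and C: "C > 0"
    and le: "(cmod a)\<^sup>2 \<le> C\<^sup>2 * mass \<psi> x0 s"
  shows "ennreal (cmod a) \<le> ennreal C * L2_norm_on B \<psi>"
proof -
  define I where "I = (\<integral>\<^sup>+x\<in>B. ennreal ((cmod (\<psi> x))\<^sup>2) \<partial>lebesgue)"
  show ?thesis
  proof (cases "I = \<infinity>")
    case True
    then show ?thesis using C by (simp add: L2_norm_on_def I_def[symmetric] Let_def ennreal_mult_top)
  next
    case False
    have "ennreal (mass \<psi> x0 s) = (\<integral>\<^sup>+z. ennreal (indicator (cball x0 s) z *\<^sub>R (cmod (\<psi> z))\<^sup>2) \<partial>lborel)"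
      unfolding mass_def using c
      by (intro nn_integral_eq_integral[symmetric] borel_integrable_compact continuous_intros AE_I2) (auto simp: indicator_def)
    also have "\<dots> = (\<integral>\<^sup>+z. ennreal (indicator (cball x0 s) z *\<^sub>R (cmod (\<psi> z))\<^sup>2) \<partial>lebesgue)"
      by (simp add: nn_integral_completion)
    also have "\<dots> \<le> I"
      unfolding I_def using sub by (intro nn_integral_mono) (auto simp: indicator_def)
    finally have "mass \<psi> x0 s \<le> enn2real I"
      using False mass_nonneg[of \<psi> x0 s] by (metis enn2real_ennreal enn2real_mono infinity_ennreal_def less_top)
    then have "(cmod a)\<^sup>2 \<le> C\<^sup>2 * enn2real I"
      using le C by (meson order_trans mult_left_mono zero_le_power2)
    then have "cmod a \<le> sqrt (C\<^sup>2 * enn2real I)" by (rule real_le_rsqrt)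
    also have "\<dots> = C * sqrt (enn2real I)" using C by (simp add: real_sqrt_mult)
    finally have "ennreal (cmod a) \<le> ennreal (C * sqrt (enn2real I))" by (rule ennreal_leI)
    also have "\<dots> = ennreal C * L2_norm_on B \<psi>"
      using C False by (simp add: L2_norm_on_def I_def[symmetric] Let_def ennreal_mult)
    finally show ?thesis .
  qed
qed

section \<open>Bounds uniform in the spectral parameter\<close>

text \<open>If \<open>y\<close> is at most \<open>L powr (\<delta> / 2)\<close>, the factor \<open>y\<close> costs only the loss \<open>\<delta>\<close> in the exponent of
  \<open>L\<close>. Otherwise \<open>L\<close> is bounded by a power of \<open>y\<close>, and \<open>\<alpha> > d / \<delta>\<close> makes \<open>4 \<alpha>\<close> exceed the resulting exponent
  \<open>1 + (d - 1) / \<delta>\<close>.\<close>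

lemma power_tradeoff:
  fixes L y \<delta> :: real and d \<alpha> :: nat
  assumes \<delta>: "\<delta> > 0" and \<alpha>: "real \<alpha> > real d / \<delta>" "d \<le> 4 * \<alpha>" and d: "d \<ge> 1" and y: "y \<ge> 1" and L: "L \<ge> 1"
  shows "L powr ((real d - 1) / 2) * y + y ^ d \<le> L powr ((real d - 1 + \<delta>) / 2) + 2 * y ^ (4 * \<alpha>)"
proof -
  have \<alpha>1: "\<alpha> \<ge> 1"
  proof -
    have "real d / \<delta> > 0" using d \<delta> by simp
    then show ?thesis using \<alpha>(1) by (cases \<alpha>) auto
  qed
  have yd: "y ^ d \<le> y ^ (4 * \<alpha>)" using \<alpha>(2) y by (rule power_increasing)
  have "L powr ((real d - 1) / 2) * y \<le> L powr ((real d - 1 + \<delta>) / 2) + y ^ (4 * \<alpha>)"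
  proof (cases "y \<le> L powr (\<delta> / 2)")
    case True
    then have "L powr ((real d - 1) / 2) * y \<le> L powr ((real d - 1) / 2) * L powr (\<delta> / 2)"
      by (intro mult_left_mono) auto
    also have "\<dots> = L powr ((real d - 1 + \<delta>) / 2)"
      by (simp add: powr_add[symmetric] add_divide_distrib)
    finally show ?thesis using y by (simp add: add_increasing2)
  next
    case False
    then have "(L powr (\<delta> / 2)) powr (2 / \<delta>) \<le> y powr (2 / \<delta>)"
      using \<delta> by (intro powr_mono2) auto
    then have Ly: "L \<le> y powr (2 / \<delta>)" using \<delta> L by (simp add: powr_powr)
    have "L powr ((real d - 1) / 2) * y \<le> (y powr (2 / \<delta>)) powr ((real d - 1) / 2) * y powr 1"
      using Ly L d y by (intro mult_mono powr_mono2) auto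
    also have "\<dots> = y powr ((real d - 1) / \<delta> + 1)"
    proof -
      have "2 / \<delta> * ((real d - 1) / 2) = (real d - 1) / \<delta>" using \<delta> by (simp add: field_simps)
      then show ?thesis by (simp only: powr_powr powr_add)
    qed
    also have "\<dots> \<le> y powr (real (4 * \<alpha>))"
    proof (rule powr_mono)
      have "(real d - 1) / \<delta> \<le> real d / \<delta>" using \<delta> by (simp add: divide_right_mono)
      then show "(real d - 1) / \<delta> + 1 \<le> real (4 * \<alpha>)" using \<alpha>(1) \<alpha>1 by simp
    qed (use y in simp)
    also have "\<dots> = y ^ (4 * \<alpha>)" using y by (simp only: powr_realpow)
    finally show ?thesis by (simp add: add_increasing)
  qed
  with yd show ?thesis by simp
qed

lemma compact_cball_neighbourhood:
  fixes K :: "'a::euclidean_space set"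
  assumes "compact K" "open \<Omega>" "K \<subseteq> \<Omega>"
  obtains e K' where "e > 0" "compact K'" "K' \<subseteq> \<Omega>" "\<And>x. x \<in> K \<Longrightarrow> cball x e \<subseteq> K'"
proof -
  obtain e where e: "e > 0" "(\<Union>x\<in>K. cball x e) \<subseteq> \<Omega>"
    using compact_subset_open_imp_cball_epsilon_subset[OF assms] by blast
  have "(\<Union>x\<in>K. cball x e) = {x + y |x y. x \<in> K \<and> y \<in> cball 0 e}"
  proof (intro equalityI subsetI)
    fix z assume "z \<in> (\<Union>x\<in>K. cball x e)"
    then obtain x where "x \<in> K" "z \<in> cball x e" by blast
    then have "z = x + (z - x)" "x \<in> K" "z - x \<in> cball 0 e" by (auto simp: dist_norm norm_minus_commute)
    then show "z \<in> {x + y |x y. x \<in> K \<and> y \<in> cball 0 e}" by blast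
  next
    fix z assume "z \<in> {x + y |x y. x \<in> K \<and> y \<in> cball 0 e}"
    then obtain x y where "z = x + y" "x \<in> K" "norm y \<le> e" by auto
    then show "z \<in> (\<Union>x\<in>K. cball x e)" by (intro UN_I[of x]) (auto simp: dist_norm)
  qed
  then have "compact (\<Union>x\<in>K. cball x e)"
    using compact_sums[OF assms(1) compact_cball, of 0 e] by simp
  then show ?thesis using that e by blast
qed

text \<open>The bound without loss, for \<open>r\<close> truncated at a radius \<open>r0\<close> for which the balls about \<open>K\<close> stay in a
  compact part of \<open>\<Omega>\<close>, where \<open>V\<close> is bounded. Halving the radius gives a closed ball inside the open one.\<close>

lemma eigenfunction_sup_bound:
  fixes \<Omega> :: "(real^'d::finite) set" and V :: "real^'d \<Rightarrow> complex"
  assumes \<Omega>: "open \<Omega>" and V: "smooth_on \<Omega> V" and K: "compact K" "K \<subseteq> \<Omega>"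
  obtains r0 C where "0 < r0" "r0 \<le> 1" "C > 0"
    "\<And>lam \<psi> r x0. cmod lam \<ge> 1 \<Longrightarrow> smooth_eigensolution \<Omega> V lam \<psi> \<Longrightarrow> 0 < r \<Longrightarrow> x0 \<in> K \<Longrightarrow> ball x0 r \<subseteq> \<Omega> \<Longrightarrow>
      (cmod (\<psi> x0))\<^sup>2 \<le> C * (cmod lam powr ((real CARD('d) - 1) / 2) * (2 / min r r0) + (2 / min r r0) ^ CARD('d))
        * mass \<psi> x0 (min r r0 / 2)"
proof -
  let ?d = "CARD('d)"
  obtain e K' where e: "e > 0" "compact K'" "K' \<subseteq> \<Omega>" "\<And>x. x \<in> K \<Longrightarrow> cball x e \<subseteq> K'"
    using compact_cball_neighbourhood[OF K(1) \<Omega> K(2)] by metis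
  have cV: "continuous_on \<Omega> V" using V Ck_on_imp_continuous[of 0] unfolding smooth_on_def by blast
  have "compact (V ` K')" using continuous_on_subset[OF cV e(3)] e(2) by (rule compact_continuous_image)
  then have "bounded (V ` K')" by (rule compact_imp_bounded)
  then obtain B where B: "\<And>z. z \<in> K' \<Longrightarrow> cmod (V z) \<le> B"
    unfolding bounded_iff by blast
  define Q where "Q = sqrt \<bar>B\<bar>"
  have Q: "Q \<ge> 0" "Q\<^sup>2 = \<bar>B\<bar>" by (auto simp: Q_def)
  define C where "C = 2 ^ (?d + 1) * local_const TYPE('d) Q"
  have C: "C > 0" unfolding C_def using local_const_pos[OF Q(1), where 'd = 'd] by simp
  show ?thesis
  proof (rule that[of "min e 1" C])
    fix lam \<psi> and r :: real and x0
    assume lam: "cmod lam \<ge> 1" and \<psi>: "smooth_eigensolution \<Omega> V lam \<psi>" and r: "0 < r" and x0: "x0 \<in> K" "ball x0 r \<subseteq> \<Omega>"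
    define \<rho> where "\<rho> = min r (min e 1) / 2"
    have \<rho>: "0 < \<rho>" "\<rho> \<le> 1" "\<rho> \<le> e" "\<rho> < r" using r e(1) by (auto simp: \<rho>_def min_def)
    have "cball x0 \<rho> \<subseteq> cball x0 e" using \<rho> by (intro subset_cball)
    then have sub: "cball x0 \<rho> \<subseteq> K'" using e(4)[OF x0(1)] by blast
    define k where "k = sqrt (cmod lam)"
    have k: "k \<ge> 1" "cmod lam = k\<^sup>2" using lam by (auto simp: k_def)
    have kd: "k ^ (?d - 1) = cmod lam powr ((real ?d - 1) / 2)"
    proof -
      have "k > 0" using k by simp
      then have "k ^ (?d - 1) = k powr (real (?d - 1))" by (rule powr_realpow[symmetric])
      also have "\<dots> = (cmod lam powr (1 / 2)) powr (real ?d - 1)"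
        using lam by (simp add: k_def powr_half_sqrt of_nat_diff Suc_leI)
      finally show ?thesis by (simp add: powr_powr)
    qed
    have "(cmod (\<psi> x0))\<^sup>2 \<le> 2 ^ (?d + 1) * local_const TYPE('d) Q * (k ^ (?d - 1) / \<rho> + 1 / \<rho> ^ ?d) * mass \<psi> x0 \<rho>"
    proof (rule interior_bound[OF \<Omega>])
      show "cball x0 \<rho> \<subseteq> \<Omega>" using sub e(3) by blast
      show "Ck_on 3 \<Omega> \<psi>" using \<psi> unfolding smooth_eigensolution_def smooth_on_def by blast
      show "- laplacian \<psi> z + V z * \<psi> z = lam * \<psi> z" if "z \<in> \<Omega>" for z
        using \<psi> that unfolding smooth_eigensolution_def by blast
      show "cmod (V z) \<le> Q\<^sup>2" if "z \<in> cball x0 \<rho>" for z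
        using B[of z] sub that Q(2) by force
    qed (use \<rho> cV Q k in auto)
    then show "(cmod (\<psi> x0))\<^sup>2 \<le> C * (cmod lam powr ((real ?d - 1) / 2) * (2 / min r (min e 1)) + (2 / min r (min e 1)) ^ ?d)
        * mass \<psi> x0 (min r (min e 1) / 2)"
      unfolding kd C_def \<rho>_def by (simp add: power_divide)
  qed (use e C in auto)
qed

lemma L2_bound:
  fixes \<Omega> :: "(real^'d::finite) set" and V :: "real^'d \<Rightarrow> complex"
  assumes \<Omega>: "open \<Omega>" and V: "smooth_on \<Omega> V" and K: "compact K" "K \<subseteq> \<Omega>"
    and \<delta>: "\<delta> > 0" and \<alpha>: "real \<alpha> > real CARD('d) / \<delta>" "CARD('d) \<le> 4 * \<alpha>"
  shows "\<exists>C::real. C > 0 \<and>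
    (\<forall>lam \<psi>. cmod lam \<ge> 1 \<longrightarrow> smooth_eigensolution \<Omega> V lam \<psi> \<longrightarrow>
      (\<forall>r>0. \<forall>x0\<in>K. ball x0 r \<subseteq> \<Omega> \<longrightarrow>
        ennreal (cmod (\<psi> x0)) \<le>
          ennreal (C * (r powi (- 2 * int \<alpha>) + cmod lam powr ((real CARD('d) - 1 + \<delta>) / 4)))
          * L2_norm_on (ball x0 r) \<psi>))"
proof -
  let ?d = "CARD('d)"
  obtain r0 C where r0: "0 < r0" "r0 \<le> 1" and C: "C > 0" and
    bnd: "\<And>lam \<psi> r x0. cmod lam \<ge> 1 \<Longrightarrow> smooth_eigensolution \<Omega> V lam \<psi> \<Longrightarrow> 0 < r \<Longrightarrow> x0 \<in> K \<Longrightarrow> ball x0 r \<subseteq> \<Omega> \<Longrightarrow>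
      (cmod (\<psi> x0))\<^sup>2 \<le> C * (cmod lam powr ((real ?d - 1) / 2) * (2 / min r r0) + (2 / min r r0) ^ ?d)
        * mass \<psi> x0 (min r r0 / 2)"
    using eigenfunction_sup_bound[OF \<Omega> V K] by metis
  define C2 where "C2 = C * (1 + 2 * (2 / r0) ^ (4 * \<alpha>))"
  have C2: "C2 > 0" unfolding C2_def using C r0 by (simp add: add_pos_nonneg)
  have main: "ennreal (cmod (\<psi> x0)) \<le> ennreal (sqrt C2 * (r powi (- 2 * int \<alpha>) + cmod lam powr ((real ?d - 1 + \<delta>) / 4)))
          * L2_norm_on (ball x0 r) \<psi>"
    if lam: "cmod lam \<ge> 1" and \<psi>: "smooth_eigensolution \<Omega> V lam \<psi>" and r: "r > 0" and x0: "x0 \<in> K" "ball x0 r \<subseteq> \<Omega>"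
    for lam \<psi> r x0
  proof -
    define X where "X = r powi (- 2 * int \<alpha>)"
    define Y where "Y = cmod lam powr ((real ?d - 1 + \<delta>) / 4)"
    have d1: "?d \<ge> 1" by (simp add: Suc_leI)
    have Xeq: "X = (1 / r) ^ (2 * \<alpha>)"
      using r by (simp add: X_def power_int_minus power_int_def nat_mult_distrib inverse_eq_divide power_one_over)
    have X: "X > 0" using r by (simp add: Xeq)
    have Y: "Y \<ge> 1" unfolding Y_def using lam \<delta> d1 by (intro ge_one_powr_ge_zero) auto
    define y where "y = 2 / min r r0"
    have y: "y \<ge> 1" using r r0 by (simp add: y_def min_def)
    have Y2: "cmod lam powr ((real ?d - 1 + \<delta>) / 2) = Y\<^sup>2"
      unfolding Y_def using lam by (simp add: power2_eq_square flip: powr_add)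
    have y4: "y ^ (4 * \<alpha>) \<le> (2 / r0) ^ (4 * \<alpha>) * (X\<^sup>2 + Y\<^sup>2)"
    proof (cases "r \<le> r0")
      case True
      have "y ^ (4 * \<alpha>) = 2 ^ (4 * \<alpha>) * X\<^sup>2"
        using True by (simp add: y_def Xeq power_divide power_mult[symmetric] mult.commute)
      also have "\<dots> \<le> (2 / r0) ^ (4 * \<alpha>) * (X\<^sup>2 + Y\<^sup>2)"
        using r0 by (intro mult_mono power_mono) (auto simp: pos_le_divide_eq)
      finally show ?thesis .
    next
      case False
      have "y ^ (4 * \<alpha>) = (2 / r0) ^ (4 * \<alpha>) * 1" using False by (simp add: y_def)
      also have "\<dots> \<le> (2 / r0) ^ (4 * \<alpha>) * (X\<^sup>2 + Y\<^sup>2)"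
        using r0 Y by (intro mult_left_mono) (auto simp: one_le_power add_increasing)
      finally show ?thesis .
    qed
    have "cmod lam powr ((real ?d - 1) / 2) * y + y ^ ?d \<le> Y\<^sup>2 + 2 * y ^ (4 * \<alpha>)"
      using power_tradeoff[OF \<delta> \<alpha> d1 y lam] unfolding Y2 .
    also have "\<dots> \<le> 1 * (X\<^sup>2 + Y\<^sup>2) + 2 * ((2 / r0) ^ (4 * \<alpha>) * (X\<^sup>2 + Y\<^sup>2))"
      using y4 by (intro add_mono mult_left_mono) auto
    also have "\<dots> = (1 + 2 * (2 / r0) ^ (4 * \<alpha>)) * (X\<^sup>2 + Y\<^sup>2)"
      by (simp add: distrib_right)
    also have "\<dots> \<le> (1 + 2 * (2 / r0) ^ (4 * \<alpha>)) * (X + Y)\<^sup>2"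
      using X Y r0 by (intro mult_left_mono) (auto simp: power2_sum)
    finally have "C * (cmod lam powr ((real ?d - 1) / 2) * y + y ^ ?d) \<le> C2 * (X + Y)\<^sup>2"
      using C by (simp add: C2_def mult.assoc)
    then have "C * (cmod lam powr ((real ?d - 1) / 2) * y + y ^ ?d) * mass \<psi> x0 (min r r0 / 2) \<le>
        C2 * (X + Y)\<^sup>2 * mass \<psi> x0 (min r r0 / 2)"
      by (rule mult_right_mono) (rule mass_nonneg)
    with bnd[OF lam \<psi> r x0] have le: "(cmod (\<psi> x0))\<^sup>2 \<le> (sqrt C2 * (X + Y))\<^sup>2 * mass \<psi> x0 (min r r0 / 2)"
      using C2 by (simp add: y_def power_mult_distrib)
    have sub: "cball x0 (min r r0 / 2) \<subseteq> ball x0 r" using r r0 by (auto simp: min_def split: if_splits)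
    have "Ck_on 0 \<Omega> \<psi>" using \<psi> unfolding smooth_eigensolution_def smooth_on_def by blast
    then have "continuous_on (cball x0 (min r r0 / 2)) \<psi>"
      using sub x0(2) by (auto intro: continuous_on_subset)
    from cmod_le_L2_norm_on[OF this sub _ le] C2 X Y show ?thesis
      unfolding X_def Y_def by simp
  qed
  show ?thesis
    by (rule exI[of _ "sqrt C2"]) (use main C2 in auto)
qed

lemma eventually_at_infinity_in: "\<forall>\<^sub>F lam in at_infinity_in \<Lambda>. lam \<in> \<Lambda> \<and> B \<le> cmod lam"
  unfolding at_infinity_in_def eventually_inf_principal
  by (rule eventually_mono[OF eventually_at_infinityI[of B]]) auto

text \<open>The left-hand side is \<open>\<bar>lam\<bar> powr (2 \<alpha> \<eta>)\<close>. The exponent \<open>2 \<alpha> \<eta>\<close> tends to zero, so it is eventually below any positive number; \<open>e / 2\<close> leaves room for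
  the \<open>o\<close>-estimate below.\<close>

lemma slowly_decaying_power:
  assumes dec: "slowly_decaying \<Lambda> r" and pos: "\<forall>lam\<in>\<Lambda>. r lam > 0" and e: "e > 0"
  shows "\<forall>\<^sub>F lam in at_infinity_in \<Lambda>. r lam powi (- 2 * int \<alpha>) \<le> cmod lam powr (e / 2)"
proof -
  from dec obtain \<eta> where \<eta>: "\<eta> \<in> o[at_infinity_in \<Lambda>](\<lambda>_. 1 :: real)"
    and eq: "\<forall>\<^sub>F lam in at_infinity_in \<Lambda>. inverse (r lam) = cmod lam powr \<eta> lam"
    unfolding slowly_decaying_def by blast
  define c where "c = e / (4 * (real \<alpha> + 1))"
  have c: "c > 0" using e by (simp add: c_def)
  have "2 * real \<alpha> * c \<le> e / 2" using e by (simp add: c_def field_simps)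
  have "\<forall>\<^sub>F lam in at_infinity_in \<Lambda>. norm (\<eta> lam) \<le> c * norm (1::real)"
    using landau_o.smallD[OF \<eta> c] .
  then show ?thesis using eq eventually_at_infinity_in[of \<Lambda> 1]
  proof eventually_elim
    case (elim lam)
    have rp: "r lam > 0" using elim pos by blast
    have "r lam powi (- 2 * int \<alpha>) = inverse (r lam) ^ (2 * \<alpha>)"
      using rp by (simp add: power_int_minus power_int_def nat_mult_distrib power_inverse)
    also have "\<dots> = (cmod lam powr \<eta> lam) ^ (2 * \<alpha>)" using elim by simp
    also have "\<dots> = cmod lam powr (\<eta> lam * real (2 * \<alpha>))"
      using elim by (subst powr_powr[symmetric], subst powr_realpow) auto
    also have "\<dots> \<le> cmod lam powr (e / 2)"
    proof (rule powr_mono)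
      have "\<eta> lam * real (2 * \<alpha>) \<le> c * real (2 * \<alpha>)" using elim by (intro mult_right_mono) auto
      then show "\<eta> lam * real (2 * \<alpha>) \<le> e / 2" using \<open>2 * real \<alpha> * c \<le> e / 2\<close> by (simp add: mult_ac)
    qed (use elim in simp)
    finally show ?case .
  qed
qed

lemma slowly_decaying_smallo:
  assumes dec: "slowly_decaying \<Lambda> r" and pos: "\<forall>lam\<in>\<Lambda>. r lam > 0" and e: "e > 0"
  shows "(\<lambda>lam. r lam powi (- 2 * int \<alpha>)) \<in> o[at_infinity_in \<Lambda>](\<lambda>lam. cmod lam powr e)"
proof (rule landau_o.smallI)
  fix c :: real assume c: "c > 0"
  show "\<forall>\<^sub>F lam in at_infinity_in \<Lambda>. norm (r lam powi (- 2 * int \<alpha>)) \<le> c * norm (cmod lam powr e)"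
    using slowly_decaying_power[OF dec pos e, of \<alpha>] eventually_at_infinity_in[of \<Lambda> "max 1 ((1 / c) powr (2 / e))"]
  proof eventually_elim
    case (elim lam)
    have rp: "r lam > 0" using elim pos by blast
    have L: "cmod lam \<ge> 1" "(1 / c) powr (2 / e) \<le> cmod lam" using elim by auto
    have "((1 / c) powr (2 / e)) powr (e / 2) \<le> cmod lam powr (e / 2)"
      using L e by (intro powr_mono2) auto
    then have "1 / c \<le> cmod lam powr (e / 2)" using c e by (simp add: powr_powr)
    then have "1 \<le> c * cmod lam powr (e / 2)" using c by (simp add: field_simps)
    then have "1 * cmod lam powr (e / 2) \<le> c * cmod lam powr (e / 2) * cmod lam powr (e / 2)"
      by (rule mult_right_mono) simp
    also have "\<dots> = c * cmod lam powr e" by (simp add: mult.assoc flip: powr_add)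
    finally show ?case using elim rp by simp
  qed
qed

theorem mainTheorem7:
  fixes \<Omega> :: "(real^'d::finite) set" and V :: "real^'d \<Rightarrow> complex"
  assumes "open \<Omega>" and "smooth_on \<Omega> V"
  shows
    "(\<forall>(\<delta>::real) (\<alpha>::nat). \<delta> > 0 \<longrightarrow> real \<alpha> > real CARD('d) / \<delta> \<longrightarrow> CARD('d) \<le> 4 * \<alpha> \<longrightarrow>
        (\<forall>K. compact K \<longrightarrow> K \<subseteq> \<Omega> \<longrightarrow>
          (\<exists>C::real. C > 0 \<and>
            (\<forall>lam \<psi>. cmod lam \<ge> 1 \<longrightarrow> smooth_eigensolution \<Omega> V lam \<psi> \<longrightarrow>
              (\<forall>r>0. \<forall>x\<^sub>0\<in>K. ball x\<^sub>0 r \<subseteq> \<Omega> \<longrightarrow>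
                ennreal (cmod (\<psi> x\<^sub>0)) \<le>
                  ennreal (C * (r powi (- 2 * int \<alpha>)
                    + cmod lam powr ((real CARD('d) - 1 + \<delta>) / 4)))
                  * L2_norm_on (ball x\<^sub>0 r) \<psi>)))))
     \<and>
     (\<forall>(\<epsilon>::real) (\<delta>::real) (\<alpha>::nat). \<epsilon> > 0 \<longrightarrow> \<delta> = 4 * \<epsilon> \<longrightarrow> real \<alpha> > real CARD('d) / \<delta> \<longrightarrow>
        (\<forall>K. compact K \<longrightarrow> K \<subseteq> \<Omega> \<longrightarrow>
          (\<exists>C::real. C > 0 \<and>
            (\<forall>\<Lambda> r. (\<forall>lam\<in>\<Lambda>. r lam > 0) \<longrightarrow> slowly_decaying \<Lambda> r \<longrightarrow>
              (\<lambda>lam. r lam powi (- 2 * int \<alpha>))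
                \<in> o[at_infinity_in \<Lambda>](\<lambda>lam. cmod lam powr ((real CARD('d) - 1) / 4 + \<epsilon>)) \<and>
              (\<forall>\<^sub>F lam in at_infinity_in \<Lambda>.
                \<forall>\<psi>. smooth_eigensolution \<Omega> V lam \<psi> \<longrightarrow>
                  (\<forall>x\<^sub>0\<in>K. ball x\<^sub>0 (r lam) \<subseteq> \<Omega> \<longrightarrow>
                    ennreal (cmod (\<psi> x\<^sub>0)) \<le>
                      ennreal (C * cmod lam powr ((real CARD('d) - 1) / 4 + \<epsilon>))
                      * L2_norm_on (ball x\<^sub>0 (r lam)) \<psi>))))))"
proof (intro conjI allI impI, goal_cases)
  case (1 \<delta> \<alpha> K)
  then show ?case by (intro L2_bound[OF assms])
next
  case (2 \<epsilon> \<delta> \<alpha> K)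
  define e where "e = (real CARD('d) - 1) / 4 + \<epsilon>"
  have e: "e > 0" using 2(1) by (simp add: e_def Suc_leI add_nonneg_pos)
  \<comment> \<open>The first part needs \<open>d \<le> 4 \<alpha>'\<close>. Enlarging \<open>\<alpha>\<close> is harmless, because every power of \<open>1 / r\<close> is
    negligible here.\<close>
  define \<alpha>' where "\<alpha>' = max \<alpha> CARD('d)"
  have \<alpha>': "real \<alpha>' > real CARD('d) / \<delta>" "CARD('d) \<le> 4 * \<alpha>'" using 2(3) by (auto simp: \<alpha>'_def)
  have "\<delta> > 0" using 2 by simp
  from L2_bound[OF assms 2(4,5) this \<alpha>']
  obtain C where C: "C > 0" and bnd: "\<And>lam \<psi> r x0. cmod lam \<ge> 1 \<Longrightarrow> smooth_eigensolution \<Omega> V lam \<psi> \<Longrightarrow>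
      r > 0 \<Longrightarrow> x0 \<in> K \<Longrightarrow> ball x0 r \<subseteq> \<Omega> \<Longrightarrow> ennreal (cmod (\<psi> x0)) \<le>
        ennreal (C * (r powi (- 2 * int \<alpha>') + cmod lam powr ((real CARD('d) - 1 + \<delta>) / 4))) * L2_norm_on (ball x0 r) \<psi>"
    by blast
  show ?case
  proof (intro exI[of _ "2 * C"] conjI allI impI)
    show "2 * C > 0" using C by simp
    fix \<Lambda> :: "complex set" and r assume pos: "\<forall>lam\<in>\<Lambda>. r lam > 0" and dec: "slowly_decaying \<Lambda> r"
    show "(\<lambda>lam. r lam powi (- 2 * int \<alpha>)) \<in> o[at_infinity_in \<Lambda>](\<lambda>lam. cmod lam powr ((real CARD('d) - 1) / 4 + \<epsilon>))"
      unfolding e_def[symmetric] by (rule slowly_decaying_smallo[OF dec pos e])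
    show "\<forall>\<^sub>F lam in at_infinity_in \<Lambda>. \<forall>\<psi>. smooth_eigensolution \<Omega> V lam \<psi> \<longrightarrow>
      (\<forall>x\<^sub>0\<in>K. ball x\<^sub>0 (r lam) \<subseteq> \<Omega> \<longrightarrow> ennreal (cmod (\<psi> x\<^sub>0)) \<le>
         ennreal (2 * C * cmod lam powr ((real CARD('d) - 1) / 4 + \<epsilon>)) * L2_norm_on (ball x\<^sub>0 (r lam)) \<psi>)"
      using slowly_decaying_power[OF dec pos e, of \<alpha>'] eventually_at_infinity_in[of \<Lambda> 1]
    proof eventually_elim
      case (elim lam)
      have ex: "(real CARD('d) - 1 + \<delta>) / 4 = e" using 2(2) by (simp add: e_def add_divide_distrib)
      have "cmod lam powr (e / 2) \<le> cmod lam powr e" using elim e by (intro powr_mono) auto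
      then have "C * (r lam powi (- 2 * int \<alpha>') + cmod lam powr e) \<le> C * (2 * cmod lam powr e)"
        using elim C by (intro mult_left_mono) auto
      then have "ennreal (C * (r lam powi (- 2 * int \<alpha>') + cmod lam powr e)) * I \<le> ennreal (2 * C * cmod lam powr e) * I" for I
        by (intro mult_right_mono ennreal_leI) (auto simp: mult_ac)
      then show ?case
        using bnd[of lam _ "r lam"] elim pos unfolding ex e_def[symmetric] by (meson order_trans)
    qed
  qed
qed

end
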